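(* Let $(M,\mathcal D,\langle\cdot,\cdot\rangle)$ be an equiregular sub-Riemannian manifold of dimension $n$ and step $m$, with $\operatorname{rank}\mathcal D=k$. Let $X_1,\dots,X_n$ be a local adapted frame, let $\nu^1,\dots,\nu^n$ be the dual coframe, and let $B_1,\dots,B_m$ be the matrices of the frame defined from its adapted structure constants. Then, on the domain of the frame, Popp's volume $\mathcal P$ satisfies $$\mathcal P=\frac{1}{\sqrt{\prod_{j=1}^m\det B_j}}\;\nu^1\wedge\cdots\wedge\nu^n ,$$ where the equality is understood up to sign (it is an exact equality if the frame is positively oriented and $\mathcal P$ is chosen positive for the orientation of $M$).
   Context: Sub-Riemannian manifold: a triple $(M,\mathcal D,\langle\cdot,\cdot\rangle)$ where $M$ is a connected orientable smooth manifold of dimension $n\ge 3$, $\mathcal D\subset TM$ is a smooth distribution of constant rank $k<n$, and $\langle\cdot,\cdot\rangle_q$ is an inner product on $\mathcal D_q$ depending smoothly on $q$. $\mathcal D$ is assumed bracket-generating: iterated Lie brackets of smooth sections of $\mathcal D$ span $T_qM$ at every $q$. Flag: $\mathcal D^0_q=\{0\}$, $\mathcal D^1=\mathcal D$, $\mathcal D^{i+1}_q=\mathcal D^i_q+[\mathcal D^i,\mathcal D]_q$. $\mathcal D$ is equiregular if $k_i:=\dim\mathcal D^i_q$ does not depend on $q$ for every $i$ (with $k_0=0$, $k_1=k$); the step is the minimal $m$ with $\mathcal D^m=TM$. Then each $\mathcal D^i$ is a distribution. Popp's volume: for $q\in M$ and $1\le i\le m$, the linear map $$\pi_i:\otimes^i\mathcal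 D_q\to\mathcal D^i_q/\mathcal D^{i-1}_q,\qquad \pi_i(v_1\otimes\cdots\otimes v_i)=[V_1,[V_2,\dots,[V_{i-1},V_i]]]_q \bmod \mathcal D^{i-1}_q,$$ where $V_j$ is any local section of $\mathcal D$ with $V_j(q)=v_j$, is well defined and surjective ($\pi_1$ is the identity). Give $\otimes^i\mathcal D_q$ the inner product induced by that of $\mathcal D_q$, and $\mathcal D^i_q/\mathcal D^{i-1}_q$ the inner product whose norm is $\|Y\|=\min\{\|Z\| : \pi_i(Z)=Y\}$. Let $\mathrm{gr}_q(\mathcal D)=\bigoplus_{i=1}^m\mathcal D^i_q/\mathcal D^{i-1}_q$ be the orthogonal direct sum, and let $\mu_q\in\wedge^n\mathrm{gr}_q(\mathcal D)^*$ be the wedge of the elements of an orthonormal dual basis (defined up to sign). Let $\theta_q:\wedge^nT_qM\to\wedge^n\mathrm{gr}_q(\mathcal D)$ be the canonical isomorphism sending $v_1\wedge\cdots\wedge v_n$ to $\widehat\theta(v_1)\wedge\cdots\wedge\widehat\theta(v_n)$, where $v_1,\dots,v_n$ is any basis of $T_qM$ such that $v_1,\dots,v_{k_i}$ is a basis of $\mathcal D^i_q$ for all $i$, and $\widehat\theta(v_l)$ is the class of $v_l$ in $\mathcal D^{i}_q/\mathcal D^{i-1}_q$ for $k_{i-1}<l\le k_{i}$ ($\theta_q$ does not depend on the basis). Popp's volume is the $n$-form $\mathcal P$ with $\mathcal P_q=\mu_q\circ\theta_q$, the signs being chosen consistently using an orientation of $M$. Adapted frame: a local frame $X_1,\dots,X_n$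 of $TM$ such that $X_1,\dots,X_{k_i}$ is a local frame for $\mathcal D^i$ for each $i$, and $X_1,\dots,X_k$ are orthonormal. Adapted structure constants: for $j=2,\dots,m$ and $1\le i_1,\dots,i_j\le k$, the smooth functions $b^l_{i_1\dots i_j}$ with $$[X_{i_1},[X_{i_2},\dots,[X_{i_{j-1}},X_{i_j}]]]=\sum_{l=k_{j-1}+1}^{k_j}b^l_{i_1\dots i_j}X_l \bmod \mathcal D^{j-1}.$$ $B_1$ is the $k\times k$ identity matrix, and for $2\le j\le m$, $B_j$ is the square matrix of size $k_j-k_{j-1}$ with entries $[B_j]^{hl}=\sum_{i_1,\dots,i_j=1}^k b^h_{i_1\dots i_j}b^l_{i_1\dots i_j}$, $k_{j-1}<h,l\le k_j$; each $B_j$ is positive definite. *)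

theory Defs
  imports
    "HOL-Analysis.Derivative"
    "HOL-Library.Function_Algebras"
    "Jordan_Normal_Form.Determinant"
begin

section \<open>Linear algebra\<close>

instantiation "fun" :: (type, scaleR) scaleR
begin

definition "c *\<^sub>R f = (\<lambda>x. c *\<^sub>R f x)"
instance ..

end

lemma scaleR_fun_apply [simp]: "(c *\<^sub>R f) x = c *\<^sub>R f x"
  by (simp add: scaleR_fun_def)

instance "fun" :: (type, real_vector) real_vector
  by standard (simp_all add: fun_eq_iff scaleR_add_right scaleR_add_left)

definition basis_family :: "nat \<Rightarrow> (nat \<Rightarrow> 'v::real_vector) \<Rightarrow> 'v set \<Rightarrow> bool" where
  "basis_family n v V \<longleftrightarrow>
     inj_on v {..<n} \<and> independent (v ` {..<n}) \<and> span (v ` {..<n}) = V"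

definition inner_product_on :: "'v::real_vector set \<Rightarrow> ('v \<Rightarrow> 'v \<Rightarrow> real) \<Rightarrow> bool" where
  "inner_product_on V B \<longleftrightarrow>
     (\<forall>x\<in>V. \<forall>y\<in>V. \<forall>z\<in>V. \<forall>a c. B (a *\<^sub>R x + c *\<^sub>R y) z = a * B x z + c * B y z) \<and>
     (\<forall>x\<in>V. \<forall>y\<in>V. B x y = B y x) \<and>
     (\<forall>x\<in>V. x \<noteq> 0 \<longrightarrow> B x x > 0)"

text \<open>
  Quotients, tensor powers and exterior powers of a vector space are all realised through the
  canonical injection into a double dual, so that they are subspaces of function spaces.
  A linear functional on a subspace is represented by a linear functional on the whole type;
  as every functional on a subspace extends, nothing is lost.

  The class of \<open>v\<close> modulo a subspace \<open>W\<close> is the evaluation at \<open>v\<close> of the functionals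
  that vanish on \<open>W\<close> (see \<open>qclass_eq_iff\<close>).
\<close>

definition qclass :: "'v::real_vector set \<Rightarrow> 'v \<Rightarrow> ('v \<Rightarrow> real) \<Rightarrow> real" where
  "qclass W v = (\<lambda>\<alpha>. if linear \<alpha> \<and> (\<forall>w\<in>W. \<alpha> w = 0) then \<alpha> v else 0)"

lemma linear_qclass: "linear (qclass W)"
  by (rule linearI) (auto simp: qclass_def fun_eq_iff linear_add linear_scale)

lemma qclass_eq_iff:
  assumes "subspace W"
  shows "qclass W v = qclass W v' \<longleftrightarrow> v - v' \<in> W"
proof
  assume "v - v' \<in> W"
  then show "qclass W v = qclass W v'"
    by (auto simp: qclass_def fun_eq_iff dest!: bspec simp: linear_diff)
next
  assume eq: "qclass W v = qclass W v'"
  show "v - v' \<in> W"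
  proof (rule ccontr)
    assume notin: "v - v' \<notin> W"
    obtain B where B: "B \<subseteq> W" "independent B" "W \<subseteq> span B"
      using basis_exists by metis
    have sp: "span B = W"
      using B assms by (metis span_minimal subset_antisym)
    have "independent (insert (v - v') B)"
      using B(2) notin sp by (simp add: independent_insertI)
    then obtain \<alpha> :: "'a \<Rightarrow> real"
      where \<alpha>: "linear \<alpha>" "\<forall>x\<in>insert (v - v') B. \<alpha> x = (if x = v - v' then 1 else 0)"
      using linear_independent_extend[of "insert (v - v') B" "\<lambda>x. if x = v - v' then 1 else 0"]
      by blast
    have "\<alpha> w = 0" if "w \<in> W" for w
    proof (rule linear_eq_0_on_span[OF \<alpha>(1)])
      show "w \<in> span B" using that sp by simp
      show "\<alpha> x = 0" if "x \<in> B" for x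
        using \<alpha>(2) that notin B(1) by auto
    qed
    then have "\<alpha> v = \<alpha> v'"
      using fun_cong[OF eq, of \<alpha>] \<alpha>(1) by (simp add: qclass_def)
    then show False
      using \<alpha> by (simp add: linear_diff)
  qed
qed

text \<open>
  \<open>tens [v\<^sub>1, \<dots>, v\<^sub>i]\<close> is the elementary tensor and \<open>wedge [v\<^sub>1, \<dots>, v\<^sub>i]\<close> the
  decomposable multivector, as multilinear functions of \<open>i\<close> covectors.
\<close>

definition tens :: "'v::real_vector list \<Rightarrow> ('v \<Rightarrow> real) list \<Rightarrow> real" where
  "tens vs = (\<lambda>\<alpha>s. if length \<alpha>s = length vs \<and> (\<forall>\<alpha>\<in>set \<alpha>s. linear \<alpha>)
                   then \<Prod>i<length vs. (\<alpha>s ! i) (vs ! i) else 0)"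

definition tensor_power :: "nat \<Rightarrow> 'v::real_vector set \<Rightarrow> (('v \<Rightarrow> real) list \<Rightarrow> real) set" where
  "tensor_power i V = span {tens vs | vs. length vs = i \<and> set vs \<subseteq> V}"

definition wedge :: "'v::real_vector list \<Rightarrow> ('v \<Rightarrow> real) list \<Rightarrow> real" where
  "wedge vs = (\<lambda>\<alpha>s. if length \<alpha>s = length vs \<and> (\<forall>\<alpha>\<in>set \<alpha>s. linear \<alpha>)
                    then det (mat (length vs) (length vs) (\<lambda>(i, j). (\<alpha>s ! i) (vs ! j))) else 0)"

definition ext_power :: "nat \<Rightarrow> 'v::real_vector set \<Rightarrow> (('v \<Rightarrow> real) list \<Rightarrow> real) set" where
  "ext_power n V = span {wedge vs | vs. length vs = n \<and> set vs \<subseteq> V}"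

text \<open>
  The \<open>n\<close>-form \<open>\<alpha>\<^sub>1 \<and> \<dots> \<and> \<alpha>\<^sub>n\<close>, as a linear functional on the \<open>n\<close>-th exterior power:
  its value on \<open>v\<^sub>1 \<and> \<dots> \<and> v\<^sub>n\<close> is the determinant of the matrix \<open>\<alpha>\<^sub>i (v\<^sub>j)\<close>.
\<close>

definition wedge_form :: "('v::real_vector \<Rightarrow> real) list \<Rightarrow> (('v \<Rightarrow> real) list \<Rightarrow> real) \<Rightarrow> real" where
  "wedge_form \<alpha>s \<Omega> = \<Omega> \<alpha>s"


section \<open>Smooth manifolds\<close>

primrec Ck_on :: "nat \<Rightarrow> 'e::real_normed_vector set \<Rightarrow> ('e \<Rightarrow> 'f::real_normed_vector) \<Rightarrow> bool" where
  "Ck_on 0 S f \<longleftrightarrow> continuous_on S f"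
| "Ck_on (Suc k) S f \<longleftrightarrow> (\<forall>x\<in>S. f differentiable (at x)) \<and>
     (\<forall>v. Ck_on k S (\<lambda>x. frechet_derivative f (at x) v))"

definition smooth_on :: "'e::real_normed_vector set \<Rightarrow> ('e \<Rightarrow> 'f::real_normed_vector) \<Rightarrow> bool" where
  "smooth_on S f \<longleftrightarrow> (\<forall>k. Ck_on k S f)"

text \<open>The underlying set of the manifold is the whole type \<open>'a\<close>; it is modelled on \<open>'e\<close>.\<close>

type_synonym ('a, 'e) atlas = "('a set \<times> ('a \<Rightarrow> 'e)) set"

definition mdim :: "('a, 'e::euclidean_space) atlas \<Rightarrow> nat" where
  "mdim A = DIM('e)"

definition smooth_atlas ::
  "('a::{t2_space, second_countable_topology}, 'e::euclidean_space) atlas \<Rightarrow> bool" where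
  "smooth_atlas A \<longleftrightarrow>
     (\<Union>(U, \<phi>)\<in>A. U) = UNIV \<and>
     (\<forall>(U, \<phi>)\<in>A. open U \<and> open (\<phi> ` U) \<and> homeomorphism U (\<phi> ` U) \<phi> (inv_into U \<phi>)) \<and>
     (\<forall>(U, \<phi>)\<in>A. \<forall>(V, \<psi>)\<in>A. smooth_on (\<phi> ` (U \<inter> V)) (\<psi> \<circ> inv_into U \<phi>))"

definition smooth_fun ::
  "('a::topological_space, 'e::euclidean_space) atlas \<Rightarrow> 'a set \<Rightarrow> ('a \<Rightarrow> real) \<Rightarrow> bool" where
  "smooth_fun A U f \<longleftrightarrow> open U \<and> (\<forall>(W, \<phi>)\<in>A. smooth_on (\<phi> ` (U \<inter> W)) (f \<circ> inv_into W \<phi>))"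

definition smooth_near ::
  "('a::topological_space, 'e::euclidean_space) atlas \<Rightarrow> 'a \<Rightarrow> ('a \<Rightarrow> real) \<Rightarrow> bool" where
  "smooth_near A q f \<longleftrightarrow> (\<exists>U. q \<in> U \<and> smooth_fun A U f)"

text \<open>
  Tangent vectors are derivations of the algebra of germs of smooth functions. A germ is
  represented by any function smooth near the point; the value on all other functions is fixed
  to be \<open>0\<close>.
\<close>

type_synonym 'a tvec = "('a \<Rightarrow> real) \<Rightarrow> real"

definition tangent_space ::
  "('a::topological_space, 'e::euclidean_space) atlas \<Rightarrow> 'a \<Rightarrow> 'a tvec set" where
  "tangent_space A q = {v.
     (\<forall>f h. smooth_near A q f \<and> smooth_near A q h \<longrightarrow>
        (\<forall>a c. v (\<lambda>p. a * f p + c * h p) = a * v f + c * v h) \<and>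
        v (\<lambda>p. f p * h p) = f q * v h + h q * v f \<and>
        (eventually (\<lambda>p. f p = h p) (nhds q) \<longrightarrow> v f = v h)) \<and>
     (\<forall>f. \<not> smooth_near A q f \<longrightarrow> v f = 0)}"

text \<open>Smooth vector fields on an open set \<open>U\<close>; values outside \<open>U\<close> are irrelevant.\<close>

definition vector_field ::
  "('a::topological_space, 'e::euclidean_space) atlas \<Rightarrow> 'a set \<Rightarrow> ('a \<Rightarrow> 'a tvec) \<Rightarrow> bool" where
  "vector_field A U X \<longleftrightarrow> open U \<and> (\<forall>q\<in>U. X q \<in> tangent_space A q) \<and>
     (\<forall>V f. V \<subseteq> U \<and> smooth_fun A V f \<longrightarrow> smooth_fun A V (\<lambda>p. X p f))"

definition lie_bracket ::
  "('a::topological_space, 'e::euclidean_space) atlas \<Rightarrow>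
   ('a \<Rightarrow> 'a tvec) \<Rightarrow> ('a \<Rightarrow> 'a tvec) \<Rightarrow> 'a \<Rightarrow> 'a tvec" where
  "lie_bracket A X Y q = (\<lambda>f. if smooth_near A q f
     then X q (\<lambda>p. Y p f) - Y q (\<lambda>p. X p f) else 0)"

fun nested_bracket ::
  "('a::topological_space, 'e::euclidean_space) atlas \<Rightarrow> ('a \<Rightarrow> 'a tvec) list \<Rightarrow> 'a \<Rightarrow> 'a tvec" where
  "nested_bracket A [] = (\<lambda>q. 0)"
| "nested_bracket A [V] = V"
| "nested_bracket A (V # W # Vs) = lie_bracket A V (nested_bracket A (W # Vs))"

text \<open>
  An orientation is given by a nowhere vanishing smooth \<open>n\<close>-form, \<open>n\<close>-forms at \<open>q\<close> being
  linear functionals on the \<open>n\<close>-th exterior power of the tangent space.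
\<close>

definition orientation ::
  "('a::topological_space, 'e::euclidean_space) atlas \<Rightarrow>
   ('a \<Rightarrow> (('a tvec \<Rightarrow> real) list \<Rightarrow> real) \<Rightarrow> real) \<Rightarrow> bool" where
  "orientation A \<omega> \<longleftrightarrow>
     (\<forall>q. linear (\<omega> q) \<and> (\<exists>\<Omega>\<in>ext_power (mdim A) (tangent_space A q). \<omega> q \<Omega> \<noteq> 0)) \<and>
     (\<forall>U Xs. open U \<and> length Xs = mdim A \<and> (\<forall>X\<in>set Xs. vector_field A U X) \<longrightarrow>
        smooth_fun A U (\<lambda>q. \<omega> q (wedge (map (\<lambda>X. X q) Xs))))"


section \<open>Sub-Riemannian manifolds\<close>

definition smooth_section ::
  "('a::topological_space, 'e::euclidean_space) atlas \<Rightarrow> ('a \<Rightarrow> 'a tvec set) \<Rightarrow> 'a set \<Rightarrow>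
   ('a \<Rightarrow> 'a tvec) \<Rightarrow> bool" where
  "smooth_section A D U V \<longleftrightarrow> vector_field A U V \<and> (\<forall>p\<in>U. V p \<in> D p)"

definition smooth_distribution ::
  "('a::topological_space, 'e::euclidean_space) atlas \<Rightarrow> ('a \<Rightarrow> 'a tvec set) \<Rightarrow> nat \<Rightarrow> bool" where
  "smooth_distribution A D k \<longleftrightarrow>
     (\<forall>q. \<exists>U X. q \<in> U \<and> (\<forall>l<k. vector_field A U (X l)) \<and> open U \<and>
        (\<forall>p\<in>U. D p \<subseteq> tangent_space A p \<and> basis_family k (\<lambda>l. X l p) (D p)))"

definition smooth_metric ::
  "('a::topological_space, 'e::euclidean_space) atlas \<Rightarrow> ('a \<Rightarrow> 'a tvec set) \<Rightarrow>
   ('a \<Rightarrow> 'a tvec \<Rightarrow> 'a tvec \<Rightarrow> real) \<Rightarrow> bool" where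
  "smooth_metric A D g \<longleftrightarrow> (\<forall>q. inner_product_on (D q) (g q)) \<and>
     (\<forall>U V W. smooth_section A D U V \<and> smooth_section A D U W \<longrightarrow>
        smooth_fun A U (\<lambda>q. g q (V q) (W q)))"

inductive iterated_bracket ::
  "('a::topological_space, 'e::euclidean_space) atlas \<Rightarrow> ('a \<Rightarrow> 'a tvec set) \<Rightarrow> 'a set \<Rightarrow>
   ('a \<Rightarrow> 'a tvec) \<Rightarrow> bool"
  for A D U where
  "smooth_section A D U V \<Longrightarrow> iterated_bracket A D U V"
| "iterated_bracket A D U V \<Longrightarrow> iterated_bracket A D U W \<Longrightarrow>
     iterated_bracket A D U (lie_bracket A V W)"

definition bracket_generating ::
  "('a::topological_space, 'e::euclidean_space) atlas \<Rightarrow> ('a \<Rightarrow> 'a tvec set) \<Rightarrow> bool" where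
  "bracket_generating A D \<longleftrightarrow>
     (\<forall>q. span {V q | U V. q \<in> U \<and> iterated_bracket A D U V} = tangent_space A q)"

definition sub_riemannian ::
  "('a::{t2_space, second_countable_topology}, 'e::euclidean_space) atlas \<Rightarrow>
   ('a \<Rightarrow> 'a tvec set) \<Rightarrow> nat \<Rightarrow> ('a \<Rightarrow> 'a tvec \<Rightarrow> 'a tvec \<Rightarrow> real) \<Rightarrow> bool" where
  "sub_riemannian A D k g \<longleftrightarrow>
     smooth_atlas A \<and> connected (UNIV :: 'a set) \<and> (\<exists>\<omega>. orientation A \<omega>) \<and> 3 \<le> mdim A \<and>
     smooth_distribution A D k \<and> k < mdim A \<and> smooth_metric A D g \<and> bracket_generating A D"

fun flag ::
  "('a::topological_space, 'e::euclidean_space) atlas \<Rightarrow> ('a \<Rightarrow> 'a tvec set) \<Rightarrow> nat \<Rightarrow>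
   'a \<Rightarrow> 'a tvec set" where
  "flag A D 0 = (\<lambda>q. {0})"
| "flag A D (Suc 0) = D"
| "flag A D (Suc (Suc i)) = (\<lambda>q. {v + w | v w. v \<in> flag A D (Suc i) q \<and>
     w \<in> span {lie_bracket A V W q | U V W. q \<in> U \<and>
                 smooth_section A (flag A D (Suc i)) U V \<and> smooth_section A D U W}})"

definition equiregular ::
  "('a::topological_space, 'e::euclidean_space) atlas \<Rightarrow> ('a \<Rightarrow> 'a tvec set) \<Rightarrow>
   (nat \<Rightarrow> nat) \<Rightarrow> bool" where
  "equiregular A D ks \<longleftrightarrow> (\<forall>i q. dim (flag A D i q) = ks i)"

definition has_step ::
  "('a::topological_space, 'e::euclidean_space) atlas \<Rightarrow> ('a \<Rightarrow> 'a tvec set) \<Rightarrow> nat \<Rightarrow> bool" where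
  "has_step A D m \<longleftrightarrow> (\<forall>q. flag A D m q = tangent_space A q) \<and>
     (\<forall>i<m. \<exists>q. flag A D i q \<noteq> tangent_space A q)"


section \<open>Popp's volume\<close>

text \<open>
  \<open>popp_map\<close> and \<open>tensor_inner\<close> are determined on the tensor power of \<open>D q\<close>, and only their
  values there are used.
\<close>

definition popp_map ::
  "('a::topological_space, 'e::euclidean_space) atlas \<Rightarrow> ('a \<Rightarrow> 'a tvec set) \<Rightarrow> nat \<Rightarrow> 'a \<Rightarrow>
   (('a tvec \<Rightarrow> real) list \<Rightarrow> real) \<Rightarrow> ('a tvec \<Rightarrow> real) \<Rightarrow> real" where
  "popp_map A D i q = (SOME \<pi>. linear \<pi> \<and>
     (\<forall>U Vs. q \<in> U \<and> length Vs = i \<and> (\<forall>V\<in>set Vs. smooth_section A D U V) \<longrightarrow>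
        \<pi> (tens (map (\<lambda>V. V q) Vs)) = qclass (flag A D (i - 1) q) (nested_bracket A Vs q)))"

definition tensor_inner ::
  "('a \<Rightarrow> 'a tvec set) \<Rightarrow> ('a \<Rightarrow> 'a tvec \<Rightarrow> 'a tvec \<Rightarrow> real) \<Rightarrow> nat \<Rightarrow> 'a \<Rightarrow>
   (('a tvec \<Rightarrow> real) list \<Rightarrow> real) \<Rightarrow> (('a tvec \<Rightarrow> real) list \<Rightarrow> real) \<Rightarrow> real" where
  "tensor_inner D g i q = (SOME B. bilinear B \<and>
     (\<forall>vs ws. length vs = i \<and> length ws = i \<and> set vs \<subseteq> D q \<and> set ws \<subseteq> D q \<longrightarrow>
        B (tens vs) (tens ws) = (\<Prod>j<i. g q (vs ! j) (ws ! j))))"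

definition quot_norm ::
  "('a::topological_space, 'e::euclidean_space) atlas \<Rightarrow> ('a \<Rightarrow> 'a tvec set) \<Rightarrow>
   ('a \<Rightarrow> 'a tvec \<Rightarrow> 'a tvec \<Rightarrow> real) \<Rightarrow> nat \<Rightarrow> 'a \<Rightarrow> (('a tvec \<Rightarrow> real) \<Rightarrow> real) \<Rightarrow> real" where
  "quot_norm A D g i q Y = (LEAST r. \<exists>Z\<in>tensor_power i (D q).
     popp_map A D i q Z = Y \<and> r = sqrt (tensor_inner D g i q Z Z))"

text \<open>The inner product with norm \<open>quot_norm\<close>, recovered from its norm by polarization.\<close>

definition quot_inner ::
  "('a::topological_space, 'e::euclidean_space) atlas \<Rightarrow> ('a \<Rightarrow> 'a tvec set) \<Rightarrow>
   ('a \<Rightarrow> 'a tvec \<Rightarrow> 'a tvec \<Rightarrow> real) \<Rightarrow> nat \<Rightarrow> 'a \<Rightarrow>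
   (('a tvec \<Rightarrow> real) \<Rightarrow> real) \<Rightarrow> (('a tvec \<Rightarrow> real) \<Rightarrow> real) \<Rightarrow> real" where
  "quot_inner A D g i q Y Z =
     ((quot_norm A D g i q (Y + Z))\<^sup>2 - (quot_norm A D g i q (Y - Z))\<^sup>2) / 4"

text \<open>
  An element of the graded space is a family \<open>Y\<close> with component \<open>Y i\<close> in the quotient of the
  \<open>i\<close>-th by the \<open>(i - 1)\<close>-st flag space for \<open>1 \<le> i \<le> m\<close>, and \<open>Y i = 0\<close> for all other \<open>i\<close>.
\<close>

type_synonym 'a gvec = "nat \<Rightarrow> ('a tvec \<Rightarrow> real) \<Rightarrow> real"

definition gr_space ::
  "('a::topological_space, 'e::euclidean_space) atlas \<Rightarrow> ('a \<Rightarrow> 'a tvec set) \<Rightarrow> nat \<Rightarrow> 'a \<Rightarrow>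
   'a gvec set" where
  "gr_space A D m q = {Y.
     (\<forall>i\<in>{1..m}. Y i \<in> qclass (flag A D (i - 1) q) ` flag A D i q) \<and> (\<forall>i. i \<notin> {1..m} \<longrightarrow> Y i = 0)}"

definition gr_inner ::
  "('a::topological_space, 'e::euclidean_space) atlas \<Rightarrow> ('a \<Rightarrow> 'a tvec set) \<Rightarrow>
   ('a \<Rightarrow> 'a tvec \<Rightarrow> 'a tvec \<Rightarrow> real) \<Rightarrow> nat \<Rightarrow> 'a \<Rightarrow> 'a gvec \<Rightarrow> 'a gvec \<Rightarrow> real" where
  "gr_inner A D g m q Y Z = (\<Sum>i=1..m. quot_inner A D g i q (Y i) (Z i))"

text \<open>
  Frames and bases are indexed from \<open>0\<close>: the \<open>l\<close>-th vector belongs to the layer \<open>i\<close> with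
  \<open>ks (i - 1) \<le> l < ks i\<close>.
\<close>

definition layer :: "(nat \<Rightarrow> nat) \<Rightarrow> nat \<Rightarrow> nat" where
  "layer ks l = (LEAST i. l < ks i)"

definition adapted_basis ::
  "('a::topological_space, 'e::euclidean_space) atlas \<Rightarrow> ('a \<Rightarrow> 'a tvec set) \<Rightarrow> (nat \<Rightarrow> nat) \<Rightarrow>
   'a \<Rightarrow> 'a tvec list \<Rightarrow> bool" where
  "adapted_basis A D ks q vs \<longleftrightarrow> length vs = mdim A \<and>
     basis_family (mdim A) ((!) vs) (tangent_space A q) \<and>
     (\<forall>i. basis_family (ks i) ((!) vs) (flag A D i q))"

definition gr_class ::
  "('a::topological_space, 'e::euclidean_space) atlas \<Rightarrow> ('a \<Rightarrow> 'a tvec set) \<Rightarrow> 'a \<Rightarrow> nat \<Rightarrow>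
   'a tvec \<Rightarrow> 'a gvec" where
  "gr_class A D q i v = (\<lambda>j. if j = i then qclass (flag A D (i - 1) q) v else 0)"

definition theta ::
  "('a::topological_space, 'e::euclidean_space) atlas \<Rightarrow> ('a \<Rightarrow> 'a tvec set) \<Rightarrow> (nat \<Rightarrow> nat) \<Rightarrow>
   'a \<Rightarrow> (('a tvec \<Rightarrow> real) list \<Rightarrow> real) \<Rightarrow> (('a gvec \<Rightarrow> real) list \<Rightarrow> real)" where
  "theta A D ks q = (SOME \<theta>. linear \<theta> \<and>
     (\<forall>vs. adapted_basis A D ks q vs \<longrightarrow>
        \<theta> (wedge vs) =
          wedge (map (\<lambda>l. gr_class A D q (layer ks l) (vs ! l)) [0..<mdim A])))"

definition gr_orthonormal_basis ::
  "('a::topological_space, 'e::euclidean_space) atlas \<Rightarrow> ('a \<Rightarrow> 'a tvec set) \<Rightarrow>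
   ('a \<Rightarrow> 'a tvec \<Rightarrow> 'a tvec \<Rightarrow> real) \<Rightarrow> nat \<Rightarrow> 'a \<Rightarrow> 'a gvec list \<Rightarrow> bool" where
  "gr_orthonormal_basis A D g m q Ys \<longleftrightarrow> length Ys = mdim A \<and>
     basis_family (mdim A) ((!) Ys) (gr_space A D m q) \<and>
     (\<forall>i<mdim A. \<forall>j<mdim A. gr_inner A D g m q (Ys ! i) (Ys ! j) = (if i = j then 1 else 0))"

definition dual_family :: "'v::real_vector list \<Rightarrow> ('v \<Rightarrow> real) list \<Rightarrow> bool" where
  "dual_family vs \<alpha>s \<longleftrightarrow> length \<alpha>s = length vs \<and> (\<forall>\<alpha>\<in>set \<alpha>s. linear \<alpha>) \<and>
     (\<forall>i<length vs. \<forall>j<length vs. (\<alpha>s ! i) (vs ! j) = (if i = j then 1 else 0))"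

text \<open>
  \<open>P\<close> is Popp's volume, with the signs chosen so that it is positive for the orientation \<open>\<omega>\<close>.
\<close>

definition popp_volume ::
  "('a::topological_space, 'e::euclidean_space) atlas \<Rightarrow> ('a \<Rightarrow> 'a tvec set) \<Rightarrow>
   ('a \<Rightarrow> 'a tvec \<Rightarrow> 'a tvec \<Rightarrow> real) \<Rightarrow> (nat \<Rightarrow> nat) \<Rightarrow> nat \<Rightarrow>
   ('a \<Rightarrow> (('a tvec \<Rightarrow> real) list \<Rightarrow> real) \<Rightarrow> real) \<Rightarrow>
   ('a \<Rightarrow> (('a tvec \<Rightarrow> real) list \<Rightarrow> real) \<Rightarrow> real) \<Rightarrow> bool" where
  "popp_volume A D g ks m \<omega> P \<longleftrightarrow> (\<forall>q.
     (\<exists>Ys \<xi>s. gr_orthonormal_basis A D g m q Ys \<and> dual_family Ys \<xi>s \<and>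
        (\<forall>\<Omega>\<in>ext_power (mdim A) (tangent_space A q).
           P q \<Omega> = wedge_form \<xi>s (theta A D ks q \<Omega>))) \<and>
     (\<forall>\<Omega>\<in>ext_power (mdim A) (tangent_space A q). 0 < \<omega> q \<Omega> \<longrightarrow> 0 < P q \<Omega>))"


section \<open>Adapted frames\<close>

definition adapted_frame ::
  "('a::topological_space, 'e::euclidean_space) atlas \<Rightarrow> ('a \<Rightarrow> 'a tvec set) \<Rightarrow>
   ('a \<Rightarrow> 'a tvec \<Rightarrow> 'a tvec \<Rightarrow> real) \<Rightarrow> (nat \<Rightarrow> nat) \<Rightarrow> 'a set \<Rightarrow>
   (nat \<Rightarrow> 'a \<Rightarrow> 'a tvec) \<Rightarrow> bool" where
  "adapted_frame A D g ks U X \<longleftrightarrow> open U \<and> (\<forall>l<mdim A. vector_field A U (X l)) \<and>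
     (\<forall>q\<in>U. basis_family (mdim A) (\<lambda>l. X l q) (tangent_space A q) \<and>
        (\<forall>i. basis_family (ks i) (\<lambda>l. X l q) (flag A D i q)) \<and>
        (\<forall>i<ks 1. \<forall>j<ks 1. g q (X i q) (X j q) = (if i = j then 1 else 0)))"

definition frame_at :: "('a, 'e::euclidean_space) atlas \<Rightarrow> (nat \<Rightarrow> 'a \<Rightarrow> 'b) \<Rightarrow> 'a \<Rightarrow> 'b list" where
  "frame_at A X q = map (\<lambda>l. X l q) [0..<mdim A]"

definition dual_coframe ::
  "('a, 'e::euclidean_space) atlas \<Rightarrow> 'a set \<Rightarrow> (nat \<Rightarrow> 'a \<Rightarrow> 'a tvec) \<Rightarrow>
   (nat \<Rightarrow> 'a \<Rightarrow> 'a tvec \<Rightarrow> real) \<Rightarrow> bool" where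
  "dual_coframe A U X \<nu> \<longleftrightarrow> (\<forall>q\<in>U. dual_family (frame_at A X q) (frame_at A \<nu> q))"

definition structure_constants ::
  "('a::topological_space, 'e::euclidean_space) atlas \<Rightarrow> ('a \<Rightarrow> 'a tvec set) \<Rightarrow> (nat \<Rightarrow> nat) \<Rightarrow>
   nat \<Rightarrow> 'a set \<Rightarrow> (nat \<Rightarrow> 'a \<Rightarrow> 'a tvec) \<Rightarrow> (nat list \<Rightarrow> nat \<Rightarrow> 'a \<Rightarrow> real) \<Rightarrow> bool" where
  "structure_constants A D ks m U X b \<longleftrightarrow>
     (\<forall>j\<in>{2..m}. \<forall>I. length I = j \<and> set I \<subseteq> {..<ks 1} \<longrightarrow>
        (\<forall>q\<in>U. nested_bracket A (map X I) q - (\<Sum>l=ks (j - 1)..<ks j. b I l q *\<^sub>R X l q)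
           \<in> flag A D (j - 1) q))"

definition structure_matrix ::
  "(nat \<Rightarrow> nat) \<Rightarrow> (nat list \<Rightarrow> nat \<Rightarrow> 'a \<Rightarrow> real) \<Rightarrow> nat \<Rightarrow> 'a \<Rightarrow> real mat" where
  "structure_matrix ks b j q =
     (if j = 1 then 1\<^sub>m (ks 1)
      else mat (ks j - ks (j - 1)) (ks j - ks (j - 1)) (\<lambda>(h, l).
        \<Sum>I | length I = j \<and> set I \<subseteq> {..<ks 1}. b I (ks (j - 1) + h) q * b I (ks (j - 1) + l) q))"

end

theory Submission
  imports Defs
begin

text \<open>
  The graded space at a point \<open>q\<close> has two natural frames: the classes of the adapted frame
  \<open>X\<close>, and an orthonormal basis for Popp's inner product. The canonical isomorphism turns
  \<open>X\<^sub>1 \<and> \<dots> \<and> X\<^sub>n\<close> into the wedge of the classes, so Popp's volume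
  evaluated on the adapted frame is the determinant \<open>N\<close> of the classes in the orthonormal
  basis, and \<open>N\<^sup>2\<close> is the determinant of the Gram matrix of the classes. The theorem follows
  once in layer \<open>j\<close> this Gram matrix is shown to be the inverse of \<open>B\<^sub>j\<close>.

  In layer \<open>j\<close> the elementary tensors in \<open>X\<^sub>1, \<dots>, X\<^sub>k\<close> form an
  orthonormal basis of the tensor power, and the Popp map sends the tensor with multi-index \<open>I\<close>
  to the class of the iterated bracket \<open>E I\<close>, whose coordinates are the structure constants
  \<open>b I h\<close>. So the norm of the class with coordinates \<open>y\<close> is the minimum of
  \<open>|z|\<close> subject to \<open>\<Sum>\<^sub>I z\<^sub>I b I h = y\<^sub>h\<close>. The minimiser is
  \<open>z\<^sub>I = \<Sum>\<^sub>h b I h w\<^sub>h\<close> with \<open>B\<^sub>j w = y\<close>, the squared norm is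
  \<open>\<langle>w, y\<rangle> = \<langle>B\<^sub>j\<^sup>-\<^sup>1 y, y\<rangle>\<close>, and
  polarization gives the Gram matrix \<open>B\<^sub>j\<^sup>-\<^sup>1\<close> (\<open>quot_norm_eq\<close>,
  \<open>quot_inner_eq\<close>, \<open>det_orthonormal_dual\<close>).

  Two facts from differential geometry make this linear algebra legitimate. Iterated brackets of
  sections are tensorial modulo the preceding flag space (\<open>nested_bracket_tensorial\<close>), so a linear
  map with the values prescribed for the Popp map exists, and its values on the tensor power
  are determined by them. And the flag is spanned by iterated brackets of the frame
  (\<open>flag_eq_bracket_span\<close>), so the Popp map is onto its layer and \<open>B\<^sub>j\<close> is
  invertible (\<open>gram_kernel\<close>).

  The isomorphism of exterior powers exists because the change from one adapted basis to another is
  block triangular, and such a matrix has the determinant of its block diagonal part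
  (\<open>det_block_triangular\<close>, \<open>theta_frame\<close>). Finally the top exterior power is a line, so
  the formula holds on all of it once it holds on \<open>X\<^sub>1 \<and> \<dots> \<and> X\<^sub>n\<close>, and the
  sign is that of the orientation on this multivector, which is locally constant by continuity.
\<close>

section \<open>Smooth functions\<close>

lemma sum_fun_apply: "(\<Sum>i\<in>S. f i) x = (\<Sum>i\<in>S. f i x)"
  by (induction S rule: infinite_finite_induct) simp_all

lemma Ck_on_subset: "Ck_on k S f \<Longrightarrow> T \<subseteq> S \<Longrightarrow> Ck_on k T f"
proof (induction k arbitrary: f)
  case 0
  then show ?case by (auto intro: continuous_on_subset)
qed auto

text \<open>
  The predicate \<open>Ck_on\<close> speaks of derivatives in the ambient space, so functions that agree on a
  set may be exchanged only if the set is open; this is the reason for the openness hypotheses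
  in this section.
\<close>

lemma differentiable_cong_open:
  assumes "open S" "x \<in> S" "\<And>y. y \<in> S \<Longrightarrow> f y = g y" "f differentiable (at x)"
  shows "g differentiable (at x)" "frechet_derivative g (at x) = frechet_derivative f (at x)"
proof -
  have "(g has_derivative frechet_derivative f (at x)) (at x)"
    using assms has_derivative_transform_within_open[OF _ assms(1,2)]
    by (metis frechet_derivative_works)
  then show "g differentiable (at x)" "frechet_derivative g (at x) = frechet_derivative f (at x)"
    by (auto simp: differentiable_def frechet_derivative_at[symmetric])
qed

lemma Ck_on_cong:
  assumes "open S" "\<And>y. y \<in> S \<Longrightarrow> f y = g y" "Ck_on k S f"
  shows "Ck_on k S g"
  using assms(2,3)
proof (induction k arbitrary: f g)
  case 0
  then show ?case by (simp cong: continuous_on_cong)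
next
  case (Suc k)
  have "\<forall>x\<in>S. g differentiable (at x)"
    using differentiable_cong_open(1)[OF assms(1) _ Suc.prems(1)] Suc.prems(2) by simp
  moreover have "Ck_on k S (\<lambda>x. frechet_derivative g (at x) v)" for v
  proof (rule Suc.IH)
    show "Ck_on k S (\<lambda>x. frechet_derivative f (at x) v)" using Suc.prems by simp
    show "frechet_derivative f (at y) v = frechet_derivative g (at y) v" if "y \<in> S" for y
      using differentiable_cong_open(2)[OF assms(1) that, of f g] Suc.prems that by auto
  qed
  ultimately show ?case by simp
qed

lemma Ck_on_Suc_imp: "Ck_on (Suc k) S f \<Longrightarrow> Ck_on k S f"
proof (induction k arbitrary: f)
  case 0
  then show ?case
    by (auto intro!: continuous_at_imp_continuous_on differentiable_imp_continuous_within)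
qed auto

lemma Ck_on_const: "Ck_on k S (\<lambda>x. c)"
  by (induction k arbitrary: c) (simp_all add: frechet_derivative_const)

lemma Ck_on_add:
  assumes "open S" "Ck_on k S f" "Ck_on k S g"
  shows "Ck_on k S (\<lambda>x. f x + g x)"
  using assms(2,3)
proof (induction k arbitrary: f g)
  case 0
  then show ?case by (simp add: continuous_on_add)
next
  case (Suc k)
  have "Ck_on k S (\<lambda>x. frechet_derivative (\<lambda>x. f x + g x) (at x) v)" for v
  proof (rule Ck_on_cong[OF assms(1)])
    show "Ck_on k S (\<lambda>x. frechet_derivative f (at x) v + frechet_derivative g (at x) v)"
      using Suc by simp
    show "frechet_derivative f (at y) v + frechet_derivative g (at y) v =
        frechet_derivative (\<lambda>x. f x + g x) (at y) v" if "y \<in> S" for y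
    proof -
      have "((\<lambda>x. f x + g x) has_derivative
        (\<lambda>v. frechet_derivative f (at y) v + frechet_derivative g (at y) v)) (at y)"
        using Suc.prems that by (intro has_derivative_add) (auto simp: frechet_derivative_works[symmetric])
      then show ?thesis by (simp add: frechet_derivative_at[symmetric])
    qed
  qed
  then show ?case using Suc.prems by simp
qed

lemma Ck_on_mult:
  fixes f g :: "'e::real_normed_vector \<Rightarrow> real"
  assumes "open S" "Ck_on k S f" "Ck_on k S g"
  shows "Ck_on k S (\<lambda>x. f x * g x)"
  using assms(2,3)
proof (induction k arbitrary: f g)
  case 0
  then show ?case by (simp add: continuous_on_mult)
next
  case (Suc k)
  have "Ck_on k S (\<lambda>x. frechet_derivative (\<lambda>x. f x * g x) (at x) v)" for v
  proof (rule Ck_on_cong[OF assms(1)])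
    have "Ck_on k S (\<lambda>x. f x * frechet_derivative g (at x) v)"
      "Ck_on k S (\<lambda>x. frechet_derivative f (at x) v * g x)"
      using Suc.IH[of f "\<lambda>x. frechet_derivative g (at x) v"]
        Suc.IH[of "\<lambda>x. frechet_derivative f (at x) v" g]
        Ck_on_Suc_imp[OF Suc.prems(1)] Ck_on_Suc_imp[OF Suc.prems(2)] Suc.prems by auto
    then show "Ck_on k S (\<lambda>x. f x * frechet_derivative g (at x) v + frechet_derivative f (at x) v * g x)"
      by (rule Ck_on_add[OF assms(1)])
    show "f y * frechet_derivative g (at y) v + frechet_derivative f (at y) v * g y =
        frechet_derivative (\<lambda>x. f x * g x) (at y) v" if "y \<in> S" for y
    proof -
      have "((\<lambda>x. f x * g x) has_derivative
        (\<lambda>v. f y * frechet_derivative g (at y) v + frechet_derivative f (at y) v * g y)) (at y)"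
        using Suc.prems that by (intro has_derivative_mult) (auto simp: frechet_derivative_works[symmetric])
      then show ?thesis by (simp add: frechet_derivative_at[symmetric])
    qed
  qed
  then show ?case using Suc.prems by simp
qed

locale atlas =
  fixes A :: "('a::{t2_space, second_countable_topology}, 'e::euclidean_space) atlas"
  assumes smooth_atlas: "smooth_atlas A"
begin

lemma chart_homeomorphism: "(W, \<phi>) \<in> A \<Longrightarrow> homeomorphism W (\<phi> ` W) \<phi> (inv_into W \<phi>)"
  using smooth_atlas unfolding smooth_atlas_def by auto

lemma smooth_fun_chart_iff:
  "smooth_fun A U f \<longleftrightarrow> open U \<and>
     (\<forall>W \<phi> k. (W, \<phi>) \<in> A \<longrightarrow> Ck_on k (\<phi> ` (U \<inter> W)) (\<lambda>x. f (inv_into W \<phi> x)))"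
  unfolding smooth_fun_def smooth_on_def comp_def by auto

lemma chart_image_open:
  assumes "(W, \<phi>) \<in> A" "open U"
  shows "open (\<phi> ` (U \<inter> W))"
proof -
  have h: "open W" "open (\<phi> ` W)" "homeomorphism W (\<phi> ` W) \<phi> (inv_into W \<phi>)"
    using smooth_atlas assms(1) unfolding smooth_atlas_def by auto
  have "openin (top_of_set (\<phi> ` W)) (\<phi> ` (U \<inter> W))"
    using h(1,3) assms(2) by (intro homeomorphism_imp_open_map[OF h(3)]) (auto simp: openin_open)
  then show ?thesis using h(2) by (simp add: openin_open_eq)
qed

lemma smooth_fun_subset: "smooth_fun A U f \<Longrightarrow> open V \<Longrightarrow> V \<subseteq> U \<Longrightarrow> smooth_fun A V f"
  unfolding smooth_fun_chart_iff by (meson Ck_on_subset Int_mono image_mono order_refl)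

lemma smooth_fun_open: "smooth_fun A U f \<Longrightarrow> open U"
  by (simp add: smooth_fun_def)

text \<open>
  Vector fields and brackets are controlled only on an open set. This congruence is what
  makes their values elsewhere irrelevant.
\<close>

lemma smooth_fun_cong:
  assumes "smooth_fun A U f" "\<And>p. p \<in> U \<Longrightarrow> f p = h p"
  shows "smooth_fun A U h"
  unfolding smooth_fun_def smooth_on_def
proof (intro conjI ballI, safe)
  show "open U" using assms(1) by (rule smooth_fun_open)
  fix W \<phi> k assume W: "(W, \<phi>) \<in> A"
  have inj: "inj_on \<phi> W"
    using chart_homeomorphism[OF W] unfolding homeomorphism_def inj_on_def by metis
  show "Ck_on k (\<phi> ` (U \<inter> W)) (h \<circ> inv_into W \<phi>)"
  proof (rule Ck_on_cong)
    show "open (\<phi> ` (U \<inter> W))" using chart_image_open[OF W \<open>open U\<close>] .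
    show "Ck_on k (\<phi> ` (U \<inter> W)) (f \<circ> inv_into W \<phi>)"
      using assms(1) W unfolding smooth_fun_def smooth_on_def by auto
    show "(f \<circ> inv_into W \<phi>) y = (h \<circ> inv_into W \<phi>) y" if "y \<in> \<phi> ` (U \<inter> W)" for y
      using that assms(2) inj by auto
  qed
qed

lemma smooth_fun_const: "open U \<Longrightarrow> smooth_fun A U (\<lambda>p. c)"
  unfolding smooth_fun_def smooth_on_def by (auto simp: comp_def Ck_on_const)

lemma smooth_fun_add:
  assumes "smooth_fun A U f" "smooth_fun A U h"
  shows "smooth_fun A U (\<lambda>p. f p + h p)"
  using assms chart_image_open unfolding smooth_fun_chart_iff by (auto intro!: Ck_on_add)

lemma smooth_fun_mult:
  assumes "smooth_fun A U f" "smooth_fun A U h"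
  shows "smooth_fun A U (\<lambda>p. f p * h p)"
  using assms chart_image_open unfolding smooth_fun_chart_iff by (auto intro!: Ck_on_mult)

lemma smooth_fun_diff:
  assumes "smooth_fun A U f" "smooth_fun A U h"
  shows "smooth_fun A U (\<lambda>p. f p - h p)"
  using smooth_fun_add[OF assms(1) smooth_fun_mult[OF smooth_fun_const[of U "-1"] assms(2)]]
    smooth_fun_open[OF assms(1)] by simp

lemma smooth_fun_sum:
  assumes "open U" "\<And>i. i \<in> I \<Longrightarrow> smooth_fun A U (f i)"
  shows "smooth_fun A U (\<lambda>p. \<Sum>i\<in>I. f i p)"
  using assms(2)
  by (induction I rule: infinite_finite_induct)
     (auto intro: smooth_fun_add smooth_fun_const[OF assms(1)])

lemma smooth_fun_prod:
  assumes "open U" "\<And>i. i \<in> I \<Longrightarrow> smooth_fun A U (f i)"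
  shows "smooth_fun A U (\<lambda>p. \<Prod>i\<in>I. f i p)"
  using assms(2)
  by (induction I rule: infinite_finite_induct)
     (auto intro: smooth_fun_mult smooth_fun_const[OF assms(1)])

lemma smooth_fun_det:
  assumes "open U" "\<And>i j. i < r \<Longrightarrow> j < r \<Longrightarrow> smooth_fun A U (M i j)"
  shows "smooth_fun A U (\<lambda>p. det (mat r r (\<lambda>(i, j). M i j p)))"
proof -
  have "smooth_fun A U (\<lambda>p. \<Sum>\<pi> | \<pi> permutes {0..<r}. signof \<pi> * (\<Prod>i = 0..<r. M i (\<pi> i) p))"
    using assms(2) by (intro smooth_fun_sum smooth_fun_mult smooth_fun_const smooth_fun_prod assms(1))
      (auto simp: permutes_in_image)
  moreover have "det (mat r r (\<lambda>(i, j). M i j p)) =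
      (\<Sum>\<pi> | \<pi> permutes {0..<r}. signof \<pi> * (\<Prod>i = 0..<r. M i (\<pi> i) p))" for p
    by (subst det_def'[of _ r]) (auto intro!: sum.cong prod.cong simp: permutes_in_image)
  ultimately show ?thesis by presburger
qed

lemma smooth_fun_continuous:
  assumes "smooth_fun A U f"
  shows "continuous_on U f"
proof -
  have "\<exists>T. open T \<and> x \<in> T \<and> continuous_on (U \<inter> T) f" if "x \<in> U" for x
  proof -
    obtain W \<phi> where W: "(W, \<phi>) \<in> A" "x \<in> W"
      using smooth_atlas UNIV_I[of x] unfolding smooth_atlas_def by blast
    have h: "open W" "homeomorphism W (\<phi> ` W) \<phi> (inv_into W \<phi>)"
      using smooth_atlas W(1) unfolding smooth_atlas_def by auto
    have "Ck_on 0 (\<phi> ` (U \<inter> W)) (f \<circ> inv_into W \<phi>)"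
      using assms W unfolding smooth_fun_def smooth_on_def by blast
    then have a: "continuous_on (\<phi> ` (U \<inter> W)) (f \<circ> inv_into W \<phi>)" by simp
    have b: "continuous_on (U \<inter> W) \<phi>"
      using h(2) by (auto simp: homeomorphism_def intro: continuous_on_subset)
    have "continuous_on (U \<inter> W) ((f \<circ> inv_into W \<phi>) \<circ> \<phi>)"
      using continuous_on_compose[OF b a] .
    then have "continuous_on (U \<inter> W) f"
      by (rule continuous_on_eq) (use h(2) in \<open>auto simp: homeomorphism_def\<close>)
    then show ?thesis using h(1) W(2) by blast
  qed
  then have "\<exists>T. open T \<and> x \<in> T \<and> continuous_on (U \<inter> T) f" if "x \<in> U" for x
    using that by blast
  then show ?thesis
    using smooth_fun_open[OF assms]
    by (meson Int_iff continuous_at_imp_continuous_on continuous_on_eq_continuous_at open_Int)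
qed

lemma smooth_near_I: "smooth_fun A U f \<Longrightarrow> q \<in> U \<Longrightarrow> smooth_near A q f"
  by (auto simp: smooth_near_def)

end

section \<open>Tangent vectors, vector fields and brackets\<close>

context atlas
begin

lemma smooth_near_algebra:
  assumes "smooth_near A q f" "smooth_near A q h"
  shows "smooth_near A q (\<lambda>p. a * f p + c * h p)" "smooth_near A q (\<lambda>p. f p * h p)"
proof -
  obtain V W where V: "q \<in> V" "smooth_fun A V f" and W: "q \<in> W" "smooth_fun A W h"
    using assms unfolding smooth_near_def by blast
  have o: "open (V \<inter> W)" using V W smooth_fun_open by auto
  have f: "smooth_fun A (V \<inter> W) f" and h: "smooth_fun A (V \<inter> W) h"
    using smooth_fun_subset[OF V(2) o] smooth_fun_subset[OF W(2) o] by auto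
  show "smooth_near A q (\<lambda>p. a * f p + c * h p)"
    using smooth_near_I[OF smooth_fun_add[OF smooth_fun_mult[OF smooth_fun_const[OF o] f]
      smooth_fun_mult[OF smooth_fun_const[OF o] h]]] V W by simp
  show "smooth_near A q (\<lambda>p. f p * h p)"
    using smooth_near_I[OF smooth_fun_mult[OF f h]] V W by simp
qed

lemma smooth_near_const: "smooth_near A q (\<lambda>p. c)"
  by (rule smooth_near_I[OF smooth_fun_const[of UNIV]]) auto

lemma smooth_near_sum:
  "(\<And>i. i \<in> I \<Longrightarrow> smooth_near A q (f i)) \<Longrightarrow> smooth_near A q (\<lambda>p. \<Sum>i\<in>I. f i p)"
proof (induction I rule: infinite_finite_induct)
  case (insert x F)
  then show ?case using smooth_near_algebra(1)[of q "f x" "\<lambda>p. \<Sum>i\<in>F. f i p" 1 1] by simp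
qed (auto intro: smooth_near_const)

lemma tangent_lincomb:
  "v \<in> tangent_space A q \<Longrightarrow> smooth_near A q f \<Longrightarrow> smooth_near A q h \<Longrightarrow>
    v (\<lambda>p. a * f p + c * h p) = a * v f + c * v h"
  unfolding tangent_space_def by blast

lemma tangent_mult:
  "v \<in> tangent_space A q \<Longrightarrow> smooth_near A q f \<Longrightarrow> smooth_near A q h \<Longrightarrow>
    v (\<lambda>p. f p * h p) = f q * v h + h q * v f"
  unfolding tangent_space_def by blast

text \<open>
  A tangent vector only sees germs, so identities between functions that hold near a point may
  be differentiated there.
\<close>

lemma tangent_germ:
  "v \<in> tangent_space A q \<Longrightarrow> smooth_near A q f \<Longrightarrow> smooth_near A q h \<Longrightarrow>
    eventually (\<lambda>p. f p = h p) (nhds q) \<Longrightarrow> v f = v h"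
  unfolding tangent_space_def by blast

lemma tangent_not_smooth: "v \<in> tangent_space A q \<Longrightarrow> \<not> smooth_near A q f \<Longrightarrow> v f = 0"
  unfolding tangent_space_def by blast

lemma tangent_zero_fun: "v \<in> tangent_space A q \<Longrightarrow> v (\<lambda>p. 0) = 0"
  using tangent_lincomb[of v q "\<lambda>p. 0" "\<lambda>p. 0" 0 0] smooth_near_const by simp

lemma tangent_sum:
  assumes "v \<in> tangent_space A q" "\<And>i. i \<in> I \<Longrightarrow> smooth_near A q (f i)"
  shows "v (\<lambda>p. \<Sum>i\<in>I. f i p) = (\<Sum>i\<in>I. v (f i))"
  using assms(2)
proof (induction I rule: infinite_finite_induct)
  case (insert x F)
  then show ?case
    using tangent_lincomb[OF assms(1), of "f x" "\<lambda>p. \<Sum>i\<in>F. f i p" 1 1] smooth_near_sum[of F q f]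
    by simp
qed (simp_all add: tangent_zero_fun[OF assms(1)])

lemma tangent_diff:
  assumes "v \<in> tangent_space A q" "smooth_near A q f" "smooth_near A q h"
  shows "v (\<lambda>p. f p - h p) = v f - v h"
  using tangent_lincomb[OF assms, of 1 "-1"] by simp

lemma subspace_tangent_space: "subspace (tangent_space A q)"
  unfolding subspace_def
proof (intro conjI ballI allI)
  show "0 \<in> tangent_space A q" by (simp add: tangent_space_def)
  fix v w c assume v: "v \<in> tangent_space A q"
  show "c *\<^sub>R v \<in> tangent_space A q"
    unfolding tangent_space_def
    by (simp add: tangent_lincomb[OF v] tangent_mult[OF v] tangent_not_smooth[OF v] algebra_simps)
      (metis tangent_germ[OF v])
  assume w: "w \<in> tangent_space A q"
  show "v + w \<in> tangent_space A q"
    unfolding tangent_space_def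
    by (simp add: tangent_lincomb[OF v] tangent_mult[OF v] tangent_not_smooth[OF v]
          tangent_lincomb[OF w] tangent_mult[OF w] tangent_not_smooth[OF w] algebra_simps)
      (metis tangent_germ[OF v] tangent_germ[OF w])
qed

lemma vector_field_tangent: "vector_field A U X \<Longrightarrow> q \<in> U \<Longrightarrow> X q \<in> tangent_space A q"
  by (simp add: vector_field_def)

lemma vector_field_open: "vector_field A U X \<Longrightarrow> open U"
  by (simp add: vector_field_def)

lemma vector_field_smooth:
  "vector_field A U X \<Longrightarrow> V \<subseteq> U \<Longrightarrow> smooth_fun A V f \<Longrightarrow> smooth_fun A V (\<lambda>p. X p f)"
  by (simp add: vector_field_def)

lemma vector_field_smooth_near:
  assumes "vector_field A U X" "q \<in> U" "smooth_near A q f"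
  shows "smooth_near A q (\<lambda>p. X p f)"
proof -
  obtain V where V: "q \<in> V" "smooth_fun A V f" using assms(3) by (auto simp: smooth_near_def)
  have "smooth_fun A (V \<inter> U) f"
    using V assms(1) by (intro smooth_fun_subset[OF V(2)]) (auto intro: smooth_fun_open vector_field_open)
  then show ?thesis
    using assms V by (intro smooth_near_I[OF vector_field_smooth[OF assms(1), of "V \<inter> U"]]) auto
qed

lemma vector_field_subset: "vector_field A U X \<Longrightarrow> open V \<Longrightarrow> V \<subseteq> U \<Longrightarrow> vector_field A V X"
  unfolding vector_field_def by blast

lemma vector_field_combination:
  assumes "open U" "\<And>i. i \<in> S \<Longrightarrow> smooth_fun A U (f i)" "\<And>i. i \<in> S \<Longrightarrow> vector_field A U (Y i)"
  shows "vector_field A U (\<lambda>p. \<Sum>i\<in>S. f i p *\<^sub>R Y i p)"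
  unfolding vector_field_def
proof (intro conjI ballI allI impI)
  show "(\<Sum>i\<in>S. f i q *\<^sub>R Y i q) \<in> tangent_space A q" if "q \<in> U" for q
    using that assms
    by (intro subspace_sum subspace_scale subspace_tangent_space) (auto intro: vector_field_tangent)
  fix V h assume V: "V \<subseteq> U \<and> smooth_fun A V h"
  have "smooth_fun A V (\<lambda>p. \<Sum>i\<in>S. f i p * Y i p h)"
    using assms V
    by (intro smooth_fun_sum smooth_fun_mult) (auto intro: smooth_fun_open smooth_fun_subset vector_field_smooth)
  then show "smooth_fun A V (\<lambda>p. (\<Sum>i\<in>S. f i p *\<^sub>R Y i p) h)"
    by (simp add: sum_fun_apply)
qed (rule assms(1))

lemma vector_field_diff:
  assumes "vector_field A U X" "vector_field A U Y"
  shows "vector_field A U (\<lambda>p. X p - Y p)"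
  unfolding vector_field_def
proof (intro conjI ballI allI impI)
  show "X q - Y q \<in> tangent_space A q" if "q \<in> U" for q
    using that assms by (intro subspace_diff subspace_tangent_space) (auto intro: vector_field_tangent)
  show "smooth_fun A V (\<lambda>p. (X p - Y p) h)" if "V \<subseteq> U \<and> smooth_fun A V h" for V h
    using assms that by (simp add: smooth_fun_diff vector_field_smooth)
qed (rule vector_field_open[OF assms(1)])

lemma lie_bracket_smooth:
  "smooth_near A q f \<Longrightarrow> lie_bracket A X Y q f = X q (\<lambda>p. Y p f) - Y q (\<lambda>p. X p f)"
  by (simp add: lie_bracket_def)

lemma lie_bracket_antisym: "lie_bracket A X Y q = - lie_bracket A Y X q"
  by (auto simp: lie_bracket_def fun_eq_iff)

text \<open>
  The second-order terms \<open>X f * Y h + Y f * X h\<close> in \<open>X (Y (f * h))\<close> are symmetric in the two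
  fields and cancel in the commutator, which leaves the Leibniz rule. The inner derivatives are
  taken at all points near \<open>q\<close>, hence the germ arguments.
\<close>

lemma lie_bracket_tangent:
  assumes X: "vector_field A U X" and Y: "vector_field A U Y" and q: "q \<in> U"
  shows "lie_bracket A X Y q \<in> tangent_space A q"
proof -
  note Xn = vector_field_smooth_near[OF X q] and Yn = vector_field_smooth_near[OF Y q]
  note Xt = vector_field_tangent[OF X q] and Yt = vector_field_tangent[OF Y q]
  have ev: "eventually (\<lambda>p. p \<in> U \<and> smooth_near A p f) (nhds q)" if f: "smooth_near A q f" for f
  proof -
    obtain V where V: "q \<in> V" "smooth_fun A V f" using f by (auto simp: smooth_near_def)
    show ?thesis
      unfolding eventually_nhds
      using V q smooth_fun_open[OF V(2)] vector_field_open[OF X] smooth_near_I[OF V(2)]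
      by (intro exI[of _ "U \<inter> V"]) auto
  qed
  have lin: "Z q (\<lambda>p. W p (\<lambda>p. a * f p + c * h p)) = a * Z q (\<lambda>p. W p f) + c * Z q (\<lambda>p. W p h)"
    if Z: "vector_field A U Z" and W: "vector_field A U W" and f: "smooth_near A q f" and h: "smooth_near A q h"
    for Z W f h a c
  proof -
    have "Z q (\<lambda>p. W p (\<lambda>p. a * f p + c * h p)) = Z q (\<lambda>p. a * W p f + c * W p h)"
    proof (rule tangent_germ[OF vector_field_tangent[OF Z q]])
      show "\<forall>\<^sub>F p in nhds q. W p (\<lambda>p. a * f p + c * h p) = a * W p f + c * W p h"
        using ev[OF f] ev[OF h]
        by eventually_elim (auto intro: tangent_lincomb vector_field_tangent[OF W])
    qed (intro vector_field_smooth_near[OF W q] smooth_near_algebra f h)+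
    also have "\<dots> = a * Z q (\<lambda>p. W p f) + c * Z q (\<lambda>p. W p h)"
      by (intro tangent_lincomb[OF vector_field_tangent[OF Z q]] vector_field_smooth_near[OF W q] f h)
    finally show ?thesis .
  qed
  have mult: "Z q (\<lambda>p. W p (\<lambda>p. f p * h p)) =
      f q * Z q (\<lambda>p. W p h) + W q h * Z q f + (h q * Z q (\<lambda>p. W p f) + W q f * Z q h)"
    if Z: "vector_field A U Z" and W: "vector_field A U W" and f: "smooth_near A q f" and h: "smooth_near A q h"
    for Z W f h
  proof -
    note Wf = vector_field_smooth_near[OF W q f] and Wh = vector_field_smooth_near[OF W q h]
    have "Z q (\<lambda>p. W p (\<lambda>p. f p * h p)) = Z q (\<lambda>p. 1 * (f p * W p h) + 1 * (h p * W p f))"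
    proof (rule tangent_germ[OF vector_field_tangent[OF Z q]])
      show "\<forall>\<^sub>F p in nhds q. W p (\<lambda>p. f p * h p) = 1 * (f p * W p h) + 1 * (h p * W p f)"
        using ev[OF f] ev[OF h]
        by eventually_elim (simp add: tangent_mult[OF vector_field_tangent[OF W]])
      show "smooth_near A q (\<lambda>p. W p (\<lambda>p. f p * h p))"
        by (intro vector_field_smooth_near[OF W q] smooth_near_algebra f h)
      show "smooth_near A q (\<lambda>p. 1 * (f p * W p h) + 1 * (h p * W p f))"
        by (intro smooth_near_algebra f h Wf Wh)
    qed
    also have "\<dots> = 1 * Z q (\<lambda>p. f p * W p h) + 1 * Z q (\<lambda>p. h p * W p f)"
      by (intro tangent_lincomb[OF vector_field_tangent[OF Z q]] smooth_near_algebra f h Wf Wh)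
    also have "\<dots> = f q * Z q (\<lambda>p. W p h) + W q h * Z q f + (h q * Z q (\<lambda>p. W p f) + W q f * Z q h)"
      by (simp add: tangent_mult[OF vector_field_tangent[OF Z q]] f h Wf Wh)
    finally show ?thesis .
  qed
  have germ: "Z q (\<lambda>p. W p f) = Z q (\<lambda>p. W p h)"
    if Z: "vector_field A U Z" and W: "vector_field A U W" and f: "smooth_near A q f" and h: "smooth_near A q h"
      and e: "\<forall>\<^sub>F p in nhds q. f p = h p"
    for Z W f h
  proof (rule tangent_germ[OF vector_field_tangent[OF Z q]])
    show "\<forall>\<^sub>F p in nhds q. W p f = W p h"
      using ev[OF f] ev[OF h] e[THEN eventually_eventually[THEN iffD2]]
      by eventually_elim (auto intro: tangent_germ vector_field_tangent[OF W])
  qed (intro vector_field_smooth_near[OF W q] f h)+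
  show ?thesis
    unfolding tangent_space_def
  proof (intro CollectI conjI allI impI; (elim conjE)?)
    fix f h a c assume f: "smooth_near A q f" and h: "smooth_near A q h"
    show "lie_bracket A X Y q (\<lambda>p. a * f p + c * h p) = a * lie_bracket A X Y q f + c * lie_bracket A X Y q h"
      by (simp add: lie_bracket_smooth f h smooth_near_algebra lin[OF X Y f h] lin[OF Y X f h] algebra_simps)
    show "lie_bracket A X Y q (\<lambda>p. f p * h p) = f q * lie_bracket A X Y q h + h q * lie_bracket A X Y q f"
      by (simp add: lie_bracket_smooth f h smooth_near_algebra mult[OF X Y f h] mult[OF Y X f h] algebra_simps)
    show "lie_bracket A X Y q f = lie_bracket A X Y q h" if "\<forall>\<^sub>F p in nhds q. f p = h p"
      using germ[OF X Y f h that] germ[OF Y X f h that] by (simp add: lie_bracket_smooth f h)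
  qed (simp add: lie_bracket_def)
qed

lemma vector_field_bracket:
  assumes "vector_field A U X" "vector_field A U Y"
  shows "vector_field A U (lie_bracket A X Y)"
  unfolding vector_field_def
proof (intro conjI ballI allI impI)
  fix V f assume V: "V \<subseteq> U \<and> smooth_fun A V f"
  have "smooth_fun A V (\<lambda>p. X p (\<lambda>p. Y p f) - Y p (\<lambda>p. X p f))"
    using V assms by (intro smooth_fun_diff) (auto intro: vector_field_smooth)
  then show "smooth_fun A V (\<lambda>p. lie_bracket A X Y p f)"
    by (rule smooth_fun_cong) (use V in \<open>auto simp: lie_bracket_smooth smooth_near_I\<close>)
qed (auto intro: assms lie_bracket_tangent vector_field_open[OF assms(1)])

lemma lie_bracket_cong:
  assumes "vector_field A U X" "vector_field A U Y" "vector_field A U Y'" "q \<in> U"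
    "\<And>p. p \<in> U \<Longrightarrow> Y p = Y' p"
  shows "lie_bracket A X Y q = lie_bracket A X Y' q"
proof
  fix f
  have "X q (\<lambda>p. Y p f) = X q (\<lambda>p. Y' p f)" if f: "smooth_near A q f"
    using assms by (intro tangent_germ[OF vector_field_tangent[OF assms(1,4)]]
      vector_field_smooth_near[OF assms(2,4) f] vector_field_smooth_near[OF assms(3,4) f])
      (auto simp: eventually_nhds intro: vector_field_open)
  then show "lie_bracket A X Y q f = lie_bracket A X Y' q f"
    using assms(4,5) by (simp add: lie_bracket_def)
qed

lemma lie_bracket_diff:
  assumes X: "vector_field A U X" and Y: "vector_field A U Y" and Z: "vector_field A U Z" and q: "q \<in> U"
  shows "lie_bracket A X (\<lambda>p. Y p - Z p) q = lie_bracket A X Y q - lie_bracket A X Z q"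
  using tangent_diff[OF vector_field_tangent[OF X q] vector_field_smooth_near[OF Y q]
      vector_field_smooth_near[OF Z q]]
  by (auto simp: lie_bracket_def fun_eq_iff)

text \<open>
  The Leibniz rule for the bracket with a combination of fields with smooth coefficients. All
  computations with brackets below reduce to it.
\<close>

lemma lie_bracket_combination:
  assumes "vector_field A U X" "\<And>i. i \<in> S \<Longrightarrow> smooth_fun A U (f i)" "\<And>i. i \<in> S \<Longrightarrow> vector_field A U (Y i)"
    and q: "q \<in> U"
  shows "lie_bracket A X (\<lambda>p. \<Sum>i\<in>S. f i p *\<^sub>R Y i p) q =
    (\<Sum>i\<in>S. f i q *\<^sub>R lie_bracket A X (Y i) q + X q (f i) *\<^sub>R Y i q)"
proof
  fix h
  note Xt = vector_field_tangent[OF assms(1) q]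
  show "lie_bracket A X (\<lambda>p. \<Sum>i\<in>S. f i p *\<^sub>R Y i p) q h =
    (\<Sum>i\<in>S. f i q *\<^sub>R lie_bracket A X (Y i) q + X q (f i) *\<^sub>R Y i q) h"
  proof (cases "smooth_near A q h")
    case True
    have Yn: "smooth_near A q (\<lambda>p. Y i p h)" if "i \<in> S" for i
      using vector_field_smooth_near[OF assms(3)[OF that] q True] .
    have fn: "smooth_near A q (f i)" if "i \<in> S" for i
      using smooth_near_I[OF assms(2)[OF that] q] .
    have "X q (\<lambda>p. \<Sum>i\<in>S. f i p * Y i p h) = (\<Sum>i\<in>S. X q (\<lambda>p. f i p * Y i p h))"
      by (intro tangent_sum[OF Xt] smooth_near_algebra Yn fn)
    also have "\<dots> = (\<Sum>i\<in>S. f i q * X q (\<lambda>p. Y i p h) + Y i q h * X q (f i))"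
      by (intro sum.cong tangent_mult[OF Xt] Yn fn refl)
    finally show ?thesis
      using True by (simp add: lie_bracket_smooth sum_fun_apply sum_subtractf[symmetric] algebra_simps)
  next
    case False
    then have "Y i q h = 0" if "i \<in> S" for i
      using tangent_not_smooth[OF vector_field_tangent[OF assms(3)[OF that] q]] by simp
    then show ?thesis using False by (simp add: lie_bracket_def sum_fun_apply)
  qed
qed

end

lemma (in atlas) smooth_fun_empty: "smooth_fun A {} f"
  by (rule smooth_fun_cong[OF smooth_fun_const[OF open_empty, of 0]]) simp

section \<open>Families of vectors\<close>

definition indep_family :: "nat \<Rightarrow> (nat \<Rightarrow> 'v::real_vector) \<Rightarrow> bool" where
  "indep_family n v \<longleftrightarrow> inj_on v {..<n} \<and> independent (v ` {..<n})"

lemma indep_family_iff: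
  "indep_family n v \<longleftrightarrow> (\<forall>c. (\<Sum>l<n. c l *\<^sub>R v l) = 0 \<longrightarrow> (\<forall>l<n. c l = 0))"
proof
  assume i: "indep_family n v"
  show "\<forall>c. (\<Sum>l<n. c l *\<^sub>R v l) = 0 \<longrightarrow> (\<forall>l<n. c l = 0)"
  proof (intro allI impI)
    fix c l assume c: "(\<Sum>l<n. c l *\<^sub>R v l) = 0" and l: "l < n"
    have inj: "inj_on v {..<n}" and ind: "independent (v ` {..<n})"
      using i by (auto simp: indep_family_def)
    have "(\<Sum>x\<in>v ` {..<n}. c (inv_into {..<n} v x) *\<^sub>R x) = (\<Sum>l<n. c l *\<^sub>R v l)"
      using inj by (simp add: sum.reindex)
    then show "c l = 0"
      using independentD[OF ind finite_imageI[OF finite_lessThan] subset_refl,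
          of "\<lambda>x. c (inv_into {..<n} v x)" "v l"] c l inj by auto
  qed
next
  assume a: "\<forall>c. (\<Sum>l<n. c l *\<^sub>R v l) = 0 \<longrightarrow> (\<forall>l<n. c l = 0)"
  have inj: "inj_on v {..<n}"
  proof (rule inj_onI, rule ccontr)
    fix i j assume ij: "i \<in> {..<n}" "j \<in> {..<n}" "v i = v j" "i \<noteq> j"
    let ?c = "\<lambda>l. if l = i then 1 else if l = j then -1 else (0::real)"
    have "(\<Sum>l<n. ?c l *\<^sub>R v l) = (\<Sum>l\<in>{i, j}. ?c l *\<^sub>R v l)"
      using ij by (intro sum.mono_neutral_right) auto
    also have "\<dots> = 0" using ij by simp
    finally have "\<forall>l<n. ?c l = 0" by (rule a[THEN spec, THEN mp])
    then show False using ij by auto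
  qed
  have "independent (v ` {..<n})"
    unfolding independent_explicit_finite_subsets
  proof (intro allI impI ballI)
    fix S u x assume S: "S \<subseteq> v ` {..<n}" "finite S" "(\<Sum>x\<in>S. u x *\<^sub>R x) = 0" "x \<in> S"
    let ?c = "\<lambda>l. if v l \<in> S then u (v l) else 0"
    have "(\<Sum>l<n. ?c l *\<^sub>R v l) = (\<Sum>l\<in>{l\<in>{..<n}. v l \<in> S}. u (v l) *\<^sub>R v l)"
      by (intro sum.mono_neutral_cong_right) auto
    also have "\<dots> = (\<Sum>x\<in>v ` {l\<in>{..<n}. v l \<in> S}. u x *\<^sub>R x)"
      using inj by (subst sum.reindex) (auto intro: inj_on_subset)
    also have "v ` {l\<in>{..<n}. v l \<in> S} = S" using S by auto
    finally have "(\<Sum>l<n. ?c l *\<^sub>R v l) = 0" using S by simp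
    then have "\<forall>l<n. ?c l = 0" by (rule a[THEN spec, THEN mp])
    moreover obtain l where "l < n" "x = v l" using S by auto
    ultimately show "u x = 0" using S by auto
  qed
  with inj show "indep_family n v" by (simp add: indep_family_def)
qed

lemma span_family_iff:
  assumes "finite S"
  shows "x \<in> span (v ` S) \<longleftrightarrow> (\<exists>c. x = (\<Sum>i\<in>S. c i *\<^sub>R v i))"
proof
  assume "x \<in> span (v ` S)"
  then show "\<exists>c. x = (\<Sum>i\<in>S. c i *\<^sub>R v i)"
  proof (induction rule: span_induct_alt)
    case base
    then show ?case by (intro exI[of _ "\<lambda>_. 0"]) simp
  next
    case (step c x y)
    then obtain i d where i: "i \<in> S" "x = v i" "y = (\<Sum>i\<in>S. d i *\<^sub>R v i)" by blast
    have "(\<Sum>j\<in>S. (if j = i then c else 0) *\<^sub>R v j) = (\<Sum>j\<in>S. if j = i then c *\<^sub>R v j else 0)"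
      by (intro sum.cong) auto
    also have "\<dots> = c *\<^sub>R x" using assms i by (simp add: sum.delta)
    finally show ?case
      using i by (intro exI[of _ "\<lambda>j. (if j = i then c else 0) + d j"])
        (simp add: scaleR_add_left sum.distrib)
  qed
qed (auto intro!: span_sum span_scale intro: span_base)

lemma indep_family_le:
  assumes "indep_family n v" "v ` {..<n} \<subseteq> span (w ` {..<m})"
  shows "n \<le> m"
proof -
  have "card (v ` {..<n}) \<le> card (w ` {..<m})"
    using assms independent_span_bound[of "w ` {..<m}" "v ` {..<n}"] by (auto simp: indep_family_def)
  also have "\<dots> \<le> m" using card_image_le[of "{..<m}" w] by simp
  finally show ?thesis using assms by (simp add: indep_family_def card_image)
qed

text \<open>
  An independent family that is as long as a spanning one spans: otherwise one further vector
  could be added to it, against the exchange bound.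
\<close>

lemma indep_family_spans:
  assumes "indep_family n v" "v ` {..<n} \<subseteq> span (w ` {..<n})"
  shows "span (v ` {..<n}) = span (w ` {..<n})"
proof
  show "span (v ` {..<n}) \<subseteq> span (w ` {..<n})"
    using assms(2) by (simp add: span_minimal)
  show "span (w ` {..<n}) \<subseteq> span (v ` {..<n})"
  proof (rule subsetI, rule ccontr)
    fix x assume x: "x \<in> span (w ` {..<n})" and nx: "x \<notin> span (v ` {..<n})"
    have "independent (insert x (v ` {..<n}))"
      using assms(1) nx by (simp add: indep_family_def independent_insertI)
    then have "card (insert x (v ` {..<n})) \<le> card (w ` {..<n})"
      using independent_span_bound[of "w ` {..<n}" "insert x (v ` {..<n})"] assms(2) x by auto
    moreover have "x \<notin> v ` {..<n}" using nx span_base[of x "v ` {..<n}"] by satx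
    moreover have "card (v ` {..<n}) = n" using assms(1) by (simp add: indep_family_def card_image)
    ultimately show False
      using card_image_le[of "{..<n}" w] by simp
  qed
qed

lemma basis_family_alt:
  "basis_family n v V \<longleftrightarrow> indep_family n v \<and> span (v ` {..<n}) = V"
  by (auto simp: basis_family_def indep_family_def)

section \<open>Multi-indices and elementary tensors\<close>

definition multi_index :: "nat \<Rightarrow> nat \<Rightarrow> nat list set" where
  "multi_index k i = {I. length I = i \<and> set I \<subseteq> {..<k}}"

lemma finite_multi_index [simp]: "finite (multi_index k i)"
  using finite_lists_length_eq[of "{..<k}" i] by (simp add: multi_index_def conj_commute)

lemma multi_index_0 [simp]: "multi_index k 0 = {[]}"
  by (auto simp: multi_index_def)

lemma sum_multi_index_Suc:
  "(\<Sum>I\<in>multi_index k (Suc i). F I) = (\<Sum>l<k. \<Sum>I\<in>multi_index k i. F (l # I))"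
proof -
  have "multi_index k (Suc i) = (\<lambda>(l, I). l # I) ` ({..<k} \<times> multi_index k i)"
    by (auto simp: multi_index_def length_Suc_conv image_iff)
  moreover have "inj_on (\<lambda>(l, I). l # I) ({..<k} \<times> multi_index k i)"
    by (auto simp: inj_on_def)
  ultimately show ?thesis by (simp add: sum.reindex sum.cartesian_product case_prod_unfold)
qed

lemma tens_Nil [simp]: "tens [] [] = 1"
  by (simp add: tens_def)

lemma tens_Cons: "linear \<alpha> \<Longrightarrow> tens (v # vs) (\<alpha> # \<alpha>s) = \<alpha> v * tens vs \<alpha>s"
  by (simp add: tens_def prod.lessThan_Suc_shift del: prod.lessThan_Suc)

section \<open>Adapted frames\<close>

text \<open>
  An adapted frame with its dual coframe. The coframe is given by functionals on the whole
  type of tangent vectors, so it yields coordinates for all the objects below: \<open>\<nu> h q\<close> is a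
  coordinate on the tangent space, and it descends to every quotient by a flag space on which it
  vanishes.
\<close>

locale adapted = atlas A
  for A :: "('a::{t2_space, second_countable_topology}, 'e::euclidean_space) atlas" +
  fixes D :: "'a \<Rightarrow> 'a tvec set"
    and g :: "'a \<Rightarrow> 'a tvec \<Rightarrow> 'a tvec \<Rightarrow> real"
    and k m :: nat
    and ks :: "nat \<Rightarrow> nat"
    and U :: "'a set"
    and X :: "nat \<Rightarrow> 'a \<Rightarrow> 'a tvec"
    and \<nu> :: "nat \<Rightarrow> 'a \<Rightarrow> 'a tvec \<Rightarrow> real"
  assumes distribution: "smooth_distribution A D k"
    and metric: "smooth_metric A D g"
    and step: "has_step A D m"
    and frame: "adapted_frame A D g ks U X"
    and coframe: "dual_coframe A U X \<nu>"
begin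

abbreviation E :: "nat list \<Rightarrow> 'a \<Rightarrow> 'a tvec" where
  "E I \<equiv> nested_bracket A (map X I)"

abbreviation F :: "nat \<Rightarrow> 'a \<Rightarrow> 'a tvec set" where
  "F i \<equiv> flag A D i"

abbreviation covec :: "nat list \<Rightarrow> 'a \<Rightarrow> ('a tvec \<Rightarrow> real) list" where
  "covec I p \<equiv> map (\<lambda>l. \<nu> l p) I"

lemma open_U: "open U"
  using frame by (simp add: adapted_frame_def)

lemma subspace_distribution: "subspace (D p)"
proof -
  obtain Y where "basis_family k (\<lambda>l. Y l p) (D p)"
    using distribution unfolding smooth_distribution_def by blast
  then show ?thesis unfolding basis_family_def by (metis subspace_span)
qed

lemma distribution_tangent: "D p \<subseteq> tangent_space A p"
  using distribution unfolding smooth_distribution_def by blast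

lemma subspace_flag: "subspace (F i p)"
proof (induction i)
  case (Suc i)
  then show ?case
    using subspace_sums[OF Suc.IH subspace_span]
    by (cases i) (auto simp: subspace_distribution)
qed simp

lemma flag_mono_Suc: "F i p \<subseteq> F (Suc i) p"
proof (cases i)
  case 0
  then show ?thesis using subspace_0[OF subspace_distribution] by simp
next
  case (Suc j)
  show ?thesis
    unfolding Suc flag.simps by (force intro: exI[of _ "0::'a tvec"] span_zero)
qed

lemma flag_mono: "i \<le> j \<Longrightarrow> F i p \<subseteq> F j p"
  using lift_Suc_mono_le[of "\<lambda>i. F i p"] flag_mono_Suc by blast

lemma bracket_in_flag:
  assumes "p \<in> V" "smooth_section A (F i) V Y" "smooth_section A D V Z" "i \<ge> 1"
  shows "lie_bracket A Y Z p \<in> F (Suc i) p"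
proof -
  obtain j where j: "i = Suc j" using assms(4) by (cases i) auto
  have "lie_bracket A Y Z p \<in> span {lie_bracket A V W p | U V W. p \<in> U \<and>
                 smooth_section A (F (Suc j)) U V \<and> smooth_section A D U W}"
    using assms j by (intro span_base) blast
  moreover have "0 \<in> F (Suc j) p" using subspace_0[OF subspace_flag] .
  ultimately show ?thesis unfolding j flag.simps by force
qed

lemma bracket_in_flag_swapped:
  assumes "p \<in> V" "smooth_section A (F i) V Y" "smooth_section A D V Z" "i \<ge> 1"
  shows "lie_bracket A Z Y p \<in> F (Suc i) p"
  using bracket_in_flag[OF assms] subspace_neg[OF subspace_flag] lie_bracket_antisym[of Z Y p] by simp

lemma flag_tangent: "F i p \<subseteq> tangent_space A p"
proof (induction i)
  case 0
  then show ?case using subspace_0[OF subspace_tangent_space] by simp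
next
  case (Suc i)
  show ?case
  proof (cases i)
    case 0
    then show ?thesis using distribution_tangent by simp
  next
    case [simp]: (Suc j)
    have "span {lie_bracket A V W p | U V W. p \<in> U \<and>
                 smooth_section A (F (Suc j)) U V \<and> smooth_section A D U W} \<subseteq> tangent_space A p"
      by (intro span_minimal subspace_tangent_space)
        (auto simp: smooth_section_def intro: lie_bracket_tangent)
    then show ?thesis
      using Suc.IH by (auto intro!: subspace_add[OF subspace_tangent_space])
  qed
qed

lemma X_field: "l < mdim A \<Longrightarrow> vector_field A U (X l)"
  using frame by (simp add: adapted_frame_def)

lemma basis_flag: "p \<in> U \<Longrightarrow> basis_family (ks i) (\<lambda>l. X l p) (F i p)"
  using frame by (simp add: adapted_frame_def)

lemma basis_tangent: "p \<in> U \<Longrightarrow> basis_family (mdim A) (\<lambda>l. X l p) (tangent_space A p)"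
  using frame by (simp add: adapted_frame_def)

lemma span_flag: "p \<in> U \<Longrightarrow> span ((\<lambda>l. X l p) ` {..<ks i}) = F i p"
  using basis_flag unfolding basis_family_def by auto

lemma X_in_flag: "p \<in> U \<Longrightarrow> l < ks i \<Longrightarrow> X l p \<in> F i p"
  using span_flag[of p i, symmetric] by (auto intro: span_base)

lemma indep_X: "p \<in> U \<Longrightarrow> indep_family (ks i) (\<lambda>l. X l p)"
  using basis_flag by (simp add: basis_family_alt)

lemma ks_mono: "p \<in> U \<Longrightarrow> i \<le> j \<Longrightarrow> ks i \<le> ks j"
  using indep_family_le[OF indep_X, of p i "\<lambda>l. X l p" "ks j"] span_flag[of p j]
    flag_mono[of i j p] X_in_flag[of p _ i] by blast

lemma ks_le: "p \<in> U \<Longrightarrow> ks i \<le> mdim A"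
proof -
  assume p: "p \<in> U"
  have "span ((\<lambda>l. X l p) ` {..<mdim A}) = tangent_space A p"
    using basis_tangent[OF p] by (simp add: basis_family_def)
  then show "ks i \<le> mdim A"
    using indep_family_le[OF indep_X[OF p], of i "\<lambda>l. X l p" "mdim A"]
      flag_tangent[of i p] X_in_flag[OF p, of _ i] by blast
qed

lemma ks_0: "p \<in> U \<Longrightarrow> ks 0 = 0"
proof -
  assume p: "p \<in> U"
  have "(\<lambda>l. X l p) ` {..<ks 0} \<subseteq> span ((\<lambda>l. X l p) ` {..<0})"
    using X_in_flag[OF p, of _ 0] by auto
  then show "ks 0 = 0" using indep_family_le[OF indep_X[OF p], of 0 "\<lambda>l. X l p" 0] by blast
qed

lemma ks_step: "p \<in> U \<Longrightarrow> ks m = mdim A"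
proof -
  assume p: "p \<in> U"
  have i: "indep_family (mdim A) (\<lambda>l. X l p)"
    and s: "span ((\<lambda>l. X l p) ` {..<mdim A}) = tangent_space A p"
    using basis_tangent[OF p] by (simp_all add: basis_family_alt)
  have "span ((\<lambda>l. X l p) ` {..<ks m}) = tangent_space A p"
    using span_flag[OF p, of m] step by (simp add: has_step_def)
  then have "mdim A \<le> ks m"
    using span_superset[of "(\<lambda>l. X l p) ` {..<mdim A}"] s
      indep_family_le[OF i, of "\<lambda>l. X l p" "ks m"] by simp
  then show "ks m = mdim A" using ks_le[OF p, of m] by simp
qed

lemma linear_\<nu>: "p \<in> U \<Longrightarrow> l < mdim A \<Longrightarrow> linear (\<nu> l p)"
  using coframe by (auto simp: dual_coframe_def dual_family_def frame_at_def)

lemma \<nu>_X: "p \<in> U \<Longrightarrow> i < mdim A \<Longrightarrow> j < mdim A \<Longrightarrow> \<nu> i p (X j p) = (if i = j then 1 else 0)"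
  using coframe by (auto simp: dual_coframe_def dual_family_def frame_at_def)

lemma \<nu>_combination:
  assumes "p \<in> U" "h < mdim A" "S \<subseteq> {..<mdim A}"
  shows "\<nu> h p (\<Sum>l\<in>S. c l *\<^sub>R X l p) = (if h \<in> S then c h else 0)"
proof -
  have "\<nu> h p (\<Sum>l\<in>S. c l *\<^sub>R X l p) = (\<Sum>l\<in>S. c l * (if h = l then 1 else 0))"
    using assms by (subst linear_sum[OF linear_\<nu>])
      (auto simp: linear_scale[OF linear_\<nu>] \<nu>_X intro!: sum.cong)
  also have "\<dots> = (\<Sum>l\<in>S. if l = h then c h else 0)" by (intro sum.cong) auto
  also have "\<dots> = (if h \<in> S then c h else 0)" using finite_subset[OF assms(3)] by (simp add: sum.delta)
  finally show ?thesis .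
qed

lemma tangent_expand:
  assumes "p \<in> U" "v \<in> tangent_space A p"
  shows "v = (\<Sum>l<mdim A. \<nu> l p v *\<^sub>R X l p)"
proof -
  obtain c where c: "v = (\<Sum>l<mdim A. c l *\<^sub>R X l p)"
    using assms basis_tangent[OF assms(1)] span_family_iff[of "{..<mdim A}" v "\<lambda>l. X l p"]
    by (auto simp: basis_family_def)
  have "\<nu> l p v = c l" if "l < mdim A" for l
    unfolding c using assms that by (subst \<nu>_combination) auto
  then show ?thesis using c by simp
qed

text \<open>
  The frame is adapted, so the flag spaces are coordinate subspaces.
\<close>

lemma flag_iff:
  assumes "p \<in> U" "v \<in> tangent_space A p"
  shows "v \<in> F i p \<longleftrightarrow> (\<forall>l<mdim A. ks i \<le> l \<longrightarrow> \<nu> l p v = 0)"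
proof
  assume "v \<in> F i p"
  then obtain c where c: "v = (\<Sum>l<ks i. c l *\<^sub>R X l p)"
    using assms span_flag[OF assms(1), of i] span_family_iff[of "{..<ks i}" v "\<lambda>l. X l p"] by auto
  show "\<forall>l<mdim A. ks i \<le> l \<longrightarrow> \<nu> l p v = 0"
    unfolding c using assms ks_le[of p i] by (auto simp: \<nu>_combination)
next
  assume a: "\<forall>l<mdim A. ks i \<le> l \<longrightarrow> \<nu> l p v = 0"
  have "v = (\<Sum>l<mdim A. \<nu> l p v *\<^sub>R X l p)" using tangent_expand[OF assms] .
  also have "\<dots> = (\<Sum>l<ks i. \<nu> l p v *\<^sub>R X l p)"
    using a ks_le[OF assms(1), of i] by (intro sum.mono_neutral_right) auto
  also have "\<dots> \<in> F i p"
    using assms by (auto intro!: subspace_sum subspace_scale subspace_flag X_in_flag)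
  finally show "v \<in> F i p" .
qed

lemma flag_expand:
  assumes "p \<in> U" "v \<in> F i p"
  shows "v = (\<Sum>l<ks i. \<nu> l p v *\<^sub>R X l p)"
proof -
  have v: "v \<in> tangent_space A p" using assms flag_tangent by blast
  have "v = (\<Sum>l<mdim A. \<nu> l p v *\<^sub>R X l p)" using tangent_expand[OF assms(1) v] .
  also have "\<dots> = (\<Sum>l<ks i. \<nu> l p v *\<^sub>R X l p)"
    using flag_iff[OF assms(1) v] assms ks_le[OF assms(1), of i] by (intro sum.mono_neutral_right) auto
  finally show ?thesis .
qed

lemma flag_1 [simp]: "F 1 = D" "F (Suc 0) = D"
  by simp_all

lemma inner_combination:
  assumes "p \<in> U" "\<And>l. l \<in> S \<Longrightarrow> l < ks 1" "w \<in> D p"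
  shows "g p (\<Sum>l\<in>S. c l *\<^sub>R X l p) w = (\<Sum>l\<in>S. c l * g p (X l p) w)"
proof -
  have lin: "g p (a *\<^sub>R x + c *\<^sub>R y) z = a * g p x z + c * g p y z"
    if "x \<in> D p" "y \<in> D p" "z \<in> D p" for x y z a c
    using metric that unfolding smooth_metric_def inner_product_on_def by blast
  have D0: "0 \<in> D p" using subspace_0[OF subspace_distribution] .
  have 0: "g p 0 w = 0" using lin[OF D0 D0 assms(3), of 0 0] by simp
  show ?thesis using assms(2)
  proof (induction S rule: infinite_finite_induct)
    case (insert x S)
    have "(\<Sum>l\<in>S. c l *\<^sub>R X l p) \<in> D p"
      using insert.prems assms(1) X_in_flag[OF assms(1), of _ 1]
      by (auto intro!: subspace_sum subspace_scale subspace_distribution)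
    then have "g p (c x *\<^sub>R X x p + 1 *\<^sub>R (\<Sum>l\<in>S. c l *\<^sub>R X l p)) w =
        c x * g p (X x p) w + 1 * g p (\<Sum>l\<in>S. c l *\<^sub>R X l p) w"
      using insert.prems X_in_flag[OF assms(1), of x 1] assms(3) by (intro lin) auto
    moreover have "g p (\<Sum>l\<in>S. c l *\<^sub>R X l p) w = (\<Sum>l\<in>S. c l * g p (X l p) w)"
      using insert by blast
    ultimately show ?case
      by (simp only: sum.insert[OF insert.hyps] scaleR_one mult_1)
  qed (simp_all add: 0)
qed

lemma inner_sym: "v \<in> D p \<Longrightarrow> w \<in> D p \<Longrightarrow> g p v w = g p w v"
  using metric unfolding smooth_metric_def inner_product_on_def by blast

lemma inner_X: "p \<in> U \<Longrightarrow> i < ks 1 \<Longrightarrow> j < ks 1 \<Longrightarrow> g p (X i p) (X j p) = (if i = j then 1 else 0)"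
  using frame by (simp add: adapted_frame_def)

lemma inner_X_right:
  assumes "p \<in> U" "v \<in> D p" "l < ks 1"
  shows "g p v (X l p) = \<nu> l p v"
proof -
  have "g p v (X l p) = g p (\<Sum>h<ks 1. \<nu> h p v *\<^sub>R X h p) (X l p)"
    using flag_expand[of p v 1] assms by simp
  also have "\<dots> = (\<Sum>h<ks 1. \<nu> h p v * g p (X h p) (X l p))"
    using assms X_in_flag[of p l 1] by (subst inner_combination) auto
  also have "\<dots> = (\<Sum>h<ks 1. if h = l then \<nu> h p v else 0)"
    using assms by (intro sum.cong refl) (simp add: inner_X)
  also have "\<dots> = \<nu> l p v" using assms by (simp add: sum.delta)
  finally show ?thesis .
qed

lemma inner_eq_sum:
  assumes "p \<in> U" "v \<in> D p" "w \<in> D p"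
  shows "g p v w = (\<Sum>l<ks 1. \<nu> l p v * \<nu> l p w)"
proof -
  have "g p v w = g p (\<Sum>h<ks 1. \<nu> h p v *\<^sub>R X h p) w"
    using flag_expand[of p v 1] assms by simp
  also have "\<dots> = (\<Sum>h<ks 1. \<nu> h p v * g p (X h p) w)"
    using assms by (subst inner_combination) auto
  also have "\<dots> = (\<Sum>l<ks 1. \<nu> l p v * \<nu> l p w)"
  proof (intro sum.cong refl)
    fix l assume "l \<in> {..<ks 1}"
    then have "g p (X l p) w = \<nu> l p w"
      using inner_sym[of "X l p" p w] inner_X_right[of p w l] X_in_flag[of p l 1] assms by simp
    then show "\<nu> l p v * g p (X l p) w = \<nu> l p v * \<nu> l p w" by simp
  qed
  finally show ?thesis .
qed

section \<open>Brackets are tensorial modulo the flag\<close>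

lemma X_section:
  assumes "p0 \<in> U" "open V" "V \<subseteq> U" "l < ks 1"
  shows "smooth_section A D V (X l)"
  using assms ks_le[OF assms(1), of 1] X_in_flag[of _ l 1] vector_field_subset[OF X_field, of l V]
  by (auto simp: smooth_section_def)

text \<open>
  In an orthonormal frame the coefficients of a section are inner products with the frame
  fields, and these are smooth because the metric is.
\<close>

lemma section_coefficient_smooth:
  assumes "smooth_section A D V Y" "V \<subseteq> U" "l < ks 1"
  shows "smooth_fun A V (\<lambda>p. \<nu> l p (Y p))"
proof (cases "V = {}")
  case True
  then show ?thesis by (simp add: smooth_fun_empty)
next
  case False
  then obtain p0 where "p0 \<in> U" using assms(2) by blast
  have "smooth_section A D V (X l)"
    using X_section[OF \<open>p0 \<in> U\<close> _ assms(2,3)] assms(1) by (simp add: smooth_section_def vector_field_def)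
  then have "smooth_fun A V (\<lambda>p. g p (Y p) (X l p))"
    using metric assms(1) unfolding smooth_metric_def by blast
  then show ?thesis
    by (rule smooth_fun_cong) (use assms in \<open>auto simp: smooth_section_def inner_X_right\<close>)
qed

lemma nested_bracket_section:
  assumes "Vs \<noteq> []" "\<And>Y. Y \<in> set Vs \<Longrightarrow> smooth_section A D V Y"
  shows "smooth_section A (F (length Vs)) V (nested_bracket A Vs)"
  using assms
proof (induction Vs rule: list_nonempty_induct)
  case (single Y)
  then show ?case by simp
next
  case (cons Y Vs)
  obtain W Ws where Vs: "Vs = W # Ws" using cons.hyps by (cases Vs) auto
  have Y: "smooth_section A D V Y" using cons.prems by simp
  have N: "smooth_section A (F (length Vs)) V (nested_bracket A Vs)" using cons by simp
  have "nested_bracket A (Y # Vs) = lie_bracket A Y (nested_bracket A Vs)" by (simp add: Vs)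
  moreover have "1 \<le> length Vs" using cons.hyps by (cases Vs) auto
  ultimately show ?case
    using bracket_in_flag_swapped[OF _ N Y] vector_field_bracket[of V Y "nested_bracket A Vs"] Y N
    by (simp add: smooth_section_def)
qed

lemma E_section:
  assumes "I \<in> multi_index (ks 1) i" "i \<ge> 1"
  shows "smooth_section A (F i) U (E I)"
proof (cases "U = {}")
  case True
  then show ?thesis by (auto simp: smooth_section_def vector_field_def smooth_fun_empty)
next
  case False
  then obtain p0 where "p0 \<in> U" by blast
  then show ?thesis
    using nested_bracket_section[of "map X I" U] X_section[of p0 U] open_U assms
    by (fastforce simp: multi_index_def)
qed

lemma tens_coefficient_smooth:
  assumes "p0 \<in> U" "V \<subseteq> U" "open V" "\<And>Y. Y \<in> set Vs \<Longrightarrow> smooth_section A D V Y"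
    and "I \<in> multi_index (ks 1) (length Vs)"
  shows "smooth_fun A V (\<lambda>p. tens (map (\<lambda>Y. Y p) Vs) (covec I p))"
  using assms(4,5)
proof (induction Vs arbitrary: I)
  case Nil
  then show ?case using smooth_fun_const[OF assms(3)] by simp
next
  case (Cons Y Vs)
  obtain l J where I: "I = l # J" "l < ks 1" "J \<in> multi_index (ks 1) (length Vs)"
    using Cons.prems(2) by (auto simp: multi_index_def length_Suc_conv)
  have "smooth_fun A V (\<lambda>p. \<nu> l p (Y p) * tens (map (\<lambda>Y. Y p) Vs) (covec J p))"
    using Cons I assms by (intro smooth_fun_mult section_coefficient_smooth) auto
  then show ?case
    by (rule smooth_fun_cong)
      (use I assms ks_le[OF assms(1), of 1] in \<open>auto simp: tens_Cons linear_\<nu>\<close>)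
qed

text \<open>
  Tensoriality of iterated brackets. Expand the inner bracket as a combination of frame brackets
  plus a section \<open>R\<close> of the preceding flag space, and the outer section in the frame. By the Leibniz
  rule, bracketing produces the expected combination together with three kinds of error terms:
  derivatives of coefficients times inner frame brackets, derivatives of coefficients times frame
  fields, and \<open>[Y, R]\<close>. All of them lie one step lower in the flag than the bracket itself.
\<close>

lemma nested_bracket_tensorial:
  assumes "Vs \<noteq> []" "\<And>Y. Y \<in> set Vs \<Longrightarrow> smooth_section A D V Y" "V \<subseteq> U" "open V" "p \<in> V"
  shows "nested_bracket A Vs p -
      (\<Sum>I\<in>multi_index (ks 1) (length Vs). tens (map (\<lambda>Y. Y p) Vs) (covec I p) *\<^sub>R E I p)
      \<in> F (length Vs - 1) p"
  using assms(1,2,5)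
proof (induction Vs arbitrary: p rule: list_nonempty_induct)
  case (single Y)
  have p: "p \<in> U" and Y: "Y p \<in> D p" using single assms by (auto simp: smooth_section_def)
  have "linear (\<nu> l p)" if "l < ks 1" for l using linear_\<nu>[OF p] ks_le[OF p, of 1] that by simp
  then have "(\<Sum>I\<in>multi_index (ks 1) (length [Y]). tens (map (\<lambda>Y. Y p) [Y]) (covec I p) *\<^sub>R E I p)
    = (\<Sum>l<ks 1. \<nu> l p (Y p) *\<^sub>R X l p)"
    by (simp add: sum_multi_index_Suc tens_Cons)
  also have "\<dots> = Y p" using flag_expand[OF p, of "Y p" 1] Y by simp
  finally have eq: "(\<Sum>I\<in>multi_index (ks 1) (length [Y]). tens (map (\<lambda>Y. Y p) [Y]) (covec I p) *\<^sub>R E I p)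
    = Y p" .
  show ?case unfolding eq nested_bracket.simps diff_self using subspace_0[OF subspace_flag] .
next
  case (cons Y Vs)
  define i where "i = length Vs"
  define M where "M = multi_index (ks 1) i"
  define N where "N = nested_bracket A Vs"
  define c where "c I p = tens (map (\<lambda>Y. Y p) Vs) (covec I p)" for I p
  define R where "R = (\<lambda>p. N p - (\<Sum>I\<in>M. c I p *\<^sub>R E I p))"
  have p: "p \<in> U" using cons assms by auto
  have i: "i \<ge> 1" using cons.hyps by (cases Vs) (auto simp: i_def)
  have Y: "smooth_section A D V Y" using cons.prems by simp
  then have Yf: "vector_field A V Y" by (simp add: smooth_section_def)
  have YD: "Y p \<in> D p" if "p \<in> V" for p using Y that by (simp add: smooth_section_def)
  have N: "smooth_section A (F i) V N"
    unfolding N_def i_def using cons by (intro nested_bracket_section) auto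
  have c: "smooth_fun A V (c I)" if "I \<in> M" for I
    unfolding c_def using tens_coefficient_smooth[OF p assms(3,4), of Vs I] cons.prems that
    by (simp add: M_def i_def)
  have Ef: "vector_field A V (E I)" if "I \<in> M" for I
    using E_section[of I i] that i assms(3,4) vector_field_subset[of U "E I" V]
    by (auto simp: M_def smooth_section_def)
  have E_flag: "E I p \<in> F i p" if "I \<in> M" for I
    using E_section[of I i] that i p by (auto simp: M_def smooth_section_def)
  have S: "vector_field A V (\<lambda>p. \<Sum>I\<in>M. c I p *\<^sub>R E I p)"
    by (intro vector_field_combination assms c Ef)
  have Nf: "vector_field A V N" using N by (simp add: smooth_section_def)
  have Rf: "vector_field A V R" unfolding R_def by (rule vector_field_diff[OF Nf S])
  have R: "smooth_section A (F (i - 1)) V R"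
    unfolding smooth_section_def
  proof (intro conjI ballI Rf)
    show "R x \<in> F (i - 1) x" if "x \<in> V" for x
      unfolding R_def c_def M_def i_def N_def by (rule cons.IH) (use cons.prems that in auto)
  qed
  have YR: "lie_bracket A Y R p \<in> F i p"
  \<comment> \<open>the flag takes brackets of sections of \<open>F i\<close> only from \<open>i = 1\<close> on, and here \<open>R\<close> is a section
           of \<open>F 0\<close>, so it vanishes identically\<close>
  proof (cases "i = 1")
    case True
    have "lie_bracket A Y R p = lie_bracket A Y (\<lambda>p. \<Sum>i\<in>{}. 0 *\<^sub>R Y p) p"
      using R True cons.prems(2) assms(4) vector_field_combination[of V "{}" "\<lambda>_ _. 0" "\<lambda>_. Y"]
      by (intro lie_bracket_cong[OF Yf Rf]) (auto simp: smooth_section_def)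
    moreover have "lie_bracket A Y (\<lambda>p. \<Sum>i\<in>{}. 0 *\<^sub>R Y p) p = 0"
      using lie_bracket_combination[OF Yf, where S="{}" and f="\<lambda>_ _. 0" and Y="\<lambda>_. Y"] cons.prems
      by simp
    ultimately have "lie_bracket A Y R p = 0" by (rule trans)
    then show ?thesis using subspace_0[OF subspace_flag[of i p]] by metis
  next
    case False
    then show ?thesis using bracket_in_flag_swapped[OF cons.prems(2) R Y] i by simp
  qed
  have YE: "lie_bracket A Y (E I) p =
      (\<Sum>l<ks 1. \<nu> l p (Y p) *\<^sub>R E (l # I) p) - (\<Sum>l<ks 1. E I p (\<lambda>p. \<nu> l p (Y p)) *\<^sub>R X l p)"
    if I: "I \<in> M" for I
  proof -
    have Xf: "vector_field A V (X l)" if "l < ks 1" for l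
      using X_section[OF p assms(4,3) that] by (simp add: smooth_section_def)
    have cf: "smooth_fun A V (\<lambda>p. \<nu> l p (Y p))" if "l < ks 1" for l
      using section_coefficient_smooth[OF Y assms(3) that] .
    have "lie_bracket A (E I) Y p = lie_bracket A (E I) (\<lambda>p. \<Sum>l<ks 1. \<nu> l p (Y p) *\<^sub>R X l p) p"
    proof (rule lie_bracket_cong[OF Ef[OF I] Yf _ cons.prems(2)])
      show "vector_field A V (\<lambda>p. \<Sum>l<ks 1. \<nu> l p (Y p) *\<^sub>R X l p)"
        by (intro vector_field_combination assms cf Xf) auto
      show "Y x = (\<Sum>l<ks 1. \<nu> l x (Y x) *\<^sub>R X l x)" if "x \<in> V" for x
        using flag_expand[of x "Y x" 1] YD[OF that] that assms(3) by auto
    qed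
    also have "\<dots> = (\<Sum>l<ks 1. \<nu> l p (Y p) *\<^sub>R lie_bracket A (E I) (X l) p
        + E I p (\<lambda>p. \<nu> l p (Y p)) *\<^sub>R X l p)"
      by (rule lie_bracket_combination[OF Ef[OF I] _ _ cons.prems(2)]) (auto intro: cf Xf)
    also have "\<dots> = (\<Sum>l<ks 1. - (\<nu> l p (Y p) *\<^sub>R E (l # I) p) + E I p (\<lambda>p. \<nu> l p (Y p)) *\<^sub>R X l p)"
    proof (intro sum.cong refl)
      fix l
      obtain a J where "I = a # J" using I i by (cases I) (auto simp: M_def multi_index_def)
      then have "E (l # I) p = lie_bracket A (X l) (E I) p" by simp
      then show "\<nu> l p (Y p) *\<^sub>R lie_bracket A (E I) (X l) p + E I p (\<lambda>p. \<nu> l p (Y p)) *\<^sub>R X l p =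
        - (\<nu> l p (Y p) *\<^sub>R E (l # I) p) + E I p (\<lambda>p. \<nu> l p (Y p)) *\<^sub>R X l p"
        using lie_bracket_antisym[of "E I" "X l" p] by simp
    qed
    finally show ?thesis
      using lie_bracket_antisym[of Y "E I" p] by (simp add: sum.distrib sum_negf sum_subtractf)
  qed
  have YR': "lie_bracket A Y R p = lie_bracket A Y N p - lie_bracket A Y (\<lambda>p. \<Sum>I\<in>M. c I p *\<^sub>R E I p) p"
    unfolding R_def by (rule lie_bracket_diff[OF Yf Nf S cons.prems(2)])
  have YS: "lie_bracket A Y (\<lambda>p. \<Sum>I\<in>M. c I p *\<^sub>R E I p) p =
      (\<Sum>I\<in>M. c I p *\<^sub>R lie_bracket A Y (E I) p + Y p (c I) *\<^sub>R E I p)"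
    by (rule lie_bracket_combination[OF Yf c Ef cons.prems(2)])
  have YN: "lie_bracket A Y N p = lie_bracket A Y R p +
      (\<Sum>I\<in>M. c I p *\<^sub>R lie_bracket A Y (E I) p + Y p (c I) *\<^sub>R E I p)"
    unfolding YR' YS by (rule diff_add_cancel[symmetric])
  have "(\<Sum>I\<in>multi_index (ks 1) (Suc i). tens (map (\<lambda>Y. Y p) (Y # Vs)) (covec I p) *\<^sub>R E I p)
    = (\<Sum>l<ks 1. \<Sum>I\<in>M. (\<nu> l p (Y p) * c I p) *\<^sub>R E (l # I) p)"
    unfolding sum_multi_index_Suc M_def using ks_le[OF p, of 1]
    by (intro sum.cong refl) (simp add: c_def tens_Cons linear_\<nu>[OF p])
  also have "\<dots> = (\<Sum>I\<in>M. \<Sum>l<ks 1. (\<nu> l p (Y p) * c I p) *\<^sub>R E (l # I) p)"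
    by (rule sum.swap)
  also have "\<dots> = (\<Sum>I\<in>M. c I p *\<^sub>R (\<Sum>l<ks 1. \<nu> l p (Y p) *\<^sub>R E (l # I) p))"
    by (simp add: scaleR_sum_right mult.commute)
  finally have T: "(\<Sum>I\<in>multi_index (ks 1) (Suc i). tens (map (\<lambda>Y. Y p) (Y # Vs)) (covec I p) *\<^sub>R E I p)
    = (\<Sum>I\<in>M. c I p *\<^sub>R (\<Sum>l<ks 1. \<nu> l p (Y p) *\<^sub>R E (l # I) p))" .
  have "nested_bracket A (Y # Vs) p = lie_bracket A Y N p"
    using i by (cases Vs) (auto simp: N_def i_def)
  then have nb: "nested_bracket A (Y # Vs) p = lie_bracket A Y R p +
      (\<Sum>I\<in>M. c I p *\<^sub>R lie_bracket A Y (E I) p + Y p (c I) *\<^sub>R E I p)"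
    using YN by simp
  define G where "G I = (\<Sum>l<ks 1. \<nu> l p (Y p) *\<^sub>R E (l # I) p)" for I
  define H where "H I = (\<Sum>l<ks 1. E I p (\<lambda>p. \<nu> l p (Y p)) *\<^sub>R X l p)" for I
  have "(\<Sum>I\<in>M. c I p *\<^sub>R lie_bracket A Y (E I) p + Y p (c I) *\<^sub>R E I p) - (\<Sum>I\<in>M. c I p *\<^sub>R G I)
      = (\<Sum>I\<in>M. Y p (c I) *\<^sub>R E I p - c I p *\<^sub>R H I)"
    unfolding sum_subtractf[symmetric]
  proof (intro sum.cong refl)
    fix I assume "I \<in> M"
    then have "lie_bracket A Y (E I) p = G I - H I" unfolding G_def H_def by (rule YE)
    then show "c I p *\<^sub>R lie_bracket A Y (E I) p + Y p (c I) *\<^sub>R E I p - c I p *\<^sub>R G I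
        = Y p (c I) *\<^sub>R E I p - c I p *\<^sub>R H I"
      by (simp add: scaleR_diff_right)
  qed
  then have "nested_bracket A (Y # Vs) p -
      (\<Sum>I\<in>multi_index (ks 1) (Suc i). tens (map (\<lambda>Y. Y p) (Y # Vs)) (covec I p) *\<^sub>R E I p) =
    lie_bracket A Y R p + (\<Sum>I\<in>M. Y p (c I) *\<^sub>R E I p - c I p *\<^sub>R H I)"
    unfolding T nb G_def[symmetric] by (simp only: add_diff_eq[symmetric])
  moreover have "\<dots> \<in> F i p"
    unfolding H_def using X_in_flag[OF p, of _ 1] flag_mono[OF i, of p]
    by (intro subspace_add subspace_sum subspace_diff subspace_scale subspace_flag YR E_flag) auto
  ultimately have "nested_bracket A (Y # Vs) p -
      (\<Sum>I\<in>multi_index (ks 1) (Suc i). tens (map (\<lambda>Y. Y p) (Y # Vs)) (covec I p) *\<^sub>R E I p) \<in> F i p"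
    by (simp only:)
  moreover have "length (Y # Vs) = Suc i" by (simp add: i_def)
  ultimately show ?case by (simp only: diff_Suc_1)
qed

end

section \<open>The flag is spanned by brackets of the frame\<close>

context atlas
begin

text \<open>
  Independent tangent vectors at a point are separated by functions. This is linear algebra:
  a functional that is no combination of the others differs from the combination that agrees
  with it on the functions found so far, and the difference is detected by some function.
\<close>

lemma dual_functions:
  assumes "\<And>l. l < r \<Longrightarrow> y l \<in> tangent_space A q" "indep_family r y"
  shows "\<exists>f. \<forall>a<r. smooth_near A q (f a) \<and> (\<forall>l<r. y l (f a) = (if l = a then 1 else 0))"
  using assms
proof (induction r)
  case 0
  then show ?case by simp
next
  case (Suc r)
  have yt: "y l \<in> tangent_space A q" if "l \<le> r" for l using Suc.prems(1) that by simp
  have "indep_family r y"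
    using Suc.prems(2) independent_mono[of "y ` {..<Suc r}" "y ` {..<r}"]
      inj_on_subset[of y "{..<Suc r}" "{..<r}"] image_mono[of "{..<r}" "{..<Suc r}" y]
    unfolding indep_family_def by auto
  then obtain f where f: "\<And>a. a < r \<Longrightarrow> smooth_near A q (f a)"
    "\<And>a l. a < r \<Longrightarrow> l < r \<Longrightarrow> y l (f a) = (if l = a then 1 else 0)"
    using Suc by (metis less_Suc_eq)
  define z where "z h = (\<Sum>a<r. y r (f a) * y a h)" for h
  have "\<exists>h. y r h \<noteq> z h"
  proof (rule ccontr)
    assume "\<not> ?thesis"
    then have e: "y r h = z h" for h by blast
    define c where "c l = (if l = r then 1 else - y r (f l))" for l
    have "(\<Sum>l<Suc r. c l *\<^sub>R y l) h = 0" for h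
      using e[of h] by (simp add: sum_fun_apply c_def z_def sum_negf)
    then have "(\<Sum>l<Suc r. c l *\<^sub>R y l) = 0" unfolding fun_eq_iff zero_fun_apply by blast
    then have "c r = 0" using Suc.prems(2) unfolding indep_family_iff by blast
    then show False by (simp add: c_def)
  qed
  then obtain h where h: "y r h \<noteq> z h" by blast
  have hn: "smooth_near A q h"
  proof (rule ccontr)
    assume "\<not> ?thesis"
    then have "y l h = 0" if "l \<le> r" for l using tangent_not_smooth[OF yt[OF that]] by blast
    then show False using h by (simp add: z_def)
  qed
  define t where "t = y r h - z h"
  \<comment> \<open>\<open>h\<close> corrected by the earlier functions and normalised, so that \<open>y r\<close> takes the value 1 on it and
           the other functionals vanish\<close>
  define f0 where "f0 = (\<lambda>p. (1 / t) * (h p - (\<Sum>a<r. y a h * f a p)))"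
  define f' where "f' a = (if a = r then f0 else (\<lambda>p. 1 * f a p + (- y r (f a)) * f0 p))" for a
  have t: "t \<noteq> 0" using h by (simp add: t_def)
  have scn: "smooth_near A q (\<lambda>p. c * u p)" if "smooth_near A q u" for c u
    using smooth_near_algebra(1)[OF that that, of c 0] by simp
  have Sn: "smooth_near A q (\<lambda>p. \<Sum>a<r. y a h * f a p)"
    by (intro smooth_near_sum scn f) simp
  have f0: "smooth_near A q f0"
    unfolding f0_def using smooth_near_algebra(1)[OF hn Sn, of "1 / t" "- 1 / t"]
    by (simp add: algebra_simps)
  have scale: "v (\<lambda>p. c * u p) = c * v u" if "v \<in> tangent_space A q" "smooth_near A q u" for v c u
    using tangent_lincomb[OF that that(2), of c 0] by simp
  have yf0: "y l f0 = (1 / t) * (y l h - (\<Sum>a<r. y a h * y l (f a)))" if "l \<le> r" for l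
  proof -
    have "y l f0 = (1 / t) * y l (\<lambda>p. h p - (\<Sum>a<r. y a h * f a p))"
      unfolding f0_def using smooth_near_algebra(1)[OF hn Sn, of 1 "-1"]
      by (intro scale yt that) simp
    also have "\<dots> = (1 / t) * (y l h - y l (\<lambda>p. \<Sum>a<r. y a h * f a p))"
      by (simp only: tangent_diff[OF yt[OF that] hn Sn])
    also have "y l (\<lambda>p. \<Sum>a<r. y a h * f a p) = (\<Sum>a<r. y l (\<lambda>p. y a h * f a p))"
      by (rule tangent_sum[OF yt[OF that]]) (intro scn f, simp)
    also have "\<dots> = (\<Sum>a<r. y a h * y l (f a))"
      by (intro sum.cong refl scale yt that f) simp
    finally show ?thesis .
  qed
  have yf0_l: "y l f0 = 0" if "l < r" for l
  proof -
    have "(\<Sum>a<r. y a h * y l (f a)) = (\<Sum>a<r. if a = l then y a h else 0)"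
      using f(2)[OF _ that] by (intro sum.cong refl) auto
    then show ?thesis using yf0[of l] that by (simp add: sum.delta)
  qed
  have yf0_r: "y r f0 = 1"
    using yf0[of r] t by (simp add: t_def z_def mult.commute)
  show ?case
  proof (intro exI[of _ f'] allI impI conjI)
    fix a assume a: "a < Suc r"
    show "smooth_near A q (f' a)"
      using a f(1)[of a] f0 smooth_near_algebra(1)[of q "f a" f0 1 "- y r (f a)"]
      unfolding f'_def by (cases "a = r") simp_all
    fix l assume l: "l < Suc r"
    show "y l (f' a) = (if l = a then 1 else 0)"
    proof (cases "a = r")
      case True
      then show ?thesis using l yf0_l[of l] yf0_r by (auto simp: f'_def less_Suc_eq)
    next
      case False
      then have ar: "a < r" using a by simp
      have "y l (f' a) = 1 * y l (f a) + (- y r (f a)) * y l f0"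
        unfolding f'_def if_not_P[OF False] 
        by (rule tangent_lincomb[OF yt[OF less_Suc_eq_le[THEN iffD1, OF l]] f(1)[OF ar] f0])
      then show ?thesis using l f(2)[OF ar] yf0_l[of l] yf0_r ar by (auto simp: less_Suc_eq)
    qed
  qed
qed

text \<open>
  Fields that are independent at a point are independent nearby, and sections of their span have
  smooth coefficients up to the common factor \<open>d\<close>, the determinant of the fields applied to a dual
  system of functions: by Cramer's rule \<open>d\<close> times a coefficient is again a determinant of smooth
  functions. Keeping the factor \<open>d\<close> avoids differentiating quotients.
\<close>

lemma local_frame:
  assumes "open V" "q \<in> V" "\<And>l. l < r \<Longrightarrow> vector_field A V (Y l)" "indep_family r (\<lambda>l. Y l q)"
  obtains W d where "open W" "q \<in> W" "W \<subseteq> V" "smooth_fun A W d" "\<And>p. p \<in> W \<Longrightarrow> d p \<noteq> 0"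
    "\<And>p. p \<in> W \<Longrightarrow> indep_family r (\<lambda>l. Y l p)"
    "\<forall>Z. vector_field A W Z \<and> (\<forall>p\<in>W. Z p \<in> span ((\<lambda>l. Y l p) ` {..<r})) \<longrightarrow>
       (\<exists>s. (\<forall>l<r. smooth_fun A W (s l)) \<and> (\<forall>p\<in>W. d p *\<^sub>R Z p = (\<Sum>l<r. s l p *\<^sub>R Y l p)))"
proof -
  obtain f where f: "\<And>a. a < r \<Longrightarrow> smooth_near A q (f a)"
    "\<And>a l. a < r \<Longrightarrow> l < r \<Longrightarrow> Y l q (f a) = (if l = a then 1 else 0)"
    using dual_functions[of r "\<lambda>l. Y l q" q] assms vector_field_tangent by metis
  have "\<forall>a\<in>{..<r}. \<exists>N. q \<in> N \<and> smooth_fun A N (f a)"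
    using f(1) unfolding smooth_near_def by blast
  then obtain N where N: "\<And>a. a < r \<Longrightarrow> q \<in> N a" "\<And>a. a < r \<Longrightarrow> smooth_fun A (N a) (f a)"
    by (auto simp: bchoice_iff)
  define V0 where "V0 = V \<inter> (\<Inter>a<r. N a)"
  have V0: "open V0" "q \<in> V0" "V0 \<subseteq> V"
    unfolding V0_def using assms(1,2) N smooth_fun_open by (auto intro!: open_Int open_INT)
  have fs: "smooth_fun A V0 (f a)" if "a < r" for a
    using smooth_fun_subset[OF N(2)[OF that] V0(1)] that by (auto simp: V0_def)
  define M where "M p = mat r r (\<lambda>(a, l). Y l p (f a))" for p
  define d where "d p = det (M p)" for p
  have ds: "smooth_fun A V0 d"
    unfolding d_def M_def
    by (intro smooth_fun_det V0 vector_field_smooth[OF assms(3)] fs)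
  define W where "W = {p \<in> V0. d p \<noteq> 0}"
  have "W = V0 \<inter> d -` (- {0})" by (auto simp: W_def)
  then have Wo: "open W"
    using continuous_open_preimage[OF smooth_fun_continuous[OF ds] V0(1), of "- {0}"]
    by (simp add: open_Compl)
  have "M q = 1\<^sub>m r" using f(2) by (auto simp: M_def)
  then have "d q = 1" by (simp add: d_def)
  then have qW: "q \<in> W" using V0 by (simp add: W_def)
  have WV: "W \<subseteq> V" "W \<subseteq> V0" using V0 by (auto simp: W_def)
  have Mc: "M p \<in> carrier_mat r r" for p by (simp add: M_def)
  have Mv: "M p *\<^sub>v vec r c = vec r (\<lambda>a. (\<Sum>l<r. c l *\<^sub>R Y l p) (f a))" for p c
    by (rule eq_vecI) (auto simp: M_def scalar_prod_def sum_fun_apply mult.commute atLeast0LessThan)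
  have ind: "indep_family r (\<lambda>l. Y l p)" if "p \<in> W" for p
    unfolding indep_family_iff
  proof (intro allI impI)
    fix c l assume c: "(\<Sum>l<r. c l *\<^sub>R Y l p) = 0" and l: "l < r"
    have "M p *\<^sub>v vec r c = 0\<^sub>v r" unfolding Mv c by auto
    moreover have "det (M p) \<noteq> 0" using that by (simp add: W_def d_def)
    ultimately have "vec r c = 0\<^sub>v r"
      using det_0_iff_vec_prod_zero_field[OF Mc, of p] vec_carrier by metis
    then have "vec r c $ l = 0\<^sub>v r $ l" by simp
    then show "c l = 0" using l by simp
  qed
  have coef: "\<exists>s. (\<forall>l<r. smooth_fun A W (s l)) \<and> (\<forall>p\<in>W. d p *\<^sub>R Z p = (\<Sum>l<r. s l p *\<^sub>R Y l p))"
    if Z: "vector_field A W Z" and sp: "\<And>p. p \<in> W \<Longrightarrow> Z p \<in> span ((\<lambda>l. Y l p) ` {..<r})" for Z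
  proof -
    define s where "s l p = det (mat r r (\<lambda>(a, j). if j = l then Z p (f a) else Y j p (f a)))" for l p
    have "smooth_fun A W (s l)" for l
      unfolding s_def
    proof (rule smooth_fun_det[OF Wo])
      fix a j assume aj: "a < r" "j < r"
      have fW: "smooth_fun A W (f a)" using smooth_fun_subset[OF fs[OF aj(1)] Wo WV(2)] .
      show "smooth_fun A W (\<lambda>p. if j = l then Z p (f a) else Y j p (f a))"
        using vector_field_smooth[OF Z order_refl fW] vector_field_smooth[OF assms(3)[OF aj(2)] WV(1) fW]
        by (cases "j = l") simp_all
    qed
    moreover have "d p *\<^sub>R Z p = (\<Sum>l<r. s l p *\<^sub>R Y l p)" if p: "p \<in> W" for p
    proof -
      obtain c where c: "Z p = (\<Sum>l<r. c l *\<^sub>R Y l p)"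
        using sp[OF p] span_family_iff[of "{..<r}" "Z p" "\<lambda>l. Y l p"] by auto
      have "s l p = c l * d p" if l: "l < r" for l
      proof -
        have "mat r r (\<lambda>(a, j). if j = l then Z p (f a) else Y j p (f a)) =
            replace_col (M p) (M p *\<^sub>v vec r c) l"
          unfolding Mv c[symmetric] by (rule eq_matI) (auto simp: replace_col_def M_def)
        then show ?thesis
          using cramer_lemma_mat[OF Mc, of "vec r c" l p] l by (simp add: s_def d_def)
      qed
      then have "(\<Sum>l<r. s l p *\<^sub>R Y l p) = (\<Sum>l<r. d p *\<^sub>R (c l *\<^sub>R Y l p))"
        by (intro sum.cong refl) (simp add: mult.commute)
      then show ?thesis unfolding c by (simp only: scaleR_sum_right)
    qed
    ultimately show ?thesis by blast
  qed
  show thesis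
  proof (rule that[OF Wo qW WV(1) smooth_fun_subset[OF ds Wo WV(2)] _ ind])
    show "d p \<noteq> 0" if "p \<in> W" for p using that by (simp add: W_def)
  qed (assumption, intro allI impI, elim conjE, rule coef, assumption, erule (1) bspec)
qed

end

context adapted
begin

text \<open>
  The empty list is excluded because its bracket is zero by convention.
\<close>

definition bracket_span :: "nat \<Rightarrow> 'a \<Rightarrow> 'a tvec set" where
  "bracket_span i q = span ((\<lambda>I. E I q) ` {I. I \<noteq> [] \<and> length I \<le> i \<and> set I \<subseteq> {..<ks 1}})"

lemma E_in_bracket_span:
  "I \<in> multi_index (ks 1) j \<Longrightarrow> 1 \<le> j \<Longrightarrow> j \<le> i \<Longrightarrow> E I q \<in> bracket_span i q"
  unfolding bracket_span_def multi_index_def by (intro span_base) auto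

lemma bracket_span_mono: "i \<le> j \<Longrightarrow> bracket_span i q \<subseteq> bracket_span j q"
  unfolding bracket_span_def by (intro span_mono image_mono) auto

lemma subspace_bracket_span: "subspace (bracket_span i q)"
  unfolding bracket_span_def by (rule subspace_span)

lemma bracket_span_subset_flag:
  assumes "q \<in> U" shows "bracket_span i q \<subseteq> F i q"
  unfolding bracket_span_def
proof (rule span_minimal[OF _ subspace_flag], safe)
  fix I assume I: "I \<noteq> []" "length I \<le> i" "set I \<subseteq> {..<ks 1}"
  have "smooth_section A (F (length I)) U (E I)"
    using I by (intro E_section) (auto simp: multi_index_def Suc_le_eq)
  then show "E I q \<in> F i q"
    using assms flag_mono[OF I(2), of q] unfolding smooth_section_def by blast
qed

text \<open>
  A basis of the span chosen among the brackets themselves, so that its members are vector fields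
  near the point and not only vectors at it.
\<close>

lemma bracket_span_basis:
  obtains idx :: "nat \<Rightarrow> nat list" and r where "\<And>l. l < r \<Longrightarrow> idx l \<noteq> []" "\<And>l. l < r \<Longrightarrow> length (idx l) \<le> i"
    "\<And>l. l < r \<Longrightarrow> set (idx l) \<subseteq> {..<ks 1}"
    "indep_family r (\<lambda>l. E (idx l) q)" "span ((\<lambda>l. E (idx l) q) ` {..<r}) = bracket_span i q"
proof -
  let ?S = "{I. I \<noteq> [] \<and> length I \<le> i \<and> set I \<subseteq> {..<ks 1}}"
  have fin: "finite ?S"
    using finite_lists_length_le[of "{..<ks 1}" i] by (rule finite_subset[rotated]) auto
  obtain B where B: "B \<subseteq> (\<lambda>I. E I q) ` ?S" "independent B" "(\<lambda>I. E I q) ` ?S \<subseteq> span B"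
    by (rule maximal_independent_subset)
  obtain T where T: "T \<subseteq> ?S" "inj_on (\<lambda>I. E I q) T" "B = (\<lambda>I. E I q) ` T"
    using B(1)[unfolded subset_image_inj] by (elim exE conjE) (rule that)
  have "finite T" using finite_subset[OF T(1) fin] .
  then obtain idx where idx: "bij_betw idx {0..<card T} T"
    using ex_bij_betw_nat_finite by blast
  then have im: "idx ` {..<card T} = T" and inj: "inj_on idx {..<card T}"
    by (auto simp: bij_betw_def atLeast0LessThan)
  have imB: "(\<lambda>l. E (idx l) q) ` {..<card T} = B"
    using T(3) im image_image[of "\<lambda>I. E I q" idx "{..<card T}"] by simp
  have "inj_on (\<lambda>l. E (idx l) q) {..<card T}"
    using comp_inj_on[OF inj, of "\<lambda>I. E I q"] T(2) im by (simp add: comp_def)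
  then have "indep_family (card T) (\<lambda>l. E (idx l) q)"
    using B(2) imB by (simp add: indep_family_def)
  moreover have "span ((\<lambda>l. E (idx l) q) ` {..<card T}) = bracket_span i q"
    unfolding imB bracket_span_def
    using span_mono[OF B(1)] span_minimal[OF B(3) subspace_span] by (rule antisym)
  moreover have "idx l \<in> ?S" if "l < card T" for l
    using im T(1) that by auto
  ultimately show thesis by (intro that[of "card T" idx]) auto
qed

lemma bracket_section_E:
  assumes "smooth_section A D V Y" "V \<subseteq> U" "open V" "q \<in> V"
    and "I \<noteq> []" "length I \<le> i" "set I \<subseteq> {..<ks 1}" and sub: "F i q \<subseteq> bracket_span i q"
  shows "lie_bracket A Y (E I) q \<in> bracket_span (Suc i) q"
proof -
  let ?Vs = "Y # map X I"
  have q: "q \<in> U" using assms by blast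
  have b: "nested_bracket A ?Vs q = lie_bracket A Y (E I) q"
    using assms(5) by (cases I) auto
  let ?S = "\<Sum>J\<in>multi_index (ks 1) (length ?Vs). tens (map (\<lambda>Y. Y q) ?Vs) (covec J q) *\<^sub>R E J q"
  have a: "nested_bracket A ?Vs q - ?S \<in> F (length ?Vs - 1) q"
    using assms X_section[OF q assms(3,2)] by (intro nested_bracket_tensorial[of _ V]) auto
  have s: "F (length ?Vs - 1) q \<subseteq> bracket_span (Suc i) q"
    using flag_mono[OF assms(6), of q] sub bracket_span_mono[of i "Suc i" q] by auto
  have "?S \<in> bracket_span (Suc i) q"
    using assms(6)
    by (intro subspace_sum[OF subspace_bracket_span] subspace_scale[OF subspace_bracket_span]
      E_in_bracket_span) auto
  then have "(nested_bracket A ?Vs q - ?S) + ?S \<in> bracket_span (Suc i) q"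
    by (rule subspace_add[OF subspace_bracket_span subsetD[OF s a]])
  then show ?thesis unfolding diff_add_cancel b .
qed

text \<open>
  Near a point, the brackets that form a basis of the flag space there are still independent, and
  equal dimensions make them a frame of the flag distribution. So a section of \<open>F i\<close> is locally a
  combination of brackets with smooth coefficients, and the Leibniz rule expresses its bracket
  with a section of the distribution through brackets of length at most \<open>i + 1\<close>. The equality has to
  be known at all points of the frame's domain, so the point varies in the induction.
\<close>

lemma flag_eq_bracket_span:
  assumes "q \<in> U"
  shows "F i q = bracket_span i q"
  using assms
proof (induction i arbitrary: q)
  case 0
  have "{I. I \<noteq> [] \<and> length I \<le> 0 \<and> set I \<subseteq> {..<ks 1}} = {}" by auto
  then show ?case unfolding bracket_span_def flag.simps by (simp only: image_empty span_empty)
next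
  case (Suc i)
  have "F (Suc i) q \<subseteq> bracket_span (Suc i) q"
  proof (cases i)
    case 0
    have "F 1 q \<subseteq> bracket_span 1 q"
      unfolding span_flag[OF Suc.prems, symmetric]
    proof (rule span_minimal[OF image_subsetI subspace_bracket_span])
      fix l assume "l \<in> {..<ks 1}"
      then show "X l q \<in> bracket_span 1 q"
        using E_in_bracket_span[of "[l]" 1 1 q] by (simp add: multi_index_def)
    qed
    then show ?thesis using 0 by simp
  next
    case (Suc j)
    have br: "lie_bracket A Z Y q \<in> bracket_span (Suc i) q"
      if qV: "q \<in> V" and Z: "smooth_section A (F i) V Z" and Y: "smooth_section A D V Y" for V Z Y
    proof -
      have V: "open V" using Z by (simp add: smooth_section_def vector_field_def)
      define V' where "V' = V \<inter> U"
      have V': "open V'" "q \<in> V'" "V' \<subseteq> U" "V' \<subseteq> V"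
        using V open_U qV Suc.prems by (auto simp: V'_def)
      obtain idx r where idx: "\<And>l. l < r \<Longrightarrow> idx l \<noteq> []" "\<And>l. l < r \<Longrightarrow> length (idx l) \<le> i"
        "\<And>l. l < r \<Longrightarrow> set (idx l) \<subseteq> {..<ks 1}"
        and ind: "indep_family r (\<lambda>l. E (idx l) q)"
        and sp: "span ((\<lambda>l. E (idx l) q) ` {..<r}) = bracket_span i q"
        by (rule bracket_span_basis[of i q]) (rule that)
      have spF: "span ((\<lambda>l. E (idx l) q) ` {..<r}) = F i q" using sp Suc.IH[OF Suc.prems] by simp
      \<comment> \<open>the flag has constant rank, so as many independent brackets span it at the nearby points too\<close>
      have r: "r = ks i"
      proof (rule antisym)
        show "r \<le> ks i"
          using indep_family_le[OF ind, of "\<lambda>l. X l q" "ks i"] spF span_flag[OF Suc.prems, of i]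
            span_superset by metis
        show "ks i \<le> r"
          using indep_family_le[OF indep_X[OF Suc.prems], of i "\<lambda>l. E (idx l) q" r] spF
            span_flag[OF Suc.prems, of i] span_superset by metis
      qed
      have Ef: "smooth_section A (F i) U (E (idx l))" if "l < r" for l
      proof -
        have "smooth_section A (F (length (idx l))) U (E (idx l))"
          using idx[OF that] by (intro E_section) (auto simp: multi_index_def Suc_le_eq)
        then show ?thesis
          using flag_mono[OF idx(2)[OF that]] unfolding smooth_section_def by blast
      qed
      have EV': "vector_field A V' (E (idx l))" if "l < r" for l
        using Ef[OF that] V' vector_field_subset unfolding smooth_section_def by blast
      obtain W d where W: "open W" "q \<in> W" "W \<subseteq> V'" "smooth_fun A W d" "\<And>p. p \<in> W \<Longrightarrow> d p \<noteq> 0"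
        "\<And>p. p \<in> W \<Longrightarrow> indep_family r (\<lambda>l. E (idx l) p)"
        "\<forall>Z. vector_field A W Z \<and> (\<forall>p\<in>W. Z p \<in> span ((\<lambda>l. E (idx l) p) ` {..<r})) \<longrightarrow>
          (\<exists>s. (\<forall>l<r. smooth_fun A W (s l)) \<and> (\<forall>p\<in>W. d p *\<^sub>R Z p = (\<Sum>l<r. s l p *\<^sub>R E (idx l) p)))"
        by (rule local_frame[OF V'(1,2) EV' ind]) (assumption, rule that)
      have WU: "W \<subseteq> U" "W \<subseteq> V" using W V' by auto
      have Zf: "vector_field A W Z" and Yf: "vector_field A W Y"
        using Z Y WU W(1) vector_field_subset unfolding smooth_section_def by blast+
      have Ysec: "smooth_section A D W Y" using Y Yf WU unfolding smooth_section_def by blast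
      have EW: "vector_field A W (E (idx l))" if "l < r" for l
        using vector_field_subset[OF EV'[OF that] W(1,3)] .
      have Zsp: "Z p \<in> span ((\<lambda>l. E (idx l) p) ` {..<r})" if p: "p \<in> W" for p
      proof -
        have pU: "p \<in> U" using p WU by blast
        have "(\<lambda>l. E (idx l) p) ` {..<r} \<subseteq> F i p"
          using Ef pU unfolding smooth_section_def by blast
        then have "span ((\<lambda>l. E (idx l) p) ` {..<r}) = F i p"
          using indep_family_spans[OF W(6)[OF p], of "\<lambda>l. X l p"] span_flag[OF pU, of i] r by simp
        then show ?thesis using Z p WU unfolding smooth_section_def by blast
      qed
      have "\<exists>s. (\<forall>l<r. smooth_fun A W (s l)) \<and> (\<forall>p\<in>W. d p *\<^sub>R Z p = (\<Sum>l<r. s l p *\<^sub>R E (idx l) p))"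
        by (rule W(7)[THEN spec, THEN mp]) (intro conjI ballI Zf Zsp)
      then obtain s where s': "\<forall>l<r. smooth_fun A W (s l)"
        "\<forall>p\<in>W. d p *\<^sub>R Z p = (\<Sum>l<r. s l p *\<^sub>R E (idx l) p)"
        by (elim exE conjE) (rule that)
      note s = s'(1)[rule_format] s'(2)[rule_format]
      have dZ: "vector_field A W (\<lambda>p. d p *\<^sub>R Z p)"
        using vector_field_combination[OF W(1), of "{0::nat}" "\<lambda>_. d" "\<lambda>_. Z"] W(4) Zf by simp
      have sE: "vector_field A W (\<lambda>p. \<Sum>l<r. s l p *\<^sub>R E (idx l) p)"
        using s EW by (intro vector_field_combination W) auto
      have e1: "lie_bracket A Y (\<lambda>p. d p *\<^sub>R Z p) q = d q *\<^sub>R lie_bracket A Y Z q + Y q d *\<^sub>R Z q"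
        using lie_bracket_combination[OF Yf, of "{0::nat}" "\<lambda>_. d" "\<lambda>_. Z" q] W(2,4) Zf by simp
      have e2: "lie_bracket A Y (\<lambda>p. \<Sum>l<r. s l p *\<^sub>R E (idx l) p) q =
          (\<Sum>l<r. s l q *\<^sub>R lie_bracket A Y (E (idx l)) q + Y q (s l) *\<^sub>R E (idx l) q)"
        using s EW by (intro lie_bracket_combination[OF Yf _ _ W(2)]) auto
      \<comment> \<open>the two expansions of \<open>[Y, d Z]\<close> at \<open>q\<close> can be solved for \<open>[Y, Z]\<close>, as \<open>d q\<close> is not zero\<close>
      have e3: "lie_bracket A Y (\<lambda>p. d p *\<^sub>R Z p) q =
          lie_bracket A Y (\<lambda>p. \<Sum>l<r. s l p *\<^sub>R E (idx l) p) q"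
        using lie_bracket_cong[OF Yf dZ sE W(2) s(2)] .
      have Eq: "E (idx l) q \<in> bracket_span (Suc i) q" if "l < r" for l
        using idx[OF that] by (intro E_in_bracket_span[of _ "length (idx l)"])
          (auto simp: multi_index_def Suc_le_eq)
      have YE: "lie_bracket A Y (E (idx l)) q \<in> bracket_span (Suc i) q" if "l < r" for l
        using bracket_section_E[OF Ysec WU(1) W(1,2) idx[OF that]] Suc.IH[OF Suc.prems] by blast
      have Zq: "Z q \<in> bracket_span (Suc i) q"
        using Z qV Suc.IH[OF Suc.prems] bracket_span_mono[of i "Suc i" q]
        unfolding smooth_section_def by auto
      have "(\<Sum>l<r. s l q *\<^sub>R lie_bracket A Y (E (idx l)) q + Y q (s l) *\<^sub>R E (idx l) q) - Y q d *\<^sub>R Z q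
          \<in> bracket_span (Suc i) q"
        by (intro subspace_diff subspace_sum subspace_add subspace_scale subspace_bracket_span Zq)
          (auto intro: Eq YE)
      moreover have "d q *\<^sub>R lie_bracket A Y Z q =
          (\<Sum>l<r. s l q *\<^sub>R lie_bracket A Y (E (idx l)) q + Y q (s l) *\<^sub>R E (idx l) q) - Y q d *\<^sub>R Z q"
        unfolding e2[symmetric] e3[symmetric] e1 by (rule add_diff_cancel_right'[symmetric])
      ultimately have "d q *\<^sub>R lie_bracket A Y Z q \<in> bracket_span (Suc i) q" by (simp only:)
      then have "inverse (d q) *\<^sub>R (d q *\<^sub>R lie_bracket A Y Z q) \<in> bracket_span (Suc i) q"
        by (rule subspace_scale[OF subspace_bracket_span])
      then have "lie_bracket A Y Z q \<in> bracket_span (Suc i) q"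
        unfolding scaleR_scaleR left_inverse[OF W(5)[OF W(2)]] scaleR_one .
      then show ?thesis
        unfolding lie_bracket_antisym[of Z Y q] by (rule subspace_neg[OF subspace_bracket_span])
    qed
    have "span {lie_bracket A Z Y q | V Z Y. q \<in> V \<and> smooth_section A (F (Suc j)) V Z \<and>
        smooth_section A D V Y} \<subseteq> bracket_span (Suc i) q"
      using br Suc by (intro span_minimal subspace_bracket_span) blast
    moreover have "F (Suc j) q \<subseteq> bracket_span (Suc i) q"
      using Suc.IH[OF Suc.prems] bracket_span_mono[of i "Suc i" q] Suc by auto
    ultimately show ?thesis
      unfolding Suc flag.simps using subspace_add[OF subspace_bracket_span] by blast
  qed
  then show ?case using bracket_span_subset_flag[OF Suc.prems] by blast
qed

end

section \<open>Tensor powers in terms of a basis\<close>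

text \<open>
  Multilinear expansion. The coefficient of the basis tensor with multi-index \<open>I\<close> is the value of the
  tensor on the covectors \<open>\<xi>\<close> listed by \<open>I\<close>, because tensors are functions of lists of covectors;
  so extracting a coefficient is an evaluation, hence linear on the whole function space.
\<close>

lemma tens_expand:
  assumes "\<And>v. v \<in> set vs \<Longrightarrow> v = (\<Sum>l<k. \<xi> l v *\<^sub>R x l)" "\<And>l. l < k \<Longrightarrow> linear (\<xi> l)"
  shows "tens vs = (\<Sum>I\<in>multi_index k (length vs). tens vs (map \<xi> I) *\<^sub>R tens (map x I))"
proof
  fix \<alpha>s
  have "tens vs \<alpha>s = (\<Sum>I\<in>multi_index k (length vs). tens vs (map \<xi> I) * tens (map x I) \<alpha>s)"
  proof (cases "length \<alpha>s = length vs \<and> (\<forall>\<alpha>\<in>set \<alpha>s. linear \<alpha>)")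
    case False
    then have "tens (map x I) \<alpha>s = 0" if "I \<in> multi_index k (length vs)" for I
      using that by (auto simp: tens_def multi_index_def)
    moreover have "tens vs \<alpha>s = 0" using False by (auto simp: tens_def)
    ultimately show ?thesis by simp
  next
    case True
    then have "length \<alpha>s = length vs" "\<forall>\<alpha>\<in>set \<alpha>s. linear \<alpha>" by auto
    then show ?thesis using assms(1)
    proof (induction \<alpha>s vs rule: list_induct2)
      case Nil
      then show ?case by simp
    next
      case (Cons \<alpha> \<alpha>s v vs)
      have lin: "linear \<alpha>" using Cons.prems by simp
      have "v = (\<Sum>l<k. \<xi> l v *\<^sub>R x l)" using Cons.prems(2) by simp
      then have "\<alpha> v = \<alpha> (\<Sum>l<k. \<xi> l v *\<^sub>R x l)" by (rule arg_cong)
      then have av: "\<alpha> v = (\<Sum>l<k. \<xi> l v * \<alpha> (x l))"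
        by (simp add: linear_sum[OF lin] linear_scale[OF lin])
      have IH: "tens vs \<alpha>s = (\<Sum>I\<in>multi_index k (length vs). tens vs (map \<xi> I) * tens (map x I) \<alpha>s)"
        using Cons.prems by (intro Cons.IH) auto
      have "tens (v # vs) (\<alpha> # \<alpha>s) = \<alpha> v * tens vs \<alpha>s" by (rule tens_Cons[OF lin])
      also have "\<dots> = (\<Sum>l<k. \<Sum>I\<in>multi_index k (length vs).
          (\<xi> l v * \<alpha> (x l)) * (tens vs (map \<xi> I) * tens (map x I) \<alpha>s))"
        unfolding av IH by (rule sum_product)
      also have "\<dots> = (\<Sum>l<k. \<Sum>I\<in>multi_index k (length vs).
          tens (v # vs) (map \<xi> (l # I)) * tens (map x (l # I)) (\<alpha> # \<alpha>s))"
        using assms(2) by (intro sum.cong refl) (simp add: tens_Cons[OF lin] tens_Cons mult_ac)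
      also have "\<dots> = (\<Sum>I\<in>multi_index k (length (v # vs)).
          tens (v # vs) (map \<xi> I) * tens (map x I) (\<alpha> # \<alpha>s))"
        by (simp only: list.size sum_multi_index_Suc add_0_right add_Suc_right One_nat_def)
      finally show ?case .
    qed
  qed
  then show "tens vs \<alpha>s = (\<Sum>I\<in>multi_index k (length vs). tens vs (map \<xi> I) *\<^sub>R tens (map x I)) \<alpha>s"
    by (simp add: sum_fun_apply)
qed

lemma tens_dual:
  assumes "\<And>l. l < k \<Longrightarrow> linear (\<xi> l)"
    and "\<And>h l. h < k \<Longrightarrow> l < k \<Longrightarrow> \<xi> h (x l) = (if h = l then 1 else 0)"
    and "I \<in> multi_index k i" "J \<in> multi_index k i"
  shows "tens (map x I) (map \<xi> J) = (if I = J then 1 else 0)"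
  using assms(3,4)
proof (induction i arbitrary: I J)
  case (Suc i)
  obtain a I' where I: "I = a # I'" "a < k" "I' \<in> multi_index k i"
    using Suc.prems(1) by (auto simp: multi_index_def length_Suc_conv)
  obtain c J' where J: "J = c # J'" "c < k" "J' \<in> multi_index k i"
    using Suc.prems(2) by (auto simp: multi_index_def length_Suc_conv)
  show ?case
    using Suc.IH[OF I(3) J(3)] assms(1)[OF J(2)] assms(2)[OF J(2) I(2)] I(1) J(1)
    by (auto simp: tens_Cons)
qed simp

text \<open>
  The inner product of elementary tensors is the Euclidean one in the coordinates of an
  orthonormal frame.
\<close>

lemma prod_inner_eq_tens:
  assumes "length vs = length ws" "\<And>l. l < k \<Longrightarrow> linear (\<xi> l)"
    and "\<And>v w. v \<in> set vs \<Longrightarrow> w \<in> set ws \<Longrightarrow> B v w = (\<Sum>l<k. \<xi> l v * \<xi> l w)"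
  shows "(\<Prod>j<length vs. B (vs ! j) (ws ! j)) =
    (\<Sum>I\<in>multi_index k (length vs). tens vs (map \<xi> I) * tens ws (map \<xi> I))"
  using assms(1,3)
proof (induction vs ws rule: list_induct2)
  case (Cons v vs w ws)
  have IH: "(\<Prod>j<length vs. B (vs ! j) (ws ! j)) =
    (\<Sum>I\<in>multi_index k (length vs). tens vs (map \<xi> I) * tens ws (map \<xi> I))"
    using Cons.prems by (intro Cons.IH) auto
  have B: "B v w = (\<Sum>l<k. \<xi> l v * \<xi> l w)" using Cons.prems by simp
  have "(\<Prod>j<length (v # vs). B ((v # vs) ! j) ((w # ws) ! j)) =
      B v w * (\<Prod>j<length vs. B (vs ! j) (ws ! j))"
    by (simp add: prod.lessThan_Suc_shift del: prod.lessThan_Suc)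
  also have "\<dots> = (\<Sum>l<k. \<Sum>I\<in>multi_index k (length vs).
      (\<xi> l v * \<xi> l w) * (tens vs (map \<xi> I) * tens ws (map \<xi> I)))"
    unfolding B IH by (rule sum_product)
  also have "\<dots> = (\<Sum>l<k. \<Sum>I\<in>multi_index k (length vs).
      tens (v # vs) (map \<xi> (l # I)) * tens (w # ws) (map \<xi> (l # I)))"
    using assms(2) by (intro sum.cong refl) (simp add: tens_Cons mult_ac)
  also have "\<dots> = (\<Sum>I\<in>multi_index k (length (v # vs)).
      tens (v # vs) (map \<xi> I) * tens (w # ws) (map \<xi> I))"
    by (simp only: list.size sum_multi_index_Suc add_0_right add_Suc_right One_nat_def)
  finally show ?case .
qed simp

section \<open>The Popp map and the induced norm\<close>

context adapted
begin

\<comment> \<open>keeps \<open>ks (i - 1)\<close> and \<open>F (i - 1)\<close> in the form in which the facts below state them\<close>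
declare One_nat_def [simp del]

lemma linear_\<nu>_horizontal: "q \<in> U \<Longrightarrow> l < ks 1 \<Longrightarrow> linear (\<nu> l q)"
  using linear_\<nu> ks_le[of q 1] by simp

lemma \<nu>_X_horizontal:
  "q \<in> U \<Longrightarrow> h < ks 1 \<Longrightarrow> l < ks 1 \<Longrightarrow> \<nu> h q (X l q) = (if h = l then 1 else 0)"
  using \<nu>_X ks_le[of q 1] by simp

abbreviation tens_frame :: "nat list \<Rightarrow> 'a \<Rightarrow> ('a tvec \<Rightarrow> real) list \<Rightarrow> real" where
  "tens_frame I q \<equiv> tens (map (\<lambda>l. X l q) I)"

abbreviation cls :: "nat \<Rightarrow> 'a \<Rightarrow> 'a tvec \<Rightarrow> ('a tvec \<Rightarrow> real) \<Rightarrow> real" where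
  "cls i q \<equiv> qclass (F (i - 1) q)"

lemma tens_frame_covec:
  assumes "q \<in> U" "I \<in> multi_index (ks 1) i" "J \<in> multi_index (ks 1) i"
  shows "tens_frame I q (covec J q) = (if I = J then 1 else 0)"
  using assms by (intro tens_dual[of "ks 1" "\<lambda>l. \<nu> l q" "\<lambda>l. X l q"] linear_\<nu>_horizontal \<nu>_X_horizontal)

lemma tens_frame_in_power:
  assumes "q \<in> U" "I \<in> multi_index (ks 1) i"
  shows "tens_frame I q \<in> tensor_power i (D q)"
  unfolding tensor_power_def using assms X_in_flag[OF assms(1), of _ 1]
  by (intro span_base CollectI exI[of _ "map (\<lambda>l. X l q) I"]) (auto simp: multi_index_def)

lemma linear_eval_sum: "linear (\<lambda>T :: 'x \<Rightarrow> real. \<Sum>I\<in>S. T (f I) *\<^sub>R (e I :: 'y::real_vector))"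
  by (rule linearI) (simp_all add: scaleR_add_left sum.distrib scaleR_sum_right)

lemma tensor_power_expand:
  assumes "q \<in> U" "Z \<in> tensor_power i (D q)"
  shows "Z = (\<Sum>I\<in>multi_index (ks 1) i. Z (covec I q) *\<^sub>R tens_frame I q)"
proof -
  have "(\<lambda>Z. Z) Z = (\<Sum>I\<in>multi_index (ks 1) i. Z (covec I q) *\<^sub>R tens_frame I q)"
  proof (rule linear_eq_on_span[OF linear_ident linear_eval_sum, OF _ assms(2)[unfolded tensor_power_def]])
    fix T assume "T \<in> {tens vs |vs. length vs = i \<and> set vs \<subseteq> D q}"
    then obtain vs where T: "T = tens vs" "length vs = i" "set vs \<subseteq> D q" by blast
    show "T = (\<Sum>I\<in>multi_index (ks 1) i. T (covec I q) *\<^sub>R tens_frame I q)"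
      unfolding T(1) T(2)[symmetric]
    proof (rule tens_expand)
      show "v = (\<Sum>l<ks 1. \<nu> l q v *\<^sub>R X l q)" if "v \<in> set vs" for v
        using flag_expand[OF assms(1), of v 1] that T by auto
    qed (rule linear_\<nu>_horizontal[OF assms(1)])
  qed
  then show ?thesis .
qed

text \<open>
  A map with the values that define the Popp map exists by tensoriality: evaluate a tensor on the
  covectors of a multi-index and use the result as the coefficient of the class of the frame bracket. On
  tensors of frame vectors the defining property, applied to the frame fields, gives the values.
\<close>

lemma popp_map_frame:
  assumes q: "q \<in> U" and i: "i \<ge> 1"
  shows "linear (popp_map A D i q)"
    and "I \<in> multi_index (ks 1) i \<Longrightarrow> popp_map A D i q (tens_frame I q) = cls i q (E I q)"
proof -
  let ?P = "\<lambda>\<pi>. linear \<pi> \<and> (\<forall>V Vs. q \<in> V \<and> length Vs = i \<and> (\<forall>Y\<in>set Vs. smooth_section A D V Y) \<longrightarrow>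
        \<pi> (tens (map (\<lambda>Y. Y q) Vs)) = qclass (flag A D (i - 1) q) (nested_bracket A Vs q))"
  let ?\<pi> = "\<lambda>T. \<Sum>I\<in>multi_index (ks 1) i. T (covec I q) *\<^sub>R cls i q (E I q)"
  have "?P ?\<pi>"
  proof (intro conjI allI impI; (elim conjE)?)
    show "linear ?\<pi>" by (rule linear_eval_sum)
    fix V Vs assume V: "q \<in> V" "length Vs = i" "\<forall>Y\<in>set Vs. smooth_section A D V Y"
    have "Vs \<noteq> []" using V i by auto
    then have oV: "open V" using V(3) by (cases Vs) (auto simp: smooth_section_def vector_field_def)
    have sec: "smooth_section A D (V \<inter> U) Y" if "Y \<in> set Vs" for Y
      using V(3) that oV open_U vector_field_subset[of V Y "V \<inter> U"] by (auto simp: smooth_section_def)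
    have "nested_bracket A Vs q -
      (\<Sum>I\<in>multi_index (ks 1) (length Vs). tens (map (\<lambda>Y. Y q) Vs) (covec I q) *\<^sub>R E I q)
      \<in> F (length Vs - 1) q"
      using V q oV open_U by (intro nested_bracket_tensorial[OF \<open>Vs \<noteq> []\<close> sec]) auto
    then have "cls i q (nested_bracket A Vs q) =
      cls i q (\<Sum>I\<in>multi_index (ks 1) i. tens (map (\<lambda>Y. Y q) Vs) (covec I q) *\<^sub>R E I q)"
      unfolding qclass_eq_iff[OF subspace_flag] V(2) .
    then show "?\<pi> (tens (map (\<lambda>Y. Y q) Vs)) = cls i q (nested_bracket A Vs q)"
      by (simp only: linear_sum[OF linear_qclass] linear_scale[OF linear_qclass])
  qed
  then have P: "?P (popp_map A D i q)" unfolding popp_map_def by (rule someI[of ?P ?\<pi>])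
  then show "linear (popp_map A D i q)" by blast
  assume I: "I \<in> multi_index (ks 1) i"
  have "popp_map A D i q (tens (map (\<lambda>Y. Y q) (map X I))) = cls i q (E I q)"
    using I q X_section[OF q open_U order_refl]
    by (intro P[THEN conjunct2, rule_format]) (auto simp: multi_index_def)
  then show "popp_map A D i q (tens_frame I q) = cls i q (E I q)" by (simp add: comp_def)
qed

lemma popp_map_eq:
  assumes q: "q \<in> U" and i: "i \<ge> 1" and Z: "Z \<in> tensor_power i (D q)"
  shows "popp_map A D i q Z = (\<Sum>I\<in>multi_index (ks 1) i. Z (covec I q) *\<^sub>R cls i q (E I q))"
proof -
  have "popp_map A D i q Z =
      popp_map A D i q (\<Sum>I\<in>multi_index (ks 1) i. Z (covec I q) *\<^sub>R tens_frame I q)"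
    using tensor_power_expand[OF q Z] by (rule arg_cong)
  also have "\<dots> = (\<Sum>I\<in>multi_index (ks 1) i. Z (covec I q) *\<^sub>R popp_map A D i q (tens_frame I q))"
    by (simp only: linear_sum[OF popp_map_frame(1)[OF q i]] linear_scale[OF popp_map_frame(1)[OF q i]])
  finally show ?thesis
    by (simp only: popp_map_frame(2)[OF q i] cong: sum.cong)
qed

text \<open>
  As for the Popp map, the chosen form is pinned down by exhibiting one with the required values
  and expanding both arguments in frame tensors.
\<close>

lemma tensor_inner_eq:
  assumes q: "q \<in> U" and Z: "Z \<in> tensor_power i (D q)" "W \<in> tensor_power i (D q)"
  shows "tensor_inner D g i q Z W = (\<Sum>I\<in>multi_index (ks 1) i. Z (covec I q) * W (covec I q))"
proof -
  let ?P = "\<lambda>B. bilinear B \<and>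
     (\<forall>vs ws. length vs = i \<and> length ws = i \<and> set vs \<subseteq> D q \<and> set ws \<subseteq> D q \<longrightarrow>
        B (tens vs) (tens ws) = (\<Prod>j<i. g q (vs ! j) (ws ! j)))"
  let ?B = "\<lambda>Z W :: ('a tvec \<Rightarrow> real) list \<Rightarrow> real. \<Sum>I\<in>multi_index (ks 1) i. Z (covec I q) * W (covec I q)"
  have PB: "?P ?B"
  proof (intro conjI allI impI; (elim conjE)?)
    show "bilinear ?B"
      unfolding bilinear_def
      by (auto intro!: linearI simp: sum.distrib algebra_simps sum_distrib_left)
    fix vs ws assume "length vs = i" "length ws = i" "set vs \<subseteq> D q" "set ws \<subseteq> D q"
    then show "?B (tens vs) (tens ws) = (\<Prod>j<i. g q (vs ! j) (ws ! j))"
      using prod_inner_eq_tens[of vs ws "ks 1" "\<lambda>l. \<nu> l q" "g q"] linear_\<nu>_horizontal[OF q]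
        inner_eq_sum[OF q] by (simp add: subset_iff)
  qed
  then have P: "?P (tensor_inner D g i q)" unfolding tensor_inner_def by (rule someI[of ?P ?B])
  have fr: "tensor_inner D g i q (tens_frame I q) (tens_frame J q) = ?B (tens_frame I q) (tens_frame J q)"
    if I: "I \<in> multi_index (ks 1) i" and J: "J \<in> multi_index (ks 1) i" for I J
  proof -
    have a: "length (map (\<lambda>l. X l q) I) = i \<and> length (map (\<lambda>l. X l q) J) = i \<and>
        set (map (\<lambda>l. X l q) I) \<subseteq> D q \<and> set (map (\<lambda>l. X l q) J) \<subseteq> D q"
      using I J X_in_flag[OF q, of _ 1] by (auto simp: multi_index_def)
    show ?thesis
      using P[THEN conjunct2, rule_format, OF a] PB[THEN conjunct2, rule_format, OF a] by simp
  qed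
  let ?z = "\<lambda>I. Z (covec I q) *\<^sub>R tens_frame I q" and ?w = "\<lambda>I. W (covec I q) *\<^sub>R tens_frame I q"
  let ?M = "multi_index (ks 1) i"
  have e: "B Z W = (\<Sum>(I, J)\<in>?M \<times> ?M. (Z (covec I q) * W (covec J q)) * B (tens_frame I q) (tens_frame J q))"
    if B: "bilinear B" for B :: "(('a tvec \<Rightarrow> real) list \<Rightarrow> real) \<Rightarrow> (('a tvec \<Rightarrow> real) list \<Rightarrow> real) \<Rightarrow> real"
  proof -
    have "B Z W = B (sum ?z ?M) (sum ?w ?M)"
      using tensor_power_expand[OF q Z(1)] tensor_power_expand[OF q Z(2)] by (rule arg_cong2)
    also have "\<dots> = (\<Sum>(I, J)\<in>?M \<times> ?M. B (?z I) (?w J))" by (rule bilinear_sum[OF B])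
    finally show ?thesis by (simp add: bilinear_lmul[OF B] bilinear_rmul[OF B] mult_ac)
  qed
  show ?thesis
    unfolding e[OF P[THEN conjunct1]] e[OF PB[THEN conjunct1]]
    by (intro sum.cong refl) (auto simp: fr)
qed

abbreviation layer_indices :: "nat \<Rightarrow> nat set" where
  "layer_indices i \<equiv> {ks (i - 1)..<ks i}"

text \<open>
  Classes are functions of the covectors that vanish on the subspace, so a coordinate of a class is
  read off by applying the class to the covector.
\<close>

lemma cls_coordinate:
  assumes q: "q \<in> U" and h: "ks (i - 1) \<le> h" "h < mdim A"
  shows "cls i q v (\<nu> h q) = \<nu> h q v"
proof -
  have "\<nu> h q w = 0" if "w \<in> F (i - 1) q" for w
    using flag_iff[OF q, of w "i - 1"] that flag_tangent[of "i - 1" q] h by blast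
  then show ?thesis using linear_\<nu>[OF q h(2)] by (simp add: qclass_def)
qed

lemma cls_expand:
  assumes q: "q \<in> U" and i: "i \<ge> 1" and v: "v \<in> F i q"
  shows "cls i q v = (\<Sum>h\<in>layer_indices i. \<nu> h q v *\<^sub>R cls i q (X h q))"
proof -
  have le: "ks (i - 1) \<le> ks i" using ks_mono[OF q, of "i - 1" i] by simp
  have un: "{..<ks (i - 1)} \<union> layer_indices i = {..<ks i}" using le by auto
  have disj: "{..<ks (i - 1)} \<inter> layer_indices i = {}" by auto
  have "(\<Sum>h<ks i. \<nu> h q v *\<^sub>R X h q) =
      (\<Sum>h<ks (i - 1). \<nu> h q v *\<^sub>R X h q) + (\<Sum>h\<in>layer_indices i. \<nu> h q v *\<^sub>R X h q)"
    using sum.union_disjoint[OF finite_lessThan finite_atLeastLessThan disj] unfolding un .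
  then have "v = (\<Sum>h<ks (i - 1). \<nu> h q v *\<^sub>R X h q) + (\<Sum>h\<in>layer_indices i. \<nu> h q v *\<^sub>R X h q)"
    using flag_expand[OF q v] by (rule trans[rotated])
  then have "v - (\<Sum>h\<in>layer_indices i. \<nu> h q v *\<^sub>R X h q) = (\<Sum>h<ks (i - 1). \<nu> h q v *\<^sub>R X h q)"
    unfolding diff_eq_eq .
  moreover have "\<dots> \<in> F (i - 1) q"
    by (intro subspace_sum subspace_scale subspace_flag X_in_flag[OF q]) auto
  ultimately have "cls i q v = cls i q (\<Sum>h\<in>layer_indices i. \<nu> h q v *\<^sub>R X h q)"
    unfolding qclass_eq_iff[OF subspace_flag] by (simp only:)
  then show ?thesis
    by (simp only: linear_sum[OF linear_qclass] linear_scale[OF linear_qclass])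
qed

lemma E_in_flag:
  assumes "q \<in> U" "i \<ge> 1" "I \<in> multi_index (ks 1) i"
  shows "E I q \<in> F i q"
  using E_section[OF assms(3,2)] assms(1) by (simp add: smooth_section_def)

text \<open>
  The entries of \<open>B\<^sub>i\<close>, indexed by the positions \<open>h\<close> and \<open>l\<close> in the whole frame. The structure
  constants are replaced by the coordinates \<open>\<nu> h q (E I q)\<close>, with which they agree in layer \<open>i\<close>;
  this gives the identity matrix for \<open>i = 1\<close> without a case distinction.
\<close>

definition gram :: "nat \<Rightarrow> 'a \<Rightarrow> nat \<Rightarrow> nat \<Rightarrow> real" where
  "gram i q h l = (\<Sum>I\<in>multi_index (ks 1) i. \<nu> h q (E I q) * \<nu> l q (E I q))"

lemma gram_quadratic:
  "(\<Sum>h\<in>S. \<Sum>l\<in>S. u h * gram i q h l * w l) =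
    (\<Sum>I\<in>multi_index (ks 1) i. (\<Sum>h\<in>S. \<nu> h q (E I q) * u h) * (\<Sum>l\<in>S. \<nu> l q (E I q) * w l))"
proof -
  let ?M = "multi_index (ks 1) i"
  have "(\<Sum>I\<in>?M. (\<Sum>h\<in>S. \<nu> h q (E I q) * u h) * (\<Sum>l\<in>S. \<nu> l q (E I q) * w l)) =
    (\<Sum>I\<in>?M. \<Sum>h\<in>S. \<Sum>l\<in>S. u h * (\<nu> h q (E I q) * \<nu> l q (E I q)) * w l)"
    unfolding sum_product by (intro sum.cong refl) (simp add: mult_ac)
  also have "\<dots> = (\<Sum>h\<in>S. \<Sum>I\<in>?M. \<Sum>l\<in>S. u h * (\<nu> h q (E I q) * \<nu> l q (E I q)) * w l)"
    by (rule sum.swap)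
  also have "\<dots> = (\<Sum>h\<in>S. \<Sum>l\<in>S. \<Sum>I\<in>?M. u h * (\<nu> h q (E I q) * \<nu> l q (E I q)) * w l)"
    by (intro sum.cong refl sum.swap)
  also have "\<dots> = (\<Sum>h\<in>S. \<Sum>l\<in>S. u h * gram i q h l * w l)"
    by (simp add: gram_def sum_distrib_left sum_distrib_right)
  finally show ?thesis by simp
qed

lemma gram_sym: "gram i q h l = gram i q l h"
  by (simp add: gram_def mult.commute)

text \<open>
  Invertibility of \<open>B\<^sub>i\<close>. The quadratic form of \<open>B\<^sub>i\<close> at \<open>c\<close> is the sum of the squares of
  \<open>\<phi> (E I q)\<close>, where \<open>\<phi> = \<Sum>\<^sub>l c l \<nu> l\<close>. If \<open>c\<close> is in the kernel, then \<open>\<phi>\<close> vanishes on all brackets of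
  length \<open>i\<close>, and on shorter ones because they lie in \<open>F (i - 1)\<close>. As brackets span \<open>F i\<close>, the functional
  vanishes on the frame fields of the layer, on which its values are the entries of \<open>c\<close>.
\<close>

lemma gram_kernel:
  assumes q: "q \<in> U" and i: "i \<ge> 1"
    and ker: "\<And>h. h \<in> layer_indices i \<Longrightarrow> (\<Sum>l\<in>layer_indices i. gram i q h l * c l) = 0"
    and h: "h \<in> layer_indices i"
  shows "c h = 0"
proof -
  let ?N = "layer_indices i" and ?M = "multi_index (ks 1) i"
  have n: "ks i \<le> mdim A" using ks_le[OF q] .
  have "(\<Sum>I\<in>?M. (\<Sum>h\<in>?N. \<nu> h q (E I q) * c h)\<^sup>2) = (\<Sum>h\<in>?N. c h * (\<Sum>l\<in>?N. gram i q h l * c l))"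
    unfolding power2_eq_square gram_quadratic[symmetric]
    by (simp add: sum_distrib_left mult.assoc)
  also have "\<dots> = 0" by (simp add: ker)
  finally have "\<forall>I\<in>?M. (\<Sum>h\<in>?N. \<nu> h q (E I q) * c h)\<^sup>2 = 0"
    by (subst (asm) sum_nonneg_eq_0_iff) auto
  then have ann: "(\<Sum>l\<in>?N. \<nu> l q (E I q) * c l) = 0" if "I \<in> ?M" for I using that by simp
  define \<phi> where "\<phi> v = (\<Sum>l\<in>?N. c l *\<^sub>R \<nu> l q v)" for v
  have lin: "linear \<phi>"
    unfolding \<phi>_def using n linear_\<nu>[OF q]
    by (intro linear_compose_sum ballI linear_compose_scale_right) auto
  have "\<phi> v = 0" if v: "v \<in> F i q" for v
  proof (rule linear_eq_0_on_span[OF lin])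
    show "v \<in> span ((\<lambda>I. E I q) ` {I. I \<noteq> [] \<and> length I \<le> i \<and> set I \<subseteq> {..<ks 1}})"
      using v unfolding flag_eq_bracket_span[OF q] bracket_span_def .
    fix x assume "x \<in> (\<lambda>I. E I q) ` {I. I \<noteq> [] \<and> length I \<le> i \<and> set I \<subseteq> {..<ks 1}}"
    then obtain I where I: "x = E I q" "I \<noteq> []" "length I \<le> i" "set I \<subseteq> {..<ks 1}" by blast
    show "\<phi> x = 0"
    proof (cases "length I = i")
      case True
      then show ?thesis using ann[of I] I unfolding \<phi>_def I(1) by (simp add: multi_index_def mult.commute)
    next
      case False
      have "x \<in> F (i - 1) q"
      proof -
        have "1 \<le> length I" "length I \<le> i - 1" using I(2,3) False by (cases I; simp)+
        then show ?thesis
          unfolding I(1) using E_in_flag[OF q, of "length I" I] I(4) flag_mono[of "length I" "i - 1" q]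
          by (auto simp: multi_index_def)
      qed
      then have "\<nu> l q x = 0" if "l \<in> ?N" for l
        using flag_iff[OF q, of x "i - 1"] flag_tangent[of "i - 1" q] that n by auto
      then show ?thesis by (simp add: \<phi>_def)
    qed
  qed
  then have "\<phi> (X h q) = 0" using X_in_flag[OF q, of h i] h by simp
  moreover have "\<phi> (X h q) = (\<Sum>l\<in>?N. if l = h then c l else 0)"
    unfolding \<phi>_def using h n by (intro sum.cong refl) (auto simp: \<nu>_X[OF q])
  ultimately show ?thesis using h by (simp add: sum.delta)
qed

text \<open>
  Least squares. The candidate \<open>z\<close> lies in the row space of the constraints, so the difference between
  it and any other feasible tensor is orthogonal to it, and Pythagoras shows that it is shortest.
\<close>

lemma quot_norm_eq:
  assumes q: "q \<in> U" and i: "i \<ge> 1"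
    and w: "\<And>h. h \<in> layer_indices i \<Longrightarrow> (\<Sum>l\<in>layer_indices i. gram i q h l * w l) = y h"
  shows "quot_norm A D g i q (\<Sum>h\<in>layer_indices i. y h *\<^sub>R cls i q (X h q)) =
      sqrt (\<Sum>h\<in>layer_indices i. w h * y h)"
    and "0 \<le> (\<Sum>h\<in>layer_indices i. w h * y h)"
proof -
  let ?N = "layer_indices i" and ?M = "multi_index (ks 1) i"
  let ?Y = "\<Sum>h\<in>?N. y h *\<^sub>R cls i q (X h q)"
  have n: "ks i \<le> mdim A" using ks_le[OF q] .
  define z where "z I = (\<Sum>l\<in>?N. \<nu> l q (E I q) * w l)" for I
  define Z0 where "Z0 = (\<Sum>I\<in>?M. z I *\<^sub>R tens_frame I q)"
  have z_y: "(\<Sum>I\<in>?M. z I * \<nu> h q (E I q)) = y h" if "h \<in> ?N" for h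
  proof -
    have "(\<Sum>I\<in>?M. z I * \<nu> h q (E I q)) = (\<Sum>I\<in>?M. \<Sum>l\<in>?N. \<nu> h q (E I q) * \<nu> l q (E I q) * w l)"
      by (simp add: z_def sum_distrib_left mult_ac)
    also have "\<dots> = (\<Sum>l\<in>?N. \<Sum>I\<in>?M. \<nu> h q (E I q) * \<nu> l q (E I q) * w l)" by (rule sum.swap)
    also have "\<dots> = (\<Sum>l\<in>?N. gram i q h l * w l)" by (simp add: gram_def sum_distrib_right)
    finally show ?thesis using w[OF that] by simp
  qed
  have zz: "(\<Sum>I\<in>?M. z I * z I) = (\<Sum>h\<in>?N. w h * y h)"
  proof -
    have "(\<Sum>I\<in>?M. z I * z I) = (\<Sum>h\<in>?N. w h * (\<Sum>l\<in>?N. gram i q h l * w l))"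
      unfolding z_def gram_quadratic[symmetric] by (simp add: sum_distrib_left mult.assoc)
    then show ?thesis using w by simp
  qed
  then show "0 \<le> (\<Sum>h\<in>?N. w h * y h)" 
    unfolding zz[symmetric] by (intro sum_nonneg) simp
  have Z0: "Z0 \<in> tensor_power i (D q)"
    unfolding Z0_def using tens_frame_in_power[OF q] subspace_span
    by (intro subspace_sum subspace_scale) (auto simp: tensor_power_def)
  have Z0c: "Z0 (covec J q) = z J" if J: "J \<in> ?M" for J
  proof -
    have "Z0 (covec J q) = (\<Sum>I\<in>?M. if I = J then z I else 0)"
      unfolding Z0_def sum_fun_apply using tens_frame_covec[OF q _ J] by (intro sum.cong refl) simp
    then show ?thesis using J by (simp add: sum.delta)
  qed
  have pZ0: "popp_map A D i q Z0 = ?Y"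
  proof -
    have "popp_map A D i q Z0 = (\<Sum>I\<in>?M. z I *\<^sub>R (\<Sum>h\<in>?N. \<nu> h q (E I q) *\<^sub>R cls i q (X h q)))"
      unfolding popp_map_eq[OF q i Z0] using Z0c cls_expand[OF q i E_in_flag[OF q i]]
      by (intro sum.cong refl) (simp only:)
    also have "\<dots> = (\<Sum>I\<in>?M. \<Sum>h\<in>?N. (z I * \<nu> h q (E I q)) *\<^sub>R cls i q (X h q))"
      by (simp only: scaleR_sum_right scaleR_scaleR)
    also have "\<dots> = (\<Sum>h\<in>?N. \<Sum>I\<in>?M. (z I * \<nu> h q (E I q)) *\<^sub>R cls i q (X h q))" by (rule sum.swap)
    also have "\<dots> = (\<Sum>h\<in>?N. (\<Sum>I\<in>?M. z I * \<nu> h q (E I q)) *\<^sub>R cls i q (X h q))"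
      by (simp only: scaleR_sum_left)
    also have "\<dots> = ?Y" by (intro sum.cong refl) (simp only: z_y)
    finally show ?thesis .
  qed
  have inZ0: "tensor_inner D g i q Z0 Z0 = (\<Sum>h\<in>?N. w h * y h)"
    unfolding tensor_inner_eq[OF q Z0 Z0] zz[symmetric] by (intro sum.cong refl) (simp add: Z0c)
  have coord: "(\<Sum>I\<in>?M. Z (covec I q) * \<nu> h q (E I q)) = y h"
    if Z: "Z \<in> tensor_power i (D q)" "popp_map A D i q Z = ?Y" and h: "h \<in> ?N" for Z h
  proof -
    have hh: "ks (i - 1) \<le> h" "h < mdim A" using h n by auto
    have "popp_map A D i q Z (\<nu> h q) = (\<Sum>I\<in>?M. Z (covec I q) * \<nu> h q (E I q))"
      unfolding popp_map_eq[OF q i Z(1)] by (simp add: sum_fun_apply cls_coordinate[OF q hh])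
    moreover have "?Y (\<nu> h q) = (\<Sum>l\<in>?N. if l = h then y l else 0)"
      unfolding sum_fun_apply scaleR_fun_apply cls_coordinate[OF q hh]
      using hh n by (intro sum.cong refl) (auto simp: \<nu>_X[OF q])
    ultimately show ?thesis using Z(2) h by (simp add: sum.delta)
  qed
  have min: "(\<Sum>h\<in>?N. w h * y h) \<le> tensor_inner D g i q Z Z"
    if Z: "Z \<in> tensor_power i (D q)" "popp_map A D i q Z = ?Y" for Z
  proof -
    \<comment> \<open>equals \<open>\<Sum>z I * z I\<close>: the difference of the two tensors is orthogonal to \<open>z\<close>\<close>
    have cross: "(\<Sum>I\<in>?M. Z (covec I q) * z I) = (\<Sum>h\<in>?N. w h * y h)"
    proof -
      have "(\<Sum>I\<in>?M. Z (covec I q) * z I) = (\<Sum>I\<in>?M. \<Sum>h\<in>?N. w h * (Z (covec I q) * \<nu> h q (E I q)))"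
        by (simp add: z_def sum_distrib_left mult_ac)
      also have "\<dots> = (\<Sum>h\<in>?N. \<Sum>I\<in>?M. w h * (Z (covec I q) * \<nu> h q (E I q)))" by (rule sum.swap)
      also have "\<dots> = (\<Sum>h\<in>?N. w h * (\<Sum>I\<in>?M. Z (covec I q) * \<nu> h q (E I q)))"
        by (simp add: sum_distrib_left)
      finally show ?thesis using coord[OF Z] by simp
    qed
    have "0 \<le> (\<Sum>I\<in>?M. (Z (covec I q) - z I)\<^sup>2)" by (simp add: sum_nonneg)
    also have "\<dots> = (\<Sum>I\<in>?M. Z (covec I q) * Z (covec I q)) - 2 * (\<Sum>I\<in>?M. Z (covec I q) * z I)
        + (\<Sum>I\<in>?M. z I * z I)"
      by (simp add: power2_eq_square algebra_simps sum.distrib sum_subtractf sum_distrib_left)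
    also have "\<dots> = tensor_inner D g i q Z Z - (\<Sum>h\<in>?N. w h * y h)"
      unfolding cross zz tensor_inner_eq[OF q Z(1) Z(1)] by simp
    finally show ?thesis by simp
  qed
  show "quot_norm A D g i q ?Y = sqrt (\<Sum>h\<in>?N. w h * y h)"
    unfolding quot_norm_def
  proof (rule Least_equality)
    show "\<exists>Z\<in>tensor_power i (D q). popp_map A D i q Z = ?Y \<and>
        sqrt (\<Sum>h\<in>?N. w h * y h) = sqrt (tensor_inner D g i q Z Z)"
      using Z0 pZ0 inZ0 by (intro bexI[of _ Z0]) simp_all
    fix r assume "\<exists>Z\<in>tensor_power i (D q). popp_map A D i q Z = ?Y \<and> r = sqrt (tensor_inner D g i q Z Z)"
    then obtain Z where "Z \<in> tensor_power i (D q)" "popp_map A D i q Z = ?Y"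
      "r = sqrt (tensor_inner D g i q Z Z)" by (elim bexE conjE) (rule that)
    then show "sqrt (\<Sum>h\<in>?N. w h * y h) \<le> r" using min by simp
  qed
qed

text \<open>
  Polarization. The solution \<open>w\<close> depends linearly on \<open>y\<close>, so the norms of the sum and the difference
  are covered by the formula for the norm; the two mixed terms agree because the Gram matrix is
  symmetric.
\<close>

lemma quot_inner_eq:
  assumes q: "q \<in> U" and i: "i \<ge> 1"
    and w: "\<And>h. h \<in> layer_indices i \<Longrightarrow> (\<Sum>l\<in>layer_indices i. gram i q h l * w l) = y h"
    and w': "\<And>h. h \<in> layer_indices i \<Longrightarrow> (\<Sum>l\<in>layer_indices i. gram i q h l * w' l) = y' h"
  shows "quot_inner A D g i q (\<Sum>h\<in>layer_indices i. y h *\<^sub>R cls i q (X h q))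
     (\<Sum>h\<in>layer_indices i. y' h *\<^sub>R cls i q (X h q)) = (\<Sum>h\<in>layer_indices i. w h * y' h)"
proof -
  let ?N = "layer_indices i"
  let ?Y = "\<lambda>y. \<Sum>h\<in>?N. y h *\<^sub>R cls i q (X h q)"
  have add: "?Y y + ?Y y' = ?Y (\<lambda>h. y h + y' h)"
    by (simp only: scaleR_add_left sum.distrib)
  have diff: "?Y y - ?Y y' = ?Y (\<lambda>h. y h - y' h)"
    by (simp only: scaleR_diff_left sum_subtractf)
  have p: "(quot_norm A D g i q (?Y y + ?Y y'))\<^sup>2 = (\<Sum>h\<in>?N. (w h + w' h) * (y h + y' h))"
    unfolding add using quot_norm_eq[OF q i, of "\<lambda>h. w h + w' h" "\<lambda>h. y h + y' h"] w w'
    by (simp add: distrib_left sum.distrib)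
  have m: "(quot_norm A D g i q (?Y y - ?Y y'))\<^sup>2 = (\<Sum>h\<in>?N. (w h - w' h) * (y h - y' h))"
    unfolding diff using quot_norm_eq[OF q i, of "\<lambda>h. w h - w' h" "\<lambda>h. y h - y' h"] w w'
    by (simp add: right_diff_distrib sum_subtractf)
  have "(\<Sum>h\<in>?N. w' h * y h) = (\<Sum>h\<in>?N. \<Sum>l\<in>?N. w' h * gram i q h l * w l)"
    using w by (simp add: sum_distrib_left[symmetric] mult.assoc)
  also have "\<dots> = (\<Sum>l\<in>?N. \<Sum>h\<in>?N. w' h * gram i q h l * w l)" by (rule sum.swap)
  also have "\<dots> = (\<Sum>l\<in>?N. w l * (\<Sum>h\<in>?N. gram i q l h * w' h))"
    by (simp add: sum_distrib_left mult_ac gram_sym)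
  also have "\<dots> = (\<Sum>h\<in>?N. w h * y' h)" using w' by simp
  finally have s: "(\<Sum>h\<in>?N. w' h * y h) = (\<Sum>h\<in>?N. w h * y' h)" .
  have "(\<Sum>h\<in>?N. (w h + w' h) * (y h + y' h)) - (\<Sum>h\<in>?N. (w h - w' h) * (y h - y' h)) =
      2 * (\<Sum>h\<in>?N. w h * y' h) + 2 * (\<Sum>h\<in>?N. w' h * y h)"
    by (simp add: sum_subtractf[symmetric] sum_distrib_left sum.distrib[symmetric] algebra_simps)
  then show ?thesis unfolding quot_inner_def p m s by simp
qed

end

section \<open>Determinants and wedge products\<close>

text \<open>
  In the Leibniz expansion only permutations \<open>\<pi>\<close> with \<open>f h \<le> f (\<pi> h)\<close> for all \<open>h\<close> contribute. Both sides
  have the same sum over \<open>h\<close>, so equality holds throughout and \<open>\<pi>\<close> preserves the blocks.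
\<close>

lemma det_block_triangular:
  fixes C :: "nat \<Rightarrow> nat \<Rightarrow> real" and f :: "nat \<Rightarrow> nat"
  assumes "\<And>h l. h < n \<Longrightarrow> l < n \<Longrightarrow> f l < f h \<Longrightarrow> C h l = 0"
  shows "det (mat n n (\<lambda>(h, l). C h l)) = det (mat n n (\<lambda>(h, l). if f h = f l then C h l else 0))"
proof -
  have "(\<Prod>h = 0..<n. C h (\<pi> h)) = (\<Prod>h = 0..<n. if f h = f (\<pi> h) then C h (\<pi> h) else 0)"
    if \<pi>: "\<pi> permutes {0..<n}" for \<pi>
  proof (cases "\<forall>h<n. f h = f (\<pi> h)")
    case True
    then show ?thesis by (intro prod.cong) auto
  next
    case False
    then obtain h0 where h0: "h0 < n" "f h0 \<noteq> f (\<pi> h0)" by blast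
    have "\<exists>h<n. f (\<pi> h) < f h"
    proof (rule ccontr)
      assume "\<not> ?thesis"
      then have le: "f h \<le> f (\<pi> h)" if "h \<in> {0..<n}" for h
        using that by (metis atLeastLessThan_iff not_less)
      have "(\<Sum>h = 0..<n. f h) < (\<Sum>h = 0..<n. f (\<pi> h))"
      proof (rule sum_strict_mono_ex1)
        show "\<exists>a\<in>{0..<n}. f a < f (\<pi> a)" using h0 le[of h0] by (intro bexI[of _ h0]) auto
      qed (use le in auto)
      then show False using sum.permute[OF \<pi>, of f] by (simp add: comp_def)
    qed
    then obtain h where h: "h < n" "f (\<pi> h) < f h" by blast
    have "C h (\<pi> h) = 0" using assms[OF h(1) _ h(2)] permutes_in_image[OF \<pi>, of h] h(1) by simp
    then have "(\<Prod>h = 0..<n. C h (\<pi> h)) = 0" using h(1) by (intro prod_zero) auto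
    moreover have "(\<Prod>h = 0..<n. if f h = f (\<pi> h) then C h (\<pi> h) else 0) = 0"
      using h by (intro prod_zero) (auto intro!: bexI[of _ h])
    ultimately show ?thesis by (rule trans[OF _ sym])
  qed
  then have eq: "signof \<pi> * (\<Prod>h = 0..<n. C h (\<pi> h)) =
      signof \<pi> * (\<Prod>h = 0..<n. if f h = f (\<pi> h) then C h (\<pi> h) else 0)"
    if "\<pi> permutes {0..<n}" for \<pi> using that by simp
  have det_eq: "det (mat n n (\<lambda>(h, l). M h l)) =
      (\<Sum>\<pi> | \<pi> permutes {0..<n}. signof \<pi> * (\<Prod>h = 0..<n. M h (\<pi> h)))" for M :: "nat \<Rightarrow> nat \<Rightarrow> real"
    by (subst det_def'[of _ n]) (auto intro!: sum.cong prod.cong simp: permutes_in_image)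
  show ?thesis unfolding det_eq using eq by (intro sum.cong) auto
qed

lemma wedge_combination:
  assumes "length vs = n" "length ys = n"
    and "\<And>l. l < n \<Longrightarrow> vs ! l = (\<Sum>h<n. C h l *\<^sub>R ys ! h)"
  shows "wedge vs = det (mat n n (\<lambda>(h, l). C h l)) *\<^sub>R wedge ys"
proof
  fix \<alpha>s
  show "wedge vs \<alpha>s = (det (mat n n (\<lambda>(h, l). C h l)) *\<^sub>R wedge ys) \<alpha>s"
  proof (cases "length \<alpha>s = n \<and> (\<forall>\<alpha>\<in>set \<alpha>s. linear \<alpha>)")
    case True
    have "(\<alpha>s ! i) (vs ! l) = (\<Sum>h<n. (\<alpha>s ! i) (ys ! h) * C h l)" if "i < n" "l < n" for i l
    proof -
      have lin: "linear (\<alpha>s ! i)" using True that by simp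
      show ?thesis
        unfolding assms(3)[OF that(2)] by (simp add: linear_sum[OF lin] linear_scale[OF lin] mult.commute)
    qed
    then have "mat n n (\<lambda>(i, j). (\<alpha>s ! i) (vs ! j)) =
        mat n n (\<lambda>(i, j). (\<alpha>s ! i) (ys ! j)) * mat n n (\<lambda>(h, l). C h l)"
      by (intro eq_matI) (auto simp: scalar_prod_def atLeast0LessThan)
    then show ?thesis
      using True assms(1,2) det_mult[of "mat n n (\<lambda>(i, j). (\<alpha>s ! i) (ys ! j))" n "mat n n (\<lambda>(h, l). C h l)"]
      by (simp add: wedge_def mult.commute)
  qed (use assms(1,2) in \<open>auto simp: wedge_def\<close>)
qed

lemma matrix_right_inverse:
  fixes M :: "real mat"
  assumes "M \<in> carrier_mat n n" "det M \<noteq> 0"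
  obtains N where "N \<in> carrier_mat n n" "M * N = 1\<^sub>m n"
  using det_non_zero_imp_unit[OF assms, of "()"] by (auto simp: Units_def ring_mat_def)

section \<open>The graded space\<close>

context adapted
begin

lemma layer_indices_layer:
  assumes q: "q \<in> U" and l: "l < mdim A"
  shows "1 \<le> layer ks l" "layer ks l \<le> m" "l \<in> layer_indices (layer ks l)"
proof -
  have lm: "l < ks m" using l ks_step[OF q] by simp
  have a: "l < ks (layer ks l)" unfolding layer_def using lm by (rule LeastI)
  show "layer ks l \<le> m" unfolding layer_def using lm by (rule Least_le)
  show 1: "1 \<le> layer ks l" using a ks_0[OF q] by (cases "layer ks l") auto
  have "\<not> l < ks (layer ks l - 1)"
    using 1 not_less_Least[of "layer ks l - 1" "\<lambda>i. l < ks i"] by (simp add: layer_def[symmetric])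
  then show "l \<in> layer_indices (layer ks l)" using a by simp
qed

lemma layer_eq:
  assumes q: "q \<in> U" and l: "l \<in> layer_indices i"
  shows "layer ks l = i"
  unfolding layer_def
proof (rule Least_equality)
  show "l < ks i" using l by simp
  fix j assume "l < ks j"
  show "i \<le> j"
  proof (rule ccontr)
    assume "\<not> i \<le> j"
    then have "j \<le> i - 1" by linarith
    then show False using ks_mono[OF q, of j "i - 1"] l \<open>l < ks j\<close> by simp
  qed
qed

lemma sum_layers:
  assumes q: "q \<in> U"
  shows "(\<Sum>h<ks i. f h) = (\<Sum>j=1..i. \<Sum>h\<in>layer_indices j. f h :: real)"
proof (induction i)
  case 0
  then show ?case using ks_0[OF q] by simp
next
  case (Suc i)
  have le: "ks i \<le> ks (Suc i)" using ks_mono[OF q] by simp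
  have "{..<ks (Suc i)} = {..<ks i} \<union> {ks i..<ks (Suc i)}" using le by auto
  then have "(\<Sum>h<ks (Suc i). f h) = (\<Sum>h<ks i. f h) + (\<Sum>h\<in>{ks i..<ks (Suc i)}. f h)"
    using sum.union_disjoint[of "{..<ks i}" "{ks i..<ks (Suc i)}" f] by (simp add: ivl_disj_int)
  then show ?case using Suc.IH by simp
qed

text \<open>
  The block diagonal matrix with the blocks \<open>B\<^sub>1, \<dots>, B\<^sub>m\<close>. Working with one matrix for the whole frame
  turns the statements about the layers into a single determinant identity.
\<close>

definition block_gram :: "'a \<Rightarrow> nat \<Rightarrow> nat \<Rightarrow> real" where
  "block_gram q h l = (if layer ks h = layer ks l then gram (layer ks h) q h l else 0)"

definition gram_mat :: "nat \<Rightarrow> 'a \<Rightarrow> real mat" where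
  "gram_mat i q = mat (ks i - ks (i - 1)) (ks i - ks (i - 1))
     (\<lambda>(h, l). gram i q (ks (i - 1) + h) (ks (i - 1) + l))"

lemma det_block_gram:
  assumes q: "q \<in> U"
  shows "det (mat (ks i) (ks i) (\<lambda>(h, l). block_gram q h l)) = (\<Prod>j=1..i. det (gram_mat j q))"
proof (induction i)
  case 0
  then show ?case using ks_0[OF q] by simp
next
  case (Suc i)
  let ?r = "ks (Suc i) - ks i"
  let ?M = "mat (ks i) (ks i) (\<lambda>(h, l). block_gram q h l)"
  have le: "ks i \<le> ks (Suc i)" using ks_mono[OF q] by simp
  have G: "gram_mat (Suc i) q \<in> carrier_mat ?r ?r" by (simp add: gram_mat_def)
  have lay: "layer ks h = Suc i" if "ks i \<le> h" "h < ks (Suc i)" for h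
    using layer_eq[OF q, of h "Suc i"] that by simp
  have lay': "layer ks h \<le> i" if "h < ks i" for h
    unfolding layer_def using that by (rule Least_le)
  have "mat (ks (Suc i)) (ks (Suc i)) (\<lambda>(h, l). block_gram q h l) =
    four_block_mat ?M (0\<^sub>m (ks i) ?r) (0\<^sub>m ?r (ks i)) (gram_mat (Suc i) q)"
  proof (rule eq_matI)
    fix h l
    assume "h < dim_row (four_block_mat ?M (0\<^sub>m (ks i) ?r) (0\<^sub>m ?r (ks i)) (gram_mat (Suc i) q))"
      "l < dim_col (four_block_mat ?M (0\<^sub>m (ks i) ?r) (0\<^sub>m ?r (ks i)) (gram_mat (Suc i) q))"
    then have hl: "h < ks (Suc i)" "l < ks (Suc i)" using le by (auto simp: gram_mat_def)
    show "mat (ks (Suc i)) (ks (Suc i)) (\<lambda>(h, l). block_gram q h l) $$ (h, l) =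
      four_block_mat ?M (0\<^sub>m (ks i) ?r) (0\<^sub>m ?r (ks i)) (gram_mat (Suc i) q) $$ (h, l)"
    proof -
      have "four_block_mat ?M (0\<^sub>m (ks i) ?r) (0\<^sub>m ?r (ks i)) (gram_mat (Suc i) q) $$ (h, l) =
        (if h < ks i then if l < ks i then block_gram q h l else 0
         else if l < ks i then 0 else gram (Suc i) q h l)"
        using hl le G unfolding gram_mat_def by (subst index_mat_four_block(1)) auto
      moreover have "layer ks h = Suc i" if "\<not> h < ks i" using lay[of h] hl that by simp
      moreover have "layer ks l = Suc i" if "\<not> l < ks i" using lay[of l] hl that by simp
      ultimately show ?thesis
        using hl lay'[of h] lay'[of l] by (cases "h < ks i"; cases "l < ks i") (simp_all add: block_gram_def)
    qed
  qed (use le G in simp_all)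
  then have "det (mat (ks (Suc i)) (ks (Suc i)) (\<lambda>(h, l). block_gram q h l)) =
      det ?M * det (gram_mat (Suc i) q)"
    using det_four_block_mat_lower_left_zero[of ?M "ks i" "0\<^sub>m (ks i) ?r" ?r "0\<^sub>m ?r (ks i)", OF _ _ _ G]
    by simp
  then show ?case using Suc.IH by simp
qed

lemma block_gram_row:
  assumes q: "q \<in> U" and h: "h \<in> layer_indices i"
  shows "(\<Sum>l<mdim A. block_gram q h l * w l) = (\<Sum>l\<in>layer_indices i. gram i q h l * w l)"
proof (rule sum.mono_neutral_cong_right)
  show "layer_indices i \<subseteq> {..<mdim A}" using ks_le[OF q, of i] by auto
  have lh: "layer ks h = i" using layer_eq[OF q h] .
  show "\<forall>l\<in>{..<mdim A} - layer_indices i. block_gram q h l * w l = 0"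
    using layer_indices_layer(3)[OF q] lh by (auto simp: block_gram_def)
  show "block_gram q h l * w l = gram i q h l * w l" if "l \<in> layer_indices i" for l
    using layer_eq[OF q that] lh by (simp add: block_gram_def)
qed simp

abbreviation gram_block_mat :: "'a \<Rightarrow> real mat" where
  "gram_block_mat q \<equiv> mat (mdim A) (mdim A) (\<lambda>(h, l). block_gram q h l)"

lemma mult_mat_vec_eq:
  assumes "dim_vec v = n" "h < n"
  shows "(mat n n (\<lambda>(h, l). M h l) *\<^sub>v v) $ h = (\<Sum>l<n. M h l * v $ l :: real)"
  using assms by (simp add: scalar_prod_def atLeast0LessThan)

lemma det_gram_block_mat_nonzero:
  assumes q: "q \<in> U"
  shows "det (gram_block_mat q) \<noteq> 0"
proof
  assume "det (gram_block_mat q) = 0"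
  then obtain v where v: "v \<in> carrier_vec (mdim A)" "v \<noteq> 0\<^sub>v (mdim A)"
    "gram_block_mat q *\<^sub>v v = 0\<^sub>v (mdim A)"
    using det_0_iff_vec_prod_zero_field[of "gram_block_mat q" "mdim A"] by auto
  have d: "dim_vec v = mdim A" using v(1) by simp
  have row: "(\<Sum>l<mdim A. block_gram q h l * v $ l) = 0" if "h < mdim A" for h
    using mult_mat_vec_eq[OF d that, of "block_gram q"] v(3) that by simp
  have "v $ h = 0" if h: "h < mdim A" for h
  proof -
    let ?i = "layer ks h"
    note L = layer_indices_layer[OF q h]
    have "(\<Sum>l\<in>layer_indices ?i. gram ?i q h' l * v $ l) = 0" if h': "h' \<in> layer_indices ?i" for h'
      using row[of h'] block_gram_row[OF q h', of "\<lambda>l. v $ l"] ks_le[OF q, of ?i] h' by simp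
    then show ?thesis by (rule gram_kernel[OF q L(1) _ L(3)])
  qed
  then have "v = 0\<^sub>v (mdim A)" using d by (intro eq_vecI) auto
  then show False using v(2) by simp
qed

abbreviation gr_frame :: "'a \<Rightarrow> nat \<Rightarrow> 'a gvec" where
  "gr_frame q l \<equiv> gr_class A D q (layer ks l) (X l q)"

lemma gr_combination:
  assumes q: "q \<in> U" and j: "1 \<le> j"
  shows "(\<Sum>l<mdim A. a l *\<^sub>R gr_frame q l) j = (\<Sum>l\<in>layer_indices j. a l *\<^sub>R cls j q (X l q))"
proof -
  have "(\<Sum>l<mdim A. a l *\<^sub>R gr_frame q l) j = (\<Sum>l<mdim A. a l *\<^sub>R gr_frame q l j)"
    by (simp only: sum_fun_apply scaleR_fun_apply)
  also have "\<dots> = (\<Sum>l\<in>layer_indices j. a l *\<^sub>R cls j q (X l q))"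
  proof (rule sum.mono_neutral_cong_right)
    show "layer_indices j \<subseteq> {..<mdim A}" using ks_le[OF q, of j] by auto
    show "\<forall>l\<in>{..<mdim A} - layer_indices j. a l *\<^sub>R gr_frame q l j = 0"
    proof
      fix l assume l: "l \<in> {..<mdim A} - layer_indices j"
      then have "j \<noteq> layer ks l" using layer_indices_layer(3)[OF q, of l] by auto
      then show "a l *\<^sub>R gr_frame q l j = 0" by (simp only: gr_class_def if_False scaleR_zero_right)
    qed
    show "a l *\<^sub>R gr_frame q l j = a l *\<^sub>R cls j q (X l q)" if "l \<in> layer_indices j" for l
      using layer_eq[OF q that] by (simp only: gr_class_def if_True refl)
  qed simp
  finally show ?thesis .
qed

lemma gr_combination_outside:
  assumes q: "q \<in> U" and j: "j \<notin> {1..m}"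
  shows "(\<Sum>l<mdim A. a l *\<^sub>R gr_frame q l) j = 0"
proof -
  have "(\<Sum>l<mdim A. a l *\<^sub>R gr_frame q l) j = (\<Sum>l<mdim A. a l *\<^sub>R gr_frame q l j)"
    by (simp only: sum_fun_apply scaleR_fun_apply)
  also have "\<dots> = 0"
  proof (rule sum.neutral, rule ballI)
    fix l assume l: "l \<in> {..<mdim A}"
    then have "j \<noteq> layer ks l" using layer_indices_layer(1,2)[OF q, of l] j by auto
    then show "a l *\<^sub>R gr_frame q l j = 0" by (simp only: gr_class_def if_False scaleR_zero_right)
  qed
  finally show ?thesis .
qed

lemma gr_class_expand:
  assumes q: "q \<in> U" and i: "i \<in> {1..m}" and v: "v \<in> F i q"
  shows "gr_class A D q i v = (\<Sum>h<mdim A. (if layer ks h = i then \<nu> h q v else 0) *\<^sub>R gr_frame q h)"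
proof
  fix j
  show "gr_class A D q i v j = (\<Sum>h<mdim A. (if layer ks h = i then \<nu> h q v else 0) *\<^sub>R gr_frame q h) j"
  proof (cases "j \<in> {1..m}")
    case False
    then have "j \<noteq> i" using i by blast
    then show ?thesis unfolding gr_combination_outside[OF q False] by (simp only: gr_class_def if_False)
  next
    case True
    then have j: "1 \<le> j" by simp
    have c: "(\<Sum>h<mdim A. (if layer ks h = i then \<nu> h q v else 0) *\<^sub>R gr_frame q h) j =
      (\<Sum>h\<in>layer_indices j. (if j = i then \<nu> h q v else 0) *\<^sub>R cls j q (X h q))"
      unfolding gr_combination[OF q j] by (intro sum.cong refl) (simp only: layer_eq[OF q])
    show ?thesis
    proof (cases "j = i")
      case True
      then show ?thesis unfolding c using cls_expand[OF q j, of v] v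
        by (simp only: gr_class_def refl if_True)
    next
      case False
      then show ?thesis unfolding c by (simp only: gr_class_def if_False scaleR_zero_left sum.neutral_const)
    qed
  qed
qed

lemma gr_space_expand:
  assumes q: "q \<in> U" and Y: "Y \<in> gr_space A D m q"
  shows "\<exists>a. Y = (\<Sum>l<mdim A. a l *\<^sub>R gr_frame q l)"
proof -
  have "\<forall>i\<in>{1..m}. \<exists>v. v \<in> F i q \<and> Y i = cls i q v"
    using Y unfolding gr_space_def by blast
  then obtain v where v: "\<And>i. i \<in> {1..m} \<Longrightarrow> v i \<in> F i q" "\<And>i. i \<in> {1..m} \<Longrightarrow> Y i = cls i q (v i)"
    by (metis (no_types, lifting))
  have Y0: "Y i = 0" if "i \<notin> {1..m}" for i using Y that unfolding gr_space_def by blast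
  have "Y = (\<Sum>l<mdim A. \<nu> l q (v (layer ks l)) *\<^sub>R gr_frame q l)"
  proof
    fix j
    show "Y j = (\<Sum>l<mdim A. \<nu> l q (v (layer ks l)) *\<^sub>R gr_frame q l) j"
    proof (cases "j \<in> {1..m}")
      case False
      then show ?thesis using gr_combination_outside[OF q False] Y0 by metis
    next
      case True
      then have j: "1 \<le> j" by simp
      have "(\<Sum>l<mdim A. \<nu> l q (v (layer ks l)) *\<^sub>R gr_frame q l) j =
        (\<Sum>l\<in>layer_indices j. \<nu> l q (v j) *\<^sub>R cls j q (X l q))"
        unfolding gr_combination[OF q j] by (intro sum.cong refl) (simp only: layer_eq[OF q])
      then show ?thesis using cls_expand[OF q j v(1)[OF True]] v(2)[OF True] by metis
    qed
  qed
  then show ?thesis by (rule exI[of _ "\<lambda>l. \<nu> l q (v (layer ks l))"])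
qed

text \<open>
  The Gram matrix of the classes of the frame is the inverse of the block matrix. The inverse
  appears only through solutions \<open>w\<close> and \<open>w'\<close> of linear systems. As the matrix is block diagonal, the
  restriction of a solution to a layer solves the system of that layer.
\<close>

lemma gr_inner_eq:
  assumes q: "q \<in> U"
    and w: "\<And>h. h < mdim A \<Longrightarrow> (\<Sum>l<mdim A. block_gram q h l * w l) = a h"
    and w': "\<And>h. h < mdim A \<Longrightarrow> (\<Sum>l<mdim A. block_gram q h l * w' l) = a' h"
  shows "gr_inner A D g m q (\<Sum>l<mdim A. a l *\<^sub>R gr_frame q l) (\<Sum>l<mdim A. a' l *\<^sub>R gr_frame q l)
     = (\<Sum>h<mdim A. w h * a' h)"
proof -
  have "gr_inner A D g m q (\<Sum>l<mdim A. a l *\<^sub>R gr_frame q l) (\<Sum>l<mdim A. a' l *\<^sub>R gr_frame q l)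
     = (\<Sum>i=1..m. \<Sum>h\<in>layer_indices i. w h * a' h)"
    unfolding gr_inner_def
  proof (rule sum.cong[OF refl])
    fix i assume "i \<in> {1..m}"
    then have i: "1 \<le> i" by simp
    have lt: "h < mdim A" if "h \<in> layer_indices i" for h using that ks_le[OF q, of i] by simp
    show "quot_inner A D g i q ((\<Sum>l<mdim A. a l *\<^sub>R gr_frame q l) i) ((\<Sum>l<mdim A. a' l *\<^sub>R gr_frame q l) i)
       = (\<Sum>h\<in>layer_indices i. w h * a' h)"
      unfolding gr_combination[OF q i]
    proof (rule quot_inner_eq[OF q i])
      fix h assume h: "h \<in> layer_indices i"
      show "(\<Sum>l\<in>layer_indices i. gram i q h l * w l) = a h"
        using w[OF lt[OF h]] block_gram_row[OF q h, of w] by simp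
      show "(\<Sum>l\<in>layer_indices i. gram i q h l * w' l) = a' h"
        using w'[OF lt[OF h]] block_gram_row[OF q h, of w'] by simp
    qed
  qed
  also have "\<dots> = (\<Sum>h<mdim A. w h * a' h)"
    using sum_layers[OF q, of "\<lambda>h. w h * a' h" m] ks_step[OF q] by simp
  finally show ?thesis .
qed

text \<open>
  Let \<open>H\<close> be the block matrix, \<open>M\<close> the coordinates of the orthonormal basis in the frame of
  classes, and \<open>N\<close> those of the classes in the orthonormal basis. Then \<open>N M = 1\<close>, and
  orthonormality says \<open>(H\<^sup>-\<^sup>1 M)\<^sup>T M = 1\<close>; taking determinants gives \<open>det H = (det M)\<^sup>2\<close>.
\<close>

lemma det_orthonormal_dual:
  assumes q: "q \<in> U" and Ys: "gr_orthonormal_basis A D g m q Ys" and \<xi>s: "dual_family Ys \<xi>s"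
  shows "(det (mat (mdim A) (mdim A) (\<lambda>(i, j). (\<xi>s ! i) (gr_frame q j))))\<^sup>2 *
      det (gram_block_mat q) = 1"
proof -
  let ?n = "mdim A"
  have len: "length Ys = ?n" using Ys by (simp add: gr_orthonormal_basis_def)
  have "Ys ! i \<in> gr_space A D m q" if "i < ?n" for i
  proof -
    have "Ys ! i \<in> span ((!) Ys ` {..<?n})" using that by (intro span_base) simp
    then show ?thesis using Ys unfolding gr_orthonormal_basis_def basis_family_def by blast
  qed
  then have "\<forall>i\<in>{..<?n}. \<exists>a. Ys ! i = (\<Sum>l<?n. a l *\<^sub>R gr_frame q l)"
    using gr_space_expand[OF q] by simp
  then obtain a where "\<forall>i\<in>{..<?n}. Ys ! i = (\<Sum>l<?n. a i l *\<^sub>R gr_frame q l)"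
    unfolding bchoice_iff by (elim exE) (rule that)
  then have a: "Ys ! i = (\<Sum>l<?n. a i l *\<^sub>R gr_frame q l)" if "i < ?n" for i using that by simp
  define M where "M = mat ?n ?n (\<lambda>(l, i). a i l)"
  let ?H = "gram_block_mat q"
  have Mc: "M \<in> carrier_mat ?n ?n" and Hc: "?H \<in> carrier_mat ?n ?n" by (simp_all add: M_def)
  obtain G where G: "G \<in> carrier_mat ?n ?n" "?H * G = 1\<^sub>m ?n"
    using matrix_right_inverse[OF Hc det_gram_block_mat_nonzero[OF q]] by blast
  \<comment> \<open>the columns of \<open>W\<close> solve the linear systems for the basis vectors\<close>
  define W where "W = G * M"
  have Wc: "W \<in> carrier_mat ?n ?n" using G Mc by (simp add: W_def)
  have HW: "?H * W = M"
    unfolding W_def using assoc_mult_mat[OF Hc G(1) Mc] G(2) Mc by simp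
  have w: "(\<Sum>l<?n. block_gram q h l * W $$ (l, i)) = a i h" if "h < ?n" "i < ?n" for h i
  proof -
    have "(?H * W) $$ (h, i) = (\<Sum>l<?n. block_gram q h l * W $$ (l, i))"
      using that Wc by (simp add: scalar_prod_def atLeast0LessThan)
    then show ?thesis using that unfolding HW by (simp add: M_def)
  qed
  have "transpose_mat W * M = 1\<^sub>m ?n"
  proof (rule eq_matI)
    fix i j assume ij': "i < dim_row (1\<^sub>m ?n :: real mat)" "j < dim_col (1\<^sub>m ?n :: real mat)"
    then have ij: "i < ?n" "j < ?n" by auto
    have "(transpose_mat W * M) $$ (i, j) = (\<Sum>h<?n. W $$ (h, i) * a j h)"
      using ij Wc Mc by (simp add: scalar_prod_def atLeast0LessThan M_def)
    also have "\<dots> = gr_inner A D g m q (Ys ! i) (Ys ! j)"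
      unfolding a[OF ij(1)] a[OF ij(2)]
      using gr_inner_eq[OF q w w, OF _ ij(1) _ ij(2), symmetric] .
    also have "\<dots> = 1\<^sub>m ?n $$ (i, j)" using Ys ij by (simp add: gr_orthonormal_basis_def)
    finally show "(transpose_mat W * M) $$ (i, j) = 1\<^sub>m ?n $$ (i, j)" .
  qed (use Wc Mc in auto)
  then have WM: "det W * det M = 1"
    using det_mult[of "transpose_mat W" ?n M] det_transpose[OF Wc] Wc Mc by simp
  have HdW: "det ?H * det W = det M"
    using det_mult[OF Hc Wc] HW by simp
  let ?N = "mat ?n ?n (\<lambda>(i, j). (\<xi>s ! i) (gr_frame q j))"
  have "?N * M = 1\<^sub>m ?n"
  proof (rule eq_matI)
    fix i j assume ij': "i < dim_row (1\<^sub>m ?n :: real mat)" "j < dim_col (1\<^sub>m ?n :: real mat)"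
    then have ij: "i < ?n" "j < ?n" by auto
    have lin: "linear (\<xi>s ! i)" using \<xi>s len ij by (simp add: dual_family_def)
    have "(\<xi>s ! i) (Ys ! j) = (\<Sum>l<?n. a j l * (\<xi>s ! i) (gr_frame q l))"
      unfolding a[OF ij(2)] by (simp only: linear_sum[OF lin] linear_scale[OF lin] real_scaleR_def)
    then have "(?N * M) $$ (i, j) = (\<xi>s ! i) (Ys ! j)"
      using ij by (simp add: scalar_prod_def atLeast0LessThan M_def mult.commute)
    also have "\<dots> = 1\<^sub>m ?n $$ (i, j)" using \<xi>s len ij by (simp add: dual_family_def)
    finally show "(?N * M) $$ (i, j) = 1\<^sub>m ?n $$ (i, j)" .
  qed (use Mc in auto)
  then have NM: "det ?N * det M = 1"
    using det_mult[of ?N ?n M] Mc by simp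
  have "(det ?N)\<^sup>2 * det ?H = (det ?N)\<^sup>2 * det ?H * (det W * det M)" unfolding WM by simp
  also have "\<dots> = (det ?N)\<^sup>2 * (det ?H * det W) * det M" by (simp add: mult_ac)
  also have "\<dots> = (det ?N * det M)\<^sup>2" unfolding HdW by (simp add: power2_eq_square mult_ac)
  finally show ?thesis unfolding NM by simp
qed

section \<open>Exterior powers\<close>

lemma wedge_covectors:
  assumes q: "q \<in> U" and "length vs = mdim A"
  shows "wedge vs (frame_at A \<nu> q) = det (mat (mdim A) (mdim A) (\<lambda>(h, l). \<nu> h q (vs ! l)))"
proof -
  have "mat (mdim A) (mdim A) (\<lambda>(i, j). (frame_at A \<nu> q ! i) (vs ! j)) =
    mat (mdim A) (mdim A) (\<lambda>(h, l). \<nu> h q (vs ! l))"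
    by (intro eq_matI) (auto simp: frame_at_def)
  then show ?thesis
    using assms linear_\<nu>[OF q] by (auto simp: wedge_def frame_at_def)
qed

lemma wedge_frame_covectors:
  assumes q: "q \<in> U"
  shows "wedge (frame_at A X q) (frame_at A \<nu> q) = 1"
proof -
  have "mat (mdim A) (mdim A) (\<lambda>(h, l). \<nu> h q (frame_at A X q ! l)) = 1\<^sub>m (mdim A)"
    by (intro eq_matI) (auto simp: frame_at_def \<nu>_X[OF q])
  then show ?thesis by (subst wedge_covectors[OF q]) (auto simp: frame_at_def)
qed

lemma wedge_frame_in_ext_power:
  assumes q: "q \<in> U"
  shows "wedge (frame_at A X q) \<in> ext_power (mdim A) (tangent_space A q)"
  unfolding ext_power_def using vector_field_tangent[OF X_field q]
  by (intro span_base CollectI exI[of _ "frame_at A X q"]) (auto simp: frame_at_def)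

text \<open>
  The top exterior power is a line spanned by the wedge of the frame, with the value on the coframe
  as coordinate.
\<close>

lemma ext_power_expand:
  assumes q: "q \<in> U" and \<Omega>: "\<Omega> \<in> ext_power (mdim A) (tangent_space A q)"
  shows "\<Omega> = \<Omega> (frame_at A \<nu> q) *\<^sub>R wedge (frame_at A X q)"
proof -
  have lin: "linear (\<lambda>\<Omega> :: ('a tvec \<Rightarrow> real) list \<Rightarrow> real. \<Omega> (frame_at A \<nu> q) *\<^sub>R wedge (frame_at A X q))"
    by (rule linearI) (simp_all add: scaleR_add_left)
  have "(\<lambda>\<Omega>. \<Omega>) \<Omega> = \<Omega> (frame_at A \<nu> q) *\<^sub>R wedge (frame_at A X q)"
  proof (rule linear_eq_on_span[OF linear_ident lin, OF _ \<Omega>[unfolded ext_power_def]])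
    fix T assume "T \<in> {wedge vs |vs. length vs = mdim A \<and> set vs \<subseteq> tangent_space A q}"
    then obtain vs where T: "T = wedge vs" "length vs = mdim A" "set vs \<subseteq> tangent_space A q" by blast
    show "T = T (frame_at A \<nu> q) *\<^sub>R wedge (frame_at A X q)"
      unfolding T(1) wedge_covectors[OF q T(2)]
    proof (rule wedge_combination[OF T(2)])
      fix l assume l: "l < mdim A"
      have "vs ! l = (\<Sum>h<mdim A. \<nu> h q (vs ! l) *\<^sub>R X h q)"
        using tangent_expand[OF q, of "vs ! l"] T l by (auto simp: subset_iff)
      also have "\<dots> = (\<Sum>h<mdim A. \<nu> h q (vs ! l) *\<^sub>R frame_at A X q ! h)"
        by (intro sum.cong refl) (simp add: frame_at_def)
      finally show "vs ! l = (\<Sum>h<mdim A. \<nu> h q (vs ! l) *\<^sub>R frame_at A X q ! h)" .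
    qed (simp add: frame_at_def)
  qed
  then show ?thesis .
qed

lemma adapted_basis_frame:
  assumes q: "q \<in> U"
  shows "adapted_basis A D ks q (frame_at A X q)"
proof -
  have nth: "frame_at A X q ! l = X l q" if "l < mdim A" for l using that by (simp add: frame_at_def)
  have bf: "basis_family r ((!) (frame_at A X q)) V" if "basis_family r (\<lambda>l. X l q) V" "r \<le> mdim A" for r V
  proof -
    have "(!) (frame_at A X q) ` {..<r} = (\<lambda>l. X l q) ` {..<r}"
      using nth that(2) by (intro image_cong) auto
    moreover have "inj_on ((!) (frame_at A X q)) {..<r} = inj_on (\<lambda>l. X l q) {..<r}"
      using nth that(2) by (intro inj_on_cong) auto
    ultimately show ?thesis using that(1) by (simp add: basis_family_def)
  qed
  show ?thesis
    unfolding adapted_basis_def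
    using bf[OF basis_tangent[OF q]] bf[OF basis_flag[OF q] ks_le[OF q]] by (simp add: frame_at_def)
qed

text \<open>
  In the line above, a map with the values that define \<open>theta\<close> sends \<open>\<Omega>\<close> to its coordinate times the
  wedge of the classes of the frame. On an adapted basis the coordinate is the determinant of the full
  change of basis, whereas the classes of the basis vectors only see the blocks on the diagonal. The two
  determinants agree because adapted bases are related by block triangular matrices.
\<close>

lemma theta_frame:
  assumes q: "q \<in> U"
  shows "linear (theta A D ks q)"
    and "theta A D ks q (wedge (frame_at A X q)) = wedge (map (gr_frame q) [0..<mdim A])"
proof -
  let ?n = "mdim A"
  let ?P = "\<lambda>\<theta>. linear \<theta> \<and> (\<forall>vs. adapted_basis A D ks q vs \<longrightarrow>
        \<theta> (wedge vs) = wedge (map (\<lambda>l. gr_class A D q (layer ks l) (vs ! l)) [0..<?n]))"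
  let ?\<theta> = "\<lambda>\<Omega> :: ('a tvec \<Rightarrow> real) list \<Rightarrow> real.
    \<Omega> (frame_at A \<nu> q) *\<^sub>R wedge (map (gr_frame q) [0..<?n])"
  have "?P ?\<theta>"
  proof (intro conjI allI impI)
    show "linear ?\<theta>" by (rule linearI) (simp_all add: scaleR_add_left)
    fix vs assume vs: "adapted_basis A D ks q vs"
    then have len: "length vs = ?n" by (simp add: adapted_basis_def)
    have inF: "vs ! l \<in> F i q" if "l < ks i" for l i
    proof -
      have "vs ! l \<in> span ((!) vs ` {..<ks i})" using that by (intro span_base) simp
      then show ?thesis using vs unfolding adapted_basis_def basis_family_def by blast
    qed
    have inL: "vs ! l \<in> F (layer ks l) q" if "l < ?n" for l
      using layer_indices_layer(3)[OF q that] by (intro inF) simp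
    have zero: "\<nu> h q (vs ! l) = 0" if "h < ?n" "l < ?n" "layer ks l < layer ks h" for h l
    proof -
      have "ks (layer ks l) \<le> ks (layer ks h - 1)"
        using that by (intro ks_mono[OF q]) simp
      also have "\<dots> \<le> h" using layer_indices_layer(3)[OF q that(1)] by simp
      finally show ?thesis
        using flag_iff[OF q, of "vs ! l" "layer ks l"] inL[OF that(2)] flag_tangent[of "layer ks l" q] that(1)
        by blast
    qed
    have "wedge (map (\<lambda>l. gr_class A D q (layer ks l) (vs ! l)) [0..<?n]) =
      det (mat ?n ?n (\<lambda>(h, l). if layer ks h = layer ks l then \<nu> h q (vs ! l) else 0)) *\<^sub>R
        wedge (map (gr_frame q) [0..<?n])"
    proof (rule wedge_combination)
      fix l assume l: "l < ?n"
      have "gr_class A D q (layer ks l) (vs ! l) =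
        (\<Sum>h<?n. (if layer ks h = layer ks l then \<nu> h q (vs ! l) else 0) *\<^sub>R gr_frame q h)"
        using layer_indices_layer(1,2)[OF q l] by (intro gr_class_expand[OF q _ inL[OF l]]) simp
      also have "\<dots> = (\<Sum>h<?n. (if layer ks h = layer ks l then \<nu> h q (vs ! l) else 0) *\<^sub>R
          map (gr_frame q) [0..<?n] ! h)"
        by (intro sum.cong refl) simp
      finally show "map (\<lambda>l. gr_class A D q (layer ks l) (vs ! l)) [0..<?n] ! l =
        (\<Sum>h<?n. (if layer ks h = layer ks l then \<nu> h q (vs ! l) else 0) *\<^sub>R
          map (gr_frame q) [0..<?n] ! h)"
        using l by (simp only: nth_map_upt diff_zero add_0)
    qed simp_all
    then show "?\<theta> (wedge vs) = wedge (map (\<lambda>l. gr_class A D q (layer ks l) (vs ! l)) [0..<?n])"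
      unfolding wedge_covectors[OF q len]
      using det_block_triangular[of ?n "layer ks" "\<lambda>h l. \<nu> h q (vs ! l)", OF zero] by (simp only:)
  qed
  then have P: "?P (theta A D ks q)" unfolding theta_def by (rule someI[of ?P ?\<theta>])
  then show "linear (theta A D ks q)" by blast
  have "map (\<lambda>l. gr_class A D q (layer ks l) (frame_at A X q ! l)) [0..<?n] = map (gr_frame q) [0..<?n]"
    by (intro map_cong refl) (simp add: frame_at_def)
  then show "theta A D ks q (wedge (frame_at A X q)) = wedge (map (gr_frame q) [0..<?n])"
    using P[THEN conjunct2, rule_format, OF adapted_basis_frame[OF q]] by (simp only:)
qed

section \<open>The volume form in the adapted frame\<close>

lemma structure_constant_eq:
  assumes q: "q \<in> U" and b: "structure_constants A D ks m U X b" and j: "2 \<le> j" "j \<le> m"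
    and I: "I \<in> multi_index (ks 1) j" and h: "h \<in> layer_indices j"
  shows "b I h q = \<nu> h q (E I q)"
proof -
  have hn: "h < mdim A" using h ks_le[OF q, of j] by simp
  let ?S = "\<Sum>l\<in>layer_indices j. b I l q *\<^sub>R X l q"
  have "E I q - ?S \<in> F (j - 1) q"
    using b q j I unfolding structure_constants_def multi_index_def by auto
  then have "\<nu> h q (E I q - ?S) = 0"
    using flag_iff[OF q, of "E I q - ?S" "j - 1"] flag_tangent[of "j - 1" q] hn h by auto
  then have "\<nu> h q (E I q) = \<nu> h q ?S" using linear_diff[OF linear_\<nu>[OF q hn]] by simp
  also have "\<dots> = b I h q"
    using h hn ks_le[OF q, of j] by (subst \<nu>_combination[OF q hn]) auto
  finally show ?thesis by simp
qed

text \<open>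
  For \<open>j = 1\<close> the brackets are the frame fields themselves, and their coordinates form the identity.
\<close>

lemma structure_matrix_eq:
  assumes q: "q \<in> U" and b: "structure_constants A D ks m U X b" and j: "j \<in> {1..m}"
  shows "structure_matrix ks b j q = gram_mat j q"
proof (cases "j = 1")
  case True
  have k: "ks 1 \<le> mdim A" using ks_le[OF q] .
  have "gram 1 q h l = (if h = l then 1 else 0)" if "h < ks 1" "l < ks 1" for h l
  proof -
    have "gram 1 q h l = (\<Sum>a<ks 1. \<nu> h q (X a q) * \<nu> l q (X a q))"
      unfolding gram_def One_nat_def sum_multi_index_Suc by simp
    also have "\<dots> = (\<Sum>a<ks 1. if a = h then (if h = l then 1 else 0) else 0)"
      using that by (intro sum.cong refl) (auto simp: \<nu>_X_horizontal[OF q])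
    finally show ?thesis using that by (simp add: sum.delta)
  qed
  then have "gram_mat 1 q = 1\<^sub>m (ks 1)"
    unfolding gram_mat_def using ks_0[OF q] by (intro eq_matI) auto
  then show ?thesis using True by (simp add: structure_matrix_def)
next
  case False
  have j2: "2 \<le> j" "j \<le> m" using j False by auto
  note e = structure_constant_eq[OF q b j2]
  have "structure_matrix ks b j q = mat (ks j - ks (j - 1)) (ks j - ks (j - 1)) (\<lambda>(h, l).
        \<Sum>I\<in>multi_index (ks 1) j. b I (ks (j - 1) + h) q * b I (ks (j - 1) + l) q)"
    using False by (simp add: structure_matrix_def multi_index_def)
  also have "\<dots> = gram_mat j q"
    unfolding gram_mat_def gram_def
    by (intro eq_matI) (auto intro!: sum.cong simp: e)
  finally show ?thesis .
qed

lemma popp_form_on_frame: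
  assumes q: "q \<in> U" and b: "structure_constants A D ks m U X b"
    and Ys: "gr_orthonormal_basis A D g m q Ys" and \<xi>s: "dual_family Ys \<xi>s"
  defines "\<Delta> \<equiv> \<Prod>j=1..m. det (structure_matrix ks b j q)"
  shows "0 < \<Delta>"
    and "\<exists>\<epsilon>\<in>{1, -1}. \<forall>\<Omega>\<in>ext_power (mdim A) (tangent_space A q).
      wedge_form \<xi>s (theta A D ks q \<Omega>) = \<epsilon> * (1 / sqrt \<Delta> * wedge_form (frame_at A \<nu> q) \<Omega>)"
proof -
  let ?n = "mdim A"
  let ?d = "det (mat ?n ?n (\<lambda>(i, j). (\<xi>s ! i) (gr_frame q j)))"
  have len: "length \<xi>s = ?n" using Ys \<xi>s by (simp add: gr_orthonormal_basis_def dual_family_def)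
  have "\<Delta> = det (gram_block_mat q)"
    using det_block_gram[OF q, of m] ks_step[OF q] structure_matrix_eq[OF q b] by (simp add: \<Delta>_def)
  then have d: "?d\<^sup>2 * \<Delta> = 1" using det_orthonormal_dual[OF q Ys \<xi>s] by simp
  show pos: "0 < \<Delta>"
  proof (rule ccontr)
    assume "\<not> 0 < \<Delta>"
    then have "?d\<^sup>2 * \<Delta> \<le> 0" by (intro mult_nonneg_nonpos) auto
    then show False using d by simp
  qed
  have "(?d * sqrt \<Delta>)\<^sup>2 = 1" using d pos by (simp add: power_mult_distrib)
  then have "?d * sqrt \<Delta> = 1 \<or> ?d * sqrt \<Delta> = -1" by (simp add: power2_eq_1_iff)
  then obtain \<epsilon> :: real where \<epsilon>: "\<epsilon> \<in> {1, -1}" "?d * sqrt \<Delta> = \<epsilon>" by blast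
  then have d\<epsilon>: "?d = \<epsilon> * (1 / sqrt \<Delta>)" using pos by (simp add: field_simps)
  have wd: "wedge (map (gr_frame q) [0..<?n]) \<xi>s = ?d"
  proof -
    have "mat ?n ?n (\<lambda>(i, j). (\<xi>s ! i) (map (gr_frame q) [0..<?n] ! j)) =
        mat ?n ?n (\<lambda>(i, j). (\<xi>s ! i) (gr_frame q j))"
      by (intro eq_matI) auto
    then show ?thesis using len \<xi>s by (simp add: wedge_def dual_family_def)
  qed
  show "\<exists>\<epsilon>\<in>{1, -1}. \<forall>\<Omega>\<in>ext_power (mdim A) (tangent_space A q).
      wedge_form \<xi>s (theta A D ks q \<Omega>) = \<epsilon> * (1 / sqrt \<Delta> * wedge_form (frame_at A \<nu> q) \<Omega>)"
  proof (rule bexI[OF _ \<epsilon>(1)], rule ballI)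
    fix \<Omega> assume \<Omega>: "\<Omega> \<in> ext_power (mdim A) (tangent_space A q)"
    have "theta A D ks q \<Omega> = theta A D ks q (\<Omega> (frame_at A \<nu> q) *\<^sub>R wedge (frame_at A X q))"
      using ext_power_expand[OF q \<Omega>] by (rule arg_cong)
    then have "theta A D ks q \<Omega> = \<Omega> (frame_at A \<nu> q) *\<^sub>R wedge (map (gr_frame q) [0..<?n])"
      by (simp only: linear_scale[OF theta_frame(1)[OF q]] theta_frame(2)[OF q])
    then have "theta A D ks q \<Omega> \<xi>s = \<Omega> (frame_at A \<nu> q) * ?d"
      using wd by (simp only: scaleR_fun_apply real_scaleR_def)
    then show "wedge_form \<xi>s (theta A D ks q \<Omega>) = \<epsilon> * (1 / sqrt \<Delta> * wedge_form (frame_at A \<nu> q) \<Omega>)"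
      unfolding d\<epsilon> by (simp add: wedge_form_def)
  qed
qed

lemma orientation_frame_nonzero:
  assumes q: "q \<in> U" and \<omega>: "orientation A \<omega>"
  shows "\<omega> q (wedge (frame_at A X q)) \<noteq> 0"
proof
  assume z: "\<omega> q (wedge (frame_at A X q)) = 0"
  have lin: "linear (\<omega> q)" using \<omega> by (simp add: orientation_def)
  obtain \<Omega> where \<Omega>: "\<Omega> \<in> ext_power (mdim A) (tangent_space A q)" "\<omega> q \<Omega> \<noteq> 0"
    using \<omega> unfolding orientation_def by blast
  have "\<omega> q \<Omega> = \<omega> q (\<Omega> (frame_at A \<nu> q) *\<^sub>R wedge (frame_at A X q))"
    using ext_power_expand[OF q \<Omega>(1)] by (rule arg_cong)
  then show False using \<Omega>(2) z by (simp only: linear_scale[OF lin] scaleR_zero_right)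
qed

lemma orientation_frame_continuous:
  assumes \<omega>: "orientation A \<omega>"
  shows "continuous_on U (\<lambda>q. \<omega> q (wedge (frame_at A X q)))"
proof -
  have "smooth_fun A U (\<lambda>q. \<omega> q (wedge (map (\<lambda>Y. Y q) (map X [0..<mdim A]))))"
    using open_U X_field
    by (intro \<omega>[unfolded orientation_def, THEN conjunct2, rule_format]) auto
  then show ?thesis
    using smooth_fun_continuous by (simp add: frame_at_def comp_def)
qed

end

theorem theorem1:
  fixes A :: "('a::{t2_space, second_countable_topology}, 'e::euclidean_space) atlas"
    and D :: "'a \<Rightarrow> 'a tvec set"
    and g :: "'a \<Rightarrow> 'a tvec \<Rightarrow> 'a tvec \<Rightarrow> real"
    and k m :: nat
    and ks :: "nat \<Rightarrow> nat"
    and \<omega> P :: "'a \<Rightarrow> (('a tvec \<Rightarrow> real) list \<Rightarrow> real) \<Rightarrow> real"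
    and U :: "'a set"
    and X :: "nat \<Rightarrow> 'a \<Rightarrow> 'a tvec"
    and \<nu> :: "nat \<Rightarrow> 'a \<Rightarrow> 'a tvec \<Rightarrow> real"
    and b :: "nat list \<Rightarrow> nat \<Rightarrow> 'a \<Rightarrow> real"
  assumes "sub_riemannian A D k g"
    and "equiregular A D ks"
    and "has_step A D m"
    and "orientation A \<omega>"
    and "popp_volume A D g ks m \<omega> P"
    and "adapted_frame A D g ks U X"
    and "dual_coframe A U X \<nu>"
    and "structure_constants A D ks m U X b"
  shows
    "(\<forall>q\<in>U. \<exists>\<epsilon>\<in>{1, -1}. \<forall>\<Omega>\<in>ext_power (mdim A) (tangent_space A q).
        P q \<Omega> = \<epsilon> * (1 / sqrt (\<Prod>j=1..m. det (structure_matrix ks b j q)) *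
                     wedge_form (frame_at A \<nu> q) \<Omega>)) \<and>
     (connected U \<longrightarrow> (\<exists>\<epsilon>\<in>{1, -1}. \<forall>q\<in>U. \<forall>\<Omega>\<in>ext_power (mdim A) (tangent_space A q).
        P q \<Omega> = \<epsilon> * (1 / sqrt (\<Prod>j=1..m. det (structure_matrix ks b j q)) *
                     wedge_form (frame_at A \<nu> q) \<Omega>))) \<and>
     ((\<forall>q\<in>U. 0 < \<omega> q (wedge (frame_at A X q))) \<longrightarrow>
        (\<forall>q\<in>U. \<forall>\<Omega>\<in>ext_power (mdim A) (tangent_space A q).
        P q \<Omega> = 1 / sqrt (\<Prod>j=1..m. det (structure_matrix ks b j q)) *
                wedge_form (frame_at A \<nu> q) \<Omega>))"
proof -
  interpret adapted A D g k m ks U X \<nu>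
    using assms by unfold_locales (auto simp: sub_riemannian_def)
  define \<Delta> where "\<Delta> q = (\<Prod>j=1..m. det (structure_matrix ks b j q))" for q
  define R where "R q \<epsilon> \<longleftrightarrow> (\<forall>\<Omega>\<in>ext_power (mdim A) (tangent_space A q).
      P q \<Omega> = \<epsilon> * (1 / sqrt (\<Delta> q) * wedge_form (frame_at A \<nu> q) \<Omega>))" for q \<epsilon>
  let ?W = "\<lambda>q. wedge (frame_at A X q)"
  have pt: "0 < \<Delta> q \<and> (\<exists>\<epsilon>\<in>{1, -1}. R q \<epsilon>)" if q: "q \<in> U" for q
  proof -
    obtain Ys \<xi>s where Ys: "gr_orthonormal_basis A D g m q Ys" "dual_family Ys \<xi>s"
      and P: "\<And>\<Omega>. \<Omega> \<in> ext_power (mdim A) (tangent_space A q) \<Longrightarrow>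
         P q \<Omega> = wedge_form \<xi>s (theta A D ks q \<Omega>)"
      using assms(5) unfolding popp_volume_def by blast
    show ?thesis
      using popp_form_on_frame[OF q assms(8) Ys] unfolding R_def \<Delta>_def by (simp add: P)
  qed
  have P_pos: "0 < P q \<Omega>" if "\<Omega> \<in> ext_power (mdim A) (tangent_space A q)" "0 < \<omega> q \<Omega>" for q \<Omega>
    using assms(5) that unfolding popp_volume_def by blast
  have sign: "R q (sgn (\<omega> q (?W q)))" if q: "q \<in> U" for q
  proof -
    obtain \<epsilon> where \<epsilon>: "\<epsilon> \<in> {1, -1}" "R q \<epsilon>" using pt[OF q] by blast
    have pos: "0 < 1 / sqrt (\<Delta> q)" using pt[OF q] by simp
    have lin: "linear (\<omega> q)" using assms(4) by (simp add: orientation_def)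
    note W = wedge_frame_in_ext_power[OF q]
    \<comment> \<open>Positivity of \<open>P\<close> is only assumed where \<open>\<omega>\<close> is positive, so a frame of negative orientation has
             to be tested with the opposite multivector.\<close>
    have nW: "- ?W q \<in> ext_power (mdim A) (tangent_space A q)"
      using W unfolding ext_power_def by (rule span_neg)
    have PW: "P q (?W q) = \<epsilon> * (1 / sqrt (\<Delta> q))"
      using \<epsilon>(2) W wedge_frame_covectors[OF q] unfolding R_def by (simp add: wedge_form_def)
    have PnW: "P q (- ?W q) = - (\<epsilon> * (1 / sqrt (\<Delta> q)))"
      using \<epsilon>(2) nW wedge_frame_covectors[OF q] unfolding R_def by (simp add: wedge_form_def)
    show ?thesis
    proof (cases "0 < \<omega> q (?W q)")
      case True
      then have "0 < \<epsilon> * (1 / sqrt (\<Delta> q))" using P_pos[OF W True] PW by simp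
      then have "\<epsilon> = 1" using \<epsilon>(1) pos by (auto simp: zero_less_mult_iff)
      then show ?thesis using \<epsilon>(2) True by simp
    next
      case False
      then have neg: "\<omega> q (?W q) < 0" using orientation_frame_nonzero[OF q assms(4)] by simp
      then have "0 < \<omega> q (- ?W q)" using linear_neg[OF lin, of "?W q"] by simp
      then have "0 < - (\<epsilon> * (1 / sqrt (\<Delta> q)))" using P_pos[OF nW] PnW by simp
      then have "\<epsilon> = -1" using \<epsilon>(1) pos by auto
      then show ?thesis using \<epsilon>(2) neg by simp
    qed
  qed
  have const: "\<exists>\<epsilon>\<in>{1, -1}. \<forall>q\<in>U. R q \<epsilon>" if c: "connected U"
  proof (cases "\<exists>p\<in>U. 0 < \<omega> p (?W p)")
    case True
    then obtain p where p: "p \<in> U" "0 < \<omega> p (?W p)" by blast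
    have conn: "connected ((\<lambda>q. \<omega> q (?W q)) ` U)"
      using connected_continuous_image[OF orientation_frame_continuous[OF assms(4)] c] .
    have "0 < \<omega> q (?W q)" if q: "q \<in> U" for q
    proof (rule ccontr)
      assume "\<not> ?thesis"
      then have "0 \<in> (\<lambda>q. \<omega> q (?W q)) ` U"
        using connectedD_interval[OF conn, of "\<omega> q (?W q)" "\<omega> p (?W p)" 0] p q by auto
      then show False using orientation_frame_nonzero[OF _ assms(4)] by auto
    qed
    then have "R q 1" if "q \<in> U" for q using sign[OF that] that by simp
    then show ?thesis by blast
  next
    case False
    then have "R q (-1)" if "q \<in> U" for q
      using sign[OF that] that orientation_frame_nonzero[OF that assms(4)]
      by (metis linorder_neqE_linordered_idom sgn_neg)
    then show ?thesis by blast
  qed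
  have "R q 1" if "\<forall>q\<in>U. 0 < \<omega> q (?W q)" "q \<in> U" for q
    using sign[OF that(2)] that by simp
  then show ?thesis
    using pt const unfolding R_def \<Delta>_def by simp
qed

end
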